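(* Let $E$ be an $AL$-space. Then the weak essential norm $\|\cdot\|_w$ has Bonsall's minimality property on the weak Calkin algebra $\mathscr{B}(E)/\mathscr{W}(E)$; that is, every algebra norm $|||\cdot|||$ on $\mathscr{B}(E)/\mathscr{W}(E)$ satisfying $|||\cdot|||\le\|\cdot\|_w$ is equal to $\|\cdot\|_w$.
   Context: Scalars are real or complex. An $AL$-space is a Banach lattice $E$ with $\|x+y\|=\|x\|+\|y\|$ for all $x,y\in E^+$ (equivalently, up to isometric lattice isomorphism, an $L_1(X,\Sigma,\mu)$-space; complex $AL$-spaces are understood via complex Banach lattices and are likewise the complex $L_1$-spaces). $\mathscr{B}(E)$ is the algebra of bounded linear operators on $E$ and $\mathscr{W}(E)$ the ideal of weakly compact operators (those mapping the unit ball to a relatively weakly compact set). The weak essential norm is the quotient norm $\|T\|_w=\inf\{\|T-W\|: W\in\mathscr{W}(E)\}$ on $\mathscr{B}(E)/\mathscr{W}(E)$. An algebra norm is a submultiplicative norm (completeness is not assumed). *)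

theory Defs
  imports
    "HOL-Analysis.Analysis"
    "HOL-Algebra.QuotRing"
    "HOL-Algebra.Module"
    "HOL-Library.Lattice_Algebras"
begin

section \<open>Banach lattices and AL-spaces\<close>

class banach_lattice = banach + ordered_real_vector + lattice_ab_group_add_abs +
  assumes norm_mono_abs: "\<bar>x\<bar> \<le> \<bar>y\<bar> \<Longrightarrow> norm x \<le> norm y"

class al_space = banach_lattice +
  assumes norm_add_nonneg: "0 \<le> x \<Longrightarrow> 0 \<le> y \<Longrightarrow> norm (x + y) = norm x + norm y"

lemma norm_mono_nonneg:
  fixes x y :: "'a::banach_lattice"
  assumes "0 \<le> x" "x \<le> y"
  shows "norm x \<le> norm y"
  using assms by (intro norm_mono_abs) (auto simp: order.trans)

lemma norm_abs_eq [simp]: "norm \<bar>x\<bar> = norm (x :: 'a::banach_lattice)"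
  by (intro order.antisym norm_mono_abs) auto

lemma banach_lattice_nonneg_limit:
  fixes X :: "nat \<Rightarrow> 'a::banach_lattice"
  assumes "X \<longlonglongrightarrow> x" "\<And>n. 0 \<le> X n"
  shows "0 \<le> x"
proof -
  have "norm (pprt (- x)) \<le> norm (X n - x)" for n
  proof -
    have "- x \<le> X n - x" using assms(2)[of n] by simp
    hence "- x \<le> \<bar>X n - x\<bar>" using abs_ge_self by (rule order.trans)
    hence "pprt (- x) \<le> \<bar>X n - x\<bar>"
      by (simp add: pprt_def)
    hence "norm (pprt (- x)) \<le> norm \<bar>X n - x\<bar>"
      by (intro norm_mono_nonneg) auto
    thus ?thesis by simp
  qed
  moreover have "(\<lambda>n. norm (X n - x)) \<longlonglongrightarrow> 0"
    using assms(1) by (simp add: LIM_zero tendsto_norm_zero)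
  ultimately have "norm (pprt (- x)) \<le> 0"
    by (intro LIMSEQ_le_const[of _ 0]) auto
  hence "pprt (- x) = 0" by simp
  thus ?thesis
    using le_zero_iff_zero_pprt[of "- x"] by simp
qed

lemma banach_lattice_le_limit:
  fixes X Y :: "nat \<Rightarrow> 'a::banach_lattice"
  assumes "X \<longlonglongrightarrow> x" "Y \<longlonglongrightarrow> y" "\<And>n. X n \<le> Y n"
  shows "x \<le> y"
  using banach_lattice_nonneg_limit[OF tendsto_diff[OF assms(2,1)]] assms(3) by simp

lemma banach_lattice_lub_exists:
  fixes A :: "'a::banach_lattice set"
  assumes u: "0 \<le> u"
    and fin: "\<And>e::real. 0 < e \<Longrightarrow>
      \<exists>F. finite F \<and> F \<noteq> {} \<and> F \<subseteq> A \<and> (\<forall>a\<in>A. \<exists>f\<in>F. a \<le> f + e *\<^sub>R u)"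
  shows "\<exists>s. (\<forall>a\<in>A. a \<le> s) \<and> (\<forall>b. (\<forall>a\<in>A. a \<le> b) \<longrightarrow> s \<le> b)"
proof -
  define e where "e n = inverse (real (Suc n))" for n
  have e_pos: "0 < e n" for n by (simp add: e_def)
  have e_lim: "e \<longlonglongrightarrow> 0"
    unfolding e_def by (rule LIMSEQ_inverse_real_of_nat)
  have "\<forall>n. \<exists>F. finite F \<and> F \<noteq> {} \<and> F \<subseteq> A \<and> (\<forall>a\<in>A. \<exists>f\<in>F. a \<le> f + e n *\<^sub>R u)"
    using fin[OF e_pos] by blast
  then obtain F where F: "\<And>n. finite (F n)" "\<And>n. F n \<noteq> {}" "\<And>n. F n \<subseteq> A"
    "\<And>n a. a \<in> A \<Longrightarrow> \<exists>f\<in>F n. a \<le> f + e n *\<^sub>R u"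
    by metis
  define s where "s n = Sup_fin (F n)" for n
  have s_up: "a \<le> s n + e n *\<^sub>R u" if a: "a \<in> A" for a n
  proof -
    obtain f where f: "f \<in> F n" "a \<le> f + e n *\<^sub>R u"
      using F(4)[OF a] by blast
    have "f \<le> s n" unfolding s_def using F(1) f(1) by (rule Sup_fin.coboundedI)
    thus ?thesis using f(2) by (meson add_right_mono order.trans)
  qed
  have s_least: "s n \<le> b" if "\<And>a. a \<in> A \<Longrightarrow> a \<le> b" for n b
    unfolding s_def using F(1,2) by (rule Sup_fin.boundedI) (use F(3) that in blast)
  have s_diff: "s m - s n \<le> e n *\<^sub>R u" for m n
    using s_least[of "s n + e n *\<^sub>R u" m] s_up by (simp add: algebra_simps)
  have s_norm: "norm (s m - s n) \<le> max (e m) (e n) * norm u" for m n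
  proof -
    have "\<bar>s m - s n\<bar> \<le> max (e m) (e n) *\<^sub>R u"
    proof (rule abs_leI)
      show "s m - s n \<le> max (e m) (e n) *\<^sub>R u"
        using s_diff[of m n] scaleR_right_mono[OF max.cobounded2 u] by (rule order.trans)
      have "s n - s m \<le> max (e m) (e n) *\<^sub>R u"
        using s_diff[of n m] scaleR_right_mono[OF max.cobounded1 u] by (rule order.trans)
      thus "- (s m - s n) \<le> max (e m) (e n) *\<^sub>R u" by simp
    qed
    hence "norm \<bar>s m - s n\<bar> \<le> norm (max (e m) (e n) *\<^sub>R u)"
      by (intro norm_mono_nonneg) auto
    thus ?thesis using e_pos[of m] e_pos[of n] by (simp add: max_def split: if_splits)
  qed
  have "Cauchy s"
  proof (rule metric_CauchyI)
    fix r :: real assume r: "0 < r"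
    have "(\<lambda>n. e n * norm u) \<longlonglongrightarrow> 0"
      using tendsto_mult_right[OF e_lim, of "norm u"] by simp
    then obtain N where N: "\<And>n. n \<ge> N \<Longrightarrow> e n * norm u < r"
      using r e_pos by (auto simp: lim_sequentially dist_real_def abs_mult)
        (metis abs_of_pos e_pos)
    show "\<exists>M. \<forall>m\<ge>M. \<forall>n\<ge>M. dist (s m) (s n) < r"
    proof (intro exI allI impI)
      fix m n assume "N \<le> m" "N \<le> n"
      hence "max (e m) (e n) * norm u < r" using N by (simp add: max_def)
      thus "dist (s m) (s n) < r" using s_norm[of m n] by (simp add: dist_norm)
    qed
  qed
  then obtain l where l: "s \<longlonglongrightarrow> l"
    using Cauchy_convergent convergent_def by blast
  have "a \<le> l" if a: "a \<in> A" for a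
  proof -
    have "(\<lambda>n. s n + e n *\<^sub>R u) \<longlonglongrightarrow> l + 0 *\<^sub>R u"
      by (intro tendsto_intros l e_lim)
    thus ?thesis using banach_lattice_le_limit[of "\<lambda>_. a" a] s_up[OF a] by force
  qed
  moreover have "l \<le> b" if "\<forall>a\<in>A. a \<le> b" for b
    using banach_lattice_le_limit[OF l, of "\<lambda>_. b" b] s_least that by auto
  ultimately show ?thesis by blast
qed


section \<open>The complexification of a Banach lattice\<close>

text \<open>A complex Banach lattice is by definition the complexification of a real one, with norm
  \<open>\<parallel>z\<parallel> = \<parallel> |z| \<parallel>\<close>, where the modulus of \<open>z = x + iy\<close> is
  \<open>|z| = sup {cos \<theta> x + sin \<theta> y | \<theta> real}\<close>.\<close>

datatype 'a complexification = Complexification (re_part: 'a) (im_part: 'a)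

definition modulus :: "'a::banach_lattice complexification \<Rightarrow> 'a" where
  "modulus z = (LEAST s. \<forall>\<theta>::real. cos \<theta> *\<^sub>R re_part z + sin \<theta> *\<^sub>R im_part z \<le> s)"

lemma scaleR_le_abs:
  fixes x :: "'a::banach_lattice"
  shows "c *\<^sub>R x \<le> \<bar>c\<bar> *\<^sub>R \<bar>x\<bar>"
proof (cases "0 \<le> c")
  case True
  thus ?thesis using scaleR_left_mono[OF abs_ge_self True] by simp
next
  case False
  have "(- c) *\<^sub>R (- x) \<le> (- c) *\<^sub>R \<bar>x\<bar>"
    using False abs_ge_minus_self by (intro scaleR_left_mono) auto
  thus ?thesis using False by simp
qed

lemma modulus_exists:
  fixes x y :: "'a::banach_lattice"
  shows "\<exists>s. (\<forall>\<theta>. cos \<theta> *\<^sub>R x + sin \<theta> *\<^sub>R y \<le> s) \<and>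
    (\<forall>b. (\<forall>\<theta>. cos \<theta> *\<^sub>R x + sin \<theta> *\<^sub>R y \<le> b) \<longrightarrow> s \<le> b)"
proof -
  define g where "g p = fst p *\<^sub>R x + snd p *\<^sub>R y" for p :: "real \<times> real"
  define u where "u = \<bar>x\<bar> + \<bar>y\<bar>"
  define C where "C = sphere (0 :: real \<times> real) 1"
  have u: "0 \<le> u" by (simp add: u_def)
  have C: "C = range (\<lambda>\<theta>. (cos \<theta>, sin \<theta>))"
  proof (intro Set.set_eqI iffI)
    fix p assume "p \<in> C"
    hence "(fst p)\<^sup>2 + (snd p)\<^sup>2 = 1"
      by (cases p) (simp add: C_def norm_Pair)
    then obtain t where "fst p = cos t" "snd p = sin t"
      using sincos_total_2pi_le by blast
    thus "p \<in> range (\<lambda>\<theta>. (cos \<theta>, sin \<theta>))" by (intro range_eqI[of _ _ t]) (simp add: prod_eq_iff)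
  qed (auto simp: C_def norm_Pair)
  have g_le: "g p \<le> g q + e *\<^sub>R u" if "dist p q < e" for p q e
  proof -
    have 1: "\<bar>fst p - fst q\<bar> \<le> e" "\<bar>snd p - snd q\<bar> \<le> e"
      using that dist_fst_le[of p q] dist_snd_le[of p q] by (auto simp: dist_real_def)
    have "(fst p - fst q) *\<^sub>R x \<le> e *\<^sub>R \<bar>x\<bar>"
      using scaleR_le_abs scaleR_right_mono[OF 1(1), of "\<bar>x\<bar>"] by (rule order.trans) simp
    moreover have "(snd p - snd q) *\<^sub>R y \<le> e *\<^sub>R \<bar>y\<bar>"
      using scaleR_le_abs scaleR_right_mono[OF 1(2), of "\<bar>y\<bar>"] by (rule order.trans) simp
    ultimately have "(fst p - fst q) *\<^sub>R x + (snd p - snd q) *\<^sub>R y \<le> e *\<^sub>R \<bar>x\<bar> + e *\<^sub>R \<bar>y\<bar>"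
      by (rule add_mono)
    thus ?thesis by (simp add: g_def u_def algebra_simps)
  qed
  have "\<exists>s. (\<forall>a\<in>g ` C. a \<le> s) \<and> (\<forall>b. (\<forall>a\<in>g ` C. a \<le> b) \<longrightarrow> s \<le> b)"
  proof (rule banach_lattice_lub_exists[OF u])
    fix e :: real assume e: "0 < e"
    have "compact C" by (simp add: C_def)
    then obtain k where k: "finite k" "k \<subseteq> C" "C \<subseteq> (\<Union>c\<in>k. ball c e)"
      using e seq_compact_imp_totally_bounded[OF compact_imp_seq_compact, of C] by blast
    have "k \<noteq> {}" using k(3) unfolding C by auto
    moreover have "\<exists>f\<in>g ` k. a \<le> f + e *\<^sub>R u" if a: "a \<in> g ` C" for a
    proof -
      obtain p where p: "p \<in> C" "a = g p" using a by blast
      then obtain c where "c \<in> k" "dist c p < e" using k(3) by auto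
      thus ?thesis using g_le[of p c e] p(2) by (auto simp: dist_commute)
    qed
    ultimately show "\<exists>F. finite F \<and> F \<noteq> {} \<and> F \<subseteq> g ` C \<and> (\<forall>a\<in>g ` C. \<exists>f\<in>F. a \<le> f + e *\<^sub>R u)"
      using k by (intro exI[of _ "g ` k"]) auto
  qed
  thus ?thesis by (simp add: C g_def)
qed

lemma modulus_ge: "cos \<theta> *\<^sub>R re_part z + sin \<theta> *\<^sub>R im_part z \<le> modulus z"
  and modulus_le: "(\<And>\<theta>. cos \<theta> *\<^sub>R re_part z + sin \<theta> *\<^sub>R im_part z \<le> b) \<Longrightarrow> modulus z \<le> b"
proof -
  let ?P = "\<lambda>s. \<forall>\<theta>. cos \<theta> *\<^sub>R re_part z + sin \<theta> *\<^sub>R im_part z \<le> s"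
  obtain s where s: "?P s" "\<And>b. ?P b \<Longrightarrow> s \<le> b"
    using modulus_exists[of "re_part z" "im_part z"] by blast
  have "modulus z = s"
    unfolding modulus_def by (rule Least_equality) (use s in auto)
  thus "cos \<theta> *\<^sub>R re_part z + sin \<theta> *\<^sub>R im_part z \<le> modulus z"
    "(\<And>\<theta>. cos \<theta> *\<^sub>R re_part z + sin \<theta> *\<^sub>R im_part z \<le> b) \<Longrightarrow> modulus z \<le> b"
    using s by auto
qed

lemma abs_re_part_le_modulus: "\<bar>re_part z\<bar> \<le> modulus z"
  using modulus_ge[of 0 z] modulus_ge[of pi z] by (intro abs_leI) auto

lemma abs_im_part_le_modulus: "\<bar>im_part z\<bar> \<le> modulus z"
  using modulus_ge[of "pi/2" z] modulus_ge[of "- (pi/2)" z] by (intro abs_leI) auto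

lemma modulus_nonneg: "0 \<le> modulus z"
  using abs_re_part_le_modulus abs_ge_zero by (rule order.trans[rotated])

lemma modulus_le_add: "modulus z \<le> \<bar>re_part z\<bar> + \<bar>im_part z\<bar>"
proof (rule modulus_le)
  fix \<theta> :: real
  have "cos \<theta> *\<^sub>R re_part z \<le> 1 *\<^sub>R \<bar>re_part z\<bar>"
    using scaleR_le_abs scaleR_right_mono[OF abs_cos_le_one abs_ge_zero] by (rule order.trans)
  moreover have "sin \<theta> *\<^sub>R im_part z \<le> 1 *\<^sub>R \<bar>im_part z\<bar>"
    using scaleR_le_abs scaleR_right_mono[OF abs_sin_le_one abs_ge_zero] by (rule order.trans)
  ultimately show "cos \<theta> *\<^sub>R re_part z + sin \<theta> *\<^sub>R im_part z \<le> \<bar>re_part z\<bar> + \<bar>im_part z\<bar>"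
    by (simp add: add_mono)
qed

instantiation complexification :: (banach_lattice) real_normed_vector
begin

definition zero_complexification :: "'a complexification" where
  "0 = Complexification 0 0"
definition plus_complexification :: "'a complexification \<Rightarrow> 'a complexification \<Rightarrow> 'a complexification" where
  "z + w = Complexification (re_part z + re_part w) (im_part z + im_part w)"
definition minus_complexification :: "'a complexification \<Rightarrow> 'a complexification \<Rightarrow> 'a complexification" where
  "z - w = Complexification (re_part z - re_part w) (im_part z - im_part w)"
definition uminus_complexification :: "'a complexification \<Rightarrow> 'a complexification" where
  "- z = Complexification (- re_part z) (- im_part z)"
definition scaleR_complexification :: "real \<Rightarrow> 'a complexification \<Rightarrow> 'a complexification" where
  "r *\<^sub>R z = Complexification (r *\<^sub>R re_part z) (r *\<^sub>R im_part z)"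
definition norm_complexification :: "'a complexification \<Rightarrow> real" where
  "norm z = norm (modulus z)"
definition dist_complexification :: "'a complexification \<Rightarrow> 'a complexification \<Rightarrow> real" where
  "dist z w = norm (z - w)" for z w :: "'a complexification"
definition sgn_complexification :: "'a complexification \<Rightarrow> 'a complexification" where
  "sgn z = inverse (norm z) *\<^sub>R z" for z :: "'a complexification"
definition uniformity_complexification :: "('a complexification \<times> 'a complexification) filter" where
  "(uniformity :: ('a complexification \<times> 'a complexification) filter) =
  (INF e\<in>{0<..}. principal {(x, y). dist x y < e})"
definition open_complexification :: "'a complexification set \<Rightarrow> bool" where
  "open (U :: 'a complexification set) \<longleftrightarrow>
  (\<forall>x\<in>U. \<forall>\<^sub>F (x', y) in uniformity. x' = x \<longrightarrow> y \<in> U)"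

lemmas complexification_arith_defs =
  zero_complexification_def plus_complexification_def minus_complexification_def
  uminus_complexification_def scaleR_complexification_def

instance
proof
  fix x y z :: "'a complexification" and a b :: real and U :: "'a complexification set"
  show "x + y + z = x + (y + z)" "x + y = y + x" "0 + x = x" "- x + x = 0" "x - y = x + - y"
    by (simp_all add: complexification_arith_defs algebra_simps)
  show "a *\<^sub>R (x + y) = a *\<^sub>R x + a *\<^sub>R y" "(a + b) *\<^sub>R x = a *\<^sub>R x + b *\<^sub>R x"
    "a *\<^sub>R b *\<^sub>R x = (a * b) *\<^sub>R x" "1 *\<^sub>R x = x"
    by (simp_all add: complexification_arith_defs algebra_simps)
  show "dist x y = norm (x - y)" "sgn x = inverse (norm x) *\<^sub>R x"
    by (fact dist_complexification_def sgn_complexification_def)+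
  show "uniformity = (INF e\<in>{0<..}. principal {(x :: 'a complexification, y). dist x y < e})"
    by (fact uniformity_complexification_def)
  show "open U \<longleftrightarrow> (\<forall>x\<in>U. \<forall>\<^sub>F (x', y) in uniformity. x' = x \<longrightarrow> y \<in> U)"
    by (fact open_complexification_def)
  show "norm x = 0 \<longleftrightarrow> x = 0"
  proof
    assume "norm x = 0"
    hence "modulus x = 0" by (simp add: norm_complexification_def)
    hence "\<bar>re_part x\<bar> \<le> 0" "\<bar>im_part x\<bar> \<le> 0"
      using abs_re_part_le_modulus[of x] abs_im_part_le_modulus[of x] by auto
    thus "x = 0" by (cases x) (simp add: zero_complexification_def)
  next
    assume "x = 0"
    hence "modulus x = 0"
      using modulus_nonneg[of x] modulus_le_add[of x]
      by (simp add: zero_complexification_def)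
    thus "norm x = 0" by (simp add: norm_complexification_def)
  qed
  show "norm (x + y) \<le> norm x + norm y"
  proof -
    have "modulus (x + y) \<le> modulus x + modulus y"
    proof (rule modulus_le)
      fix t :: real
      show "cos t *\<^sub>R re_part (x + y) + sin t *\<^sub>R im_part (x + y) \<le> modulus x + modulus y"
        using add_mono[OF modulus_ge[of t x] modulus_ge[of t y]]
        by (simp add: plus_complexification_def algebra_simps)
    qed
    hence "norm (modulus (x + y)) \<le> norm (modulus x + modulus y)"
      by (intro norm_mono_nonneg modulus_nonneg)
    thus ?thesis
      unfolding norm_complexification_def using norm_triangle_ineq by (rule order.trans)
  qed
  show "norm (a *\<^sub>R x) = \<bar>a\<bar> * norm x"
  proof -
    have le: "modulus (c *\<^sub>R w) \<le> \<bar>c\<bar> *\<^sub>R modulus w" for c and w :: "'a complexification"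
    proof (rule modulus_le)
      fix t :: real
      have "\<bar>c\<bar> *\<^sub>R (cos t' *\<^sub>R re_part w + sin t' *\<^sub>R im_part w) \<le> \<bar>c\<bar> *\<^sub>R modulus w" for t'
        by (intro scaleR_left_mono modulus_ge) auto
      from this[of t] this[of "t + pi"]
      show "cos t *\<^sub>R re_part (c *\<^sub>R w) + sin t *\<^sub>R im_part (c *\<^sub>R w) \<le> \<bar>c\<bar> *\<^sub>R modulus w"
        by (cases "0 \<le> c") (simp_all add: scaleR_complexification_def algebra_simps)
    qed
    have le': "norm (c *\<^sub>R w) \<le> \<bar>c\<bar> * norm w" for c and w :: "'a complexification"
      using norm_mono_nonneg[OF modulus_nonneg le[of c w]]
      by (simp add: norm_complexification_def)
    show ?thesis
    proof (cases "a = 0")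
      case True
      thus ?thesis using le'[of 0 x] by (simp add: norm_complexification_def)
    next
      case False
      have "inverse a *\<^sub>R a *\<^sub>R x = x"
        using False by (cases x) (simp add: scaleR_complexification_def)
      hence "norm x \<le> \<bar>inverse a\<bar> * norm (a *\<^sub>R x)" using le'[of "inverse a" "a *\<^sub>R x"] by simp
      hence "\<bar>a\<bar> * norm x \<le> norm (a *\<^sub>R x)"
        using False by (simp add: field_simps)
      thus ?thesis using le'[of a x] by simp
    qed
  qed
qed

end

lemma norm_re_part_le: "norm (re_part z) \<le> norm z"
  using norm_mono_nonneg[OF abs_ge_zero abs_re_part_le_modulus[of z]]
  by (simp add: norm_complexification_def)

lemma norm_im_part_le: "norm (im_part z) \<le> norm z"
  using norm_mono_nonneg[OF abs_ge_zero abs_im_part_le_modulus[of z]]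
  by (simp add: norm_complexification_def)

lemma norm_complexification_le: "norm z \<le> norm (re_part z) + norm (im_part z)"
proof -
  have "norm z \<le> norm (\<bar>re_part z\<bar> + \<bar>im_part z\<bar>)"
    unfolding norm_complexification_def by (intro norm_mono_nonneg modulus_nonneg modulus_le_add)
  also have "\<dots> \<le> norm (re_part z) + norm (im_part z)"
    using norm_triangle_ineq[of "\<bar>re_part z\<bar>" "\<bar>im_part z\<bar>"] by simp
  finally show ?thesis .
qed

instance complexification :: (banach_lattice) banach
proof
  fix X :: "nat \<Rightarrow> 'a complexification"
  assume X: "Cauchy X"
  have "Cauchy (\<lambda>n. re_part (X n))"
  proof (rule metric_CauchyI)
    fix e :: real assume "0 < e"
    then obtain M where "\<forall>m\<ge>M. \<forall>n\<ge>M. dist (X m) (X n) < e"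
      using metric_CauchyD[OF X] by blast
    moreover have "dist (re_part (X m)) (re_part (X n)) \<le> dist (X m) (X n)" for m n
      using norm_re_part_le[of "X m - X n"] by (simp add: dist_norm minus_complexification_def)
    ultimately show "\<exists>M. \<forall>m\<ge>M. \<forall>n\<ge>M. dist (re_part (X m)) (re_part (X n)) < e"
      by (meson order.strict_trans1)
  qed
  then obtain x where x: "(\<lambda>n. re_part (X n)) \<longlonglongrightarrow> x"
    using Cauchy_convergent convergent_def by blast
  have "Cauchy (\<lambda>n. im_part (X n))"
  proof (rule metric_CauchyI)
    fix e :: real assume "0 < e"
    then obtain M where "\<forall>m\<ge>M. \<forall>n\<ge>M. dist (X m) (X n) < e"
      using metric_CauchyD[OF X] by blast
    moreover have "dist (im_part (X m)) (im_part (X n)) \<le> dist (X m) (X n)" for m n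
      using norm_im_part_le[of "X m - X n"] by (simp add: dist_norm minus_complexification_def)
    ultimately show "\<exists>M. \<forall>m\<ge>M. \<forall>n\<ge>M. dist (im_part (X m)) (im_part (X n)) < e"
      by (meson order.strict_trans1)
  qed
  then obtain y where y: "(\<lambda>n. im_part (X n)) \<longlonglongrightarrow> y"
    using Cauchy_convergent convergent_def by blast
  have "(\<lambda>n. norm (re_part (X n) - x) + norm (im_part (X n) - y)) \<longlonglongrightarrow> 0 + 0"
    using x y by (intro tendsto_add tendsto_norm_zero LIM_zero)
  hence lim0: "(\<lambda>n. norm (re_part (X n) - x) + norm (im_part (X n) - y)) \<longlonglongrightarrow> 0" by simp
  have "(\<lambda>n. X n - Complexification x y) \<longlonglongrightarrow> 0"
  proof (rule Lim_null_comparison[OF _ lim0], rule always_eventually, rule allI)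
    fix n
    show "norm (X n - Complexification x y) \<le> norm (re_part (X n) - x) + norm (im_part (X n) - y)"
      using norm_complexification_le[of "X n - Complexification x y"]
      by (simp add: minus_complexification_def)
  qed
  hence "X \<longlonglongrightarrow> Complexification x y" by (rule LIM_zero_cancel)
  thus "convergent X" by (rule convergentI)
qed

definition scaleC :: "complex \<Rightarrow> 'a::banach_lattice complexification \<Rightarrow> 'a complexification" where
  "scaleC c z = Complexification
     (Re c *\<^sub>R re_part z - Im c *\<^sub>R im_part z) (Re c *\<^sub>R im_part z + Im c *\<^sub>R re_part z)"

lemma vector_space_scaleC: "vector_space (scaleC :: complex \<Rightarrow> 'a::banach_lattice complexification \<Rightarrow> _)"
  by unfold_locales
    (simp_all add: scaleC_def complexification_arith_defs algebra_simps)

lemma scaleC_of_real: "scaleC (complex_of_real r) z = r *\<^sub>R z"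
  by (simp add: scaleC_def scaleR_complexification_def)

lemma scaleC_scaleR_right: "scaleC c (r *\<^sub>R z) = r *\<^sub>R scaleC c z"
  by (simp add: scaleC_def scaleR_complexification_def algebra_simps)

lemma modulus_scaleC_le: "modulus (scaleC c z) \<le> cmod c *\<^sub>R modulus z"
proof (rule modulus_le)
  fix t :: real
  define a where "a = Arg c"
  have c: "c = rcis (cmod c) a" by (simp add: a_def rcis_cmod_Arg)
  have R: "Re c = cmod c * cos a" by (subst c) simp
  have I: "Im c = cmod c * sin a" by (subst c) simp
  have "cos t *\<^sub>R re_part (scaleC c z) + sin t *\<^sub>R im_part (scaleC c z)
      = cmod c *\<^sub>R (cos (t - a) *\<^sub>R re_part z + sin (t - a) *\<^sub>R im_part z)"
    by (simp add: scaleC_def R I cos_diff sin_diff algebra_simps)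
  also have "\<dots> \<le> cmod c *\<^sub>R modulus z"
    by (intro scaleR_left_mono modulus_ge) auto
  finally show "cos t *\<^sub>R re_part (scaleC c z) + sin t *\<^sub>R im_part (scaleC c z) \<le> cmod c *\<^sub>R modulus z" .
qed

lemma norm_scaleC: "norm (scaleC c z) = cmod c * norm z"
proof -
  interpret vector_space scaleC by (rule vector_space_scaleC)
  have le: "norm (scaleC d w) \<le> cmod d * norm w" for d and w :: "'a complexification"
    using norm_mono_nonneg[OF modulus_nonneg modulus_scaleC_le[of d w]]
    by (simp add: norm_complexification_def)
  show ?thesis
  proof (cases "c = 0")
    case False
    hence "norm z \<le> inverse (cmod c) * norm (scaleC c z)"
      using le[of "inverse c" "scaleC c z"] by (simp add: norm_inverse)
    from mult_left_mono[OF this norm_ge_zero[of c]]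
    have "cmod c * norm z \<le> norm (scaleC c z)"
      using False by (simp add: mult.assoc[symmetric])
    thus ?thesis by (intro order.antisym le)
  qed simp
qed


section \<open>The weak Calkin algebra\<close>

text \<open>Both scalar fields are treated at once: \<open>s\<close> is the scalar multiplication of the space, to be
  taken as \<^const>\<open>scaleR\<close> or \<^const>\<open>scaleC\<close>. Elements of \<open>'e \<Rightarrow>\<^sub>L 'e\<close> are bounded
  and real-linear, so linearity over the scalar field has to be required separately.\<close>

definition dual :: "('k::real_normed_field \<Rightarrow> 'e::real_normed_vector \<Rightarrow> 'e) \<Rightarrow> ('e \<Rightarrow> 'k) set" where
  "dual s = {f. bounded_linear f \<and> Vector_Spaces.linear s (*) f}"

definition weak_topology :: "('k::real_normed_field \<Rightarrow> 'e::real_normed_vector \<Rightarrow> 'e) \<Rightarrow> 'e topology" where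
  "weak_topology s = topology_generated_by {f -` U | f U. f \<in> dual s \<and> open U}"

definition operator_algebra ::
  "('k::real_normed_field \<Rightarrow> 'e::real_normed_vector \<Rightarrow> 'e) \<Rightarrow> ('k, 'e \<Rightarrow>\<^sub>L 'e) module" where
  "operator_algebra s = \<lparr>carrier = {T. Vector_Spaces.linear s s (blinfun_apply T)},
     mult = (o\<^sub>L), one = id_blinfun, zero = 0, add = (+),
     smult = (\<lambda>c T. Blinfun (\<lambda>x. s c (blinfun_apply T x)))\<rparr>"

text \<open>\<^const>\<open>Blinfun\<close> is only meaningful on bounded real-linear maps; the next two lemmas show
  that this is the case for both scalar multiplications of interest.\<close>

lemma smult_operator_algebra_scaleR:
  "blinfun_apply (c \<odot>\<^bsub>operator_algebra scaleR\<^esub> T) x = c *\<^sub>R blinfun_apply T x"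
  by (simp add: operator_algebra_def bounded_linear_Blinfun_apply blinfun.bounded_linear_right
      bounded_linear_const_scaleR)

lemma smult_operator_algebra_scaleC:
  "blinfun_apply (c \<odot>\<^bsub>operator_algebra scaleC\<^esub> T) x = scaleC c (blinfun_apply T x)"
proof -
  interpret vector_space scaleC by (rule vector_space_scaleC)
  have "bounded_linear (\<lambda>x. scaleC c (blinfun_apply T x))"
  proof (rule bounded_linear_intro[where K = "cmod c * norm T"])
    fix x y and r :: real
    show "scaleC c (blinfun_apply T (x + y)) = scaleC c (blinfun_apply T x) + scaleC c (blinfun_apply T y)"
      by (simp add: blinfun.add_right scale_right_distrib)
    show "scaleC c (blinfun_apply T (r *\<^sub>R x)) = r *\<^sub>R scaleC c (blinfun_apply T x)"
      by (simp add: blinfun.scaleR_right scaleC_scaleR_right)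
    show "norm (scaleC c (blinfun_apply T x)) \<le> norm x * (cmod c * norm T)"
      using mult_left_mono[OF norm_blinfun[of T x] norm_ge_zero[of c]]
      by (simp add: norm_scaleC ac_simps)
  qed
  thus ?thesis by (simp add: operator_algebra_def bounded_linear_Blinfun_apply)
qed

definition weakly_compact_operators ::
  "('k::real_normed_field \<Rightarrow> 'e::real_normed_vector \<Rightarrow> 'e) \<Rightarrow> ('e \<Rightarrow>\<^sub>L 'e) set" where
  "weakly_compact_operators s = {T \<in> carrier (operator_algebra s).
     compactin (weak_topology s)
       (Abstract_Topology.closure_of (weak_topology s) (blinfun_apply T ` cball 0 1))}"

definition weak_calkin_algebra ::
  "('k::real_normed_field \<Rightarrow> 'e::real_normed_vector \<Rightarrow> 'e) \<Rightarrow> ('k, ('e \<Rightarrow>\<^sub>L 'e) set) module" where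
  "weak_calkin_algebra s =
     (let B = operator_algebra s; W = weakly_compact_operators s
      in ring.extend (B Quot W) (module.fields (\<lambda>c X. \<Union>T\<in>X. W +>\<^bsub>B\<^esub> (c \<odot>\<^bsub>B\<^esub> T))))"

text \<open>The quotient norm of the coset \<open>X = T + W\<close> is the infimum of the operator norms of its
  elements; see \<open>weak_essential_norm_coset\<close> for the form \<open>inf \<parallel>T - W\<parallel>\<close>. The norm of
  \<open>'e \<Rightarrow>\<^sub>L 'e\<close> is the operator norm.\<close>

definition weak_essential_norm :: "('e::real_normed_vector \<Rightarrow>\<^sub>L 'e) set \<Rightarrow> real" where
  "weak_essential_norm X = (INF T\<in>X. norm T)"

lemma uminus_weakly_compact_operators:
  assumes "T \<in> weakly_compact_operators s"
  shows "- T \<in> weakly_compact_operators s"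
proof -
  have lin: "Vector_Spaces.linear s s (blinfun_apply T)"
    using assms by (simp add: weakly_compact_operators_def operator_algebra_def)
  then interpret Vector_Spaces.linear s s "blinfun_apply T" .
  have "Vector_Spaces.linear s s (blinfun_apply (- T))"
    by unfold_locales (simp_all add: blinfun.minus_left add scale)
  moreover have "blinfun_apply (- T) ` cball 0 1 = blinfun_apply T ` cball 0 1"
  proof (intro subset_antisym subsetI)
    fix y assume "y \<in> blinfun_apply (- T) ` cball 0 1"
    then obtain x where x: "norm x \<le> 1" "y = - blinfun_apply T x"
      by (auto simp: blinfun.minus_left)
    hence "y = blinfun_apply T (- x)" "- x \<in> cball 0 1" by (simp_all add: blinfun.minus_right)
    thus "y \<in> blinfun_apply T ` cball 0 1" by (rule image_eqI)
  next
    fix y assume "y \<in> blinfun_apply T ` cball 0 1"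
    then obtain x where x: "norm x \<le> 1" "y = blinfun_apply T x" by auto
    hence "y = blinfun_apply (- T) (- x)" "- x \<in> cball 0 1"
      by (simp_all add: blinfun.minus_right blinfun.minus_left)
    thus "y \<in> blinfun_apply (- T) ` cball 0 1" by (rule image_eqI)
  qed
  ultimately show ?thesis
    using assms by (simp add: weakly_compact_operators_def operator_algebra_def)
qed

lemma weak_essential_norm_coset:
  "weak_essential_norm (weakly_compact_operators s +>\<^bsub>operator_algebra s\<^esub> T)
     = (INF W\<in>weakly_compact_operators s. norm (T - W))"
proof -
  let ?W = "weakly_compact_operators s"
  have "?W +>\<^bsub>operator_algebra s\<^esub> T = (\<lambda>W. W + T) ` ?W"
    by (auto simp: a_r_coset_def' operator_algebra_def)
  also have "\<dots> = (\<lambda>W. T - W) ` ?W"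
  proof (intro subset_antisym subsetI)
    fix S assume "S \<in> (\<lambda>W. W + T) ` ?W"
    then obtain W where "W \<in> ?W" "S = W + T" by blast
    thus "S \<in> (\<lambda>W. T - W) ` ?W"
      by (intro image_eqI[of _ _ "- W"] uminus_weakly_compact_operators) simp_all
  next
    fix S assume "S \<in> (\<lambda>W. T - W) ` ?W"
    then obtain W where "W \<in> ?W" "S = T - W" by blast
    thus "S \<in> (\<lambda>W. W + T) ` ?W"
      by (intro image_eqI[of _ _ "- W"] uminus_weakly_compact_operators) simp_all
  qed
  finally show ?thesis
    by (simp add: weak_essential_norm_def image_image)
qed


section \<open>Algebra norms and Bonsall's minimality property\<close>

definition algebra_norm :: "('k::real_normed_field, 'x) module \<Rightarrow> ('x \<Rightarrow> real) \<Rightarrow> bool" where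
  "algebra_norm A N \<longleftrightarrow>
     (\<forall>x\<in>carrier A. 0 \<le> N x \<and> (N x = 0 \<longleftrightarrow> x = \<zero>\<^bsub>A\<^esub>)) \<and>
     (\<forall>x\<in>carrier A. \<forall>y\<in>carrier A. N (x \<oplus>\<^bsub>A\<^esub> y) \<le> N x + N y) \<and>
     (\<forall>c. \<forall>x\<in>carrier A. N (c \<odot>\<^bsub>A\<^esub> x) = norm c * N x) \<and>
     (\<forall>x\<in>carrier A. \<forall>y\<in>carrier A. N (x \<otimes>\<^bsub>A\<^esub> y) \<le> N x * N y)"

definition bonsall_minimal :: "('k::real_normed_field, 'x) module \<Rightarrow> ('x \<Rightarrow> real) \<Rightarrow> bool" where
  "bonsall_minimal A \<nu> \<longleftrightarrow>
     (\<forall>N. algebra_norm A N \<and> (\<forall>x\<in>carrier A. N x \<le> \<nu> x) \<longrightarrow> (\<forall>x\<in>carrier A. N x = \<nu> x))"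

end

theory Submission
  imports Defs
begin

text \<open>
  The theorem rests on one property of an operator \<open>T\<close> on a real or complex AL-space. If \<open>T\<close> has
  weak essential norm greater than \<open>c\<close>, then there is an operator \<open>U\<close> of norm only slightly greater
  than \<open>1 / c\<close> such that \<open>P = U T\<close> is an idempotent which is not weakly compact (\<open>dichotomy\<close>). Now let
  \<open>N\<close> be an algebra norm below the weak essential norm. Since \<open>P\<close> is a nonzero idempotent modulo
  weakly compact operators, \<open>N P \<le> N P * N P\<close> gives \<open>1 \<le> N P \<le> N U * N T \<le> \<parallel>U\<parallel> * N T\<close>, so that
  \<open>N T\<close> is at least \<open>c\<close> up to a factor close to \<open>1\<close>; letting \<open>c\<close> increase to the weak essential
  norm gives equality.

  For the dichotomy, write \<open>|z|\<close> for the modulus of \<open>z\<close>, an element of the real AL-space \<open>E\<close>, and ask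
  whether some \<open>u \<ge> 0\<close> in \<open>E\<close> satisfies \<open>\<parallel>(|T f| - u)\<^sup>+\<parallel> \<le> c\<close> for all \<open>f \<ge> 0\<close> of norm at most \<open>1\<close>.

  Suppose that it does. Cutting \<open>T f\<close> down to modulus at most \<open>u\<close> changes it by at most \<open>c\<close>, but it
  is not linear in \<open>f\<close>. On a finite partition of \<open>E\<close> into bands, however, one may cut down one
  value of \<open>T\<close> for each band and extend linearly. Finitely many given elements are almost
  constant multiples of one element on the bands of a fine partition, so this yields a linear \<open>W\<close>
  with \<open>|W f| \<le> \<parallel>f\<parallel> u\<close> that is almost within \<open>c\<close> of \<open>T\<close> at these elements (\<open>finite_truncation\<close>).
  Order intervals are weakly compact, so by Tychonoff's theorem there is one \<open>W\<close> that is within \<open>c\<close>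
  of \<open>T\<close> everywhere (\<open>truncated_operator\<close>). It maps the unit ball into an order interval and is
  therefore weakly compact; that is, \<open>T\<close> has distance at most \<open>c\<close> to the weakly compact operators.

  Suppose that no such \<open>u\<close> exists. Choose \<open>f n\<close> one after the other so that the part of \<open>|T (f n)|\<close>
  above a large multiple of the sum of the earlier moduli has norm greater than \<open>c\<close>. These parts are almost disjoint, and
  integration over disjoint bands gives functionals \<open>\<phi> n\<close> with \<open>\<Sum>n. |\<phi> n g| \<le> \<parallel>g\<parallel>\<close> and
  \<open>|\<phi> n (T (f n))|\<close> not much smaller than \<open>c\<close>. By Rosenthal's lemma, a subsequence makes the matrix
  \<open>\<phi> m (T (f n))\<close> nearly diagonal. The map \<open>x \<mapsto> \<Sum>n. \<phi> n x * f n\<close>, normalised to diagonal \<open>1\<close>, then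
  almost inverts \<open>T\<close> on the combinations of the \<open>f n\<close> with absolutely summable coefficients, and a
  Neumann series turns it into \<open>U\<close>. The idempotent \<open>U T\<close> fixes every \<open>f n\<close>, and these form a basic
  sequence equivalent to the unit vectors of \<open>\<ell>\<^sub>1\<close>, so it is not weakly compact.

  Everything is done inside the lattice, without a representation of \<open>E\<close> as an \<open>L\<^sub>1\<close>-space: band
  projections replace indicator functions, and finite families of positive operators with sum \<open>1\<close>
  replace partitions of the measure space. The weak compactness of order intervals comes from a
  uniformly convex function on them, the counterpart of \<open>\<integral>x\<^sup>2 / u\<close>.\<close>

notation blinfun_apply (infixl \<open>\<cdot>\<close> 90)

section \<open>Positive parts and disjointness\<close>

lemma scaleR_inf:
  fixes x y :: "'a::banach_lattice"
  assumes r: "0 \<le> r"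
  shows "r *\<^sub>R inf x y = inf (r *\<^sub>R x) (r *\<^sub>R y)"
proof (cases "r = 0")
  case False
  with r have r: "0 < r" by simp
  show ?thesis
  proof (rule order.antisym)
    show "r *\<^sub>R inf x y \<le> inf (r *\<^sub>R x) (r *\<^sub>R y)"
      using r by (intro le_infI scaleR_left_mono) auto
    have "inverse r *\<^sub>R inf (r *\<^sub>R x) (r *\<^sub>R y) \<le> inf x y"
    proof (rule le_infI)
      show "inverse r *\<^sub>R inf (r *\<^sub>R x) (r *\<^sub>R y) \<le> x"
        using scaleR_left_mono[of "inf (r *\<^sub>R x) (r *\<^sub>R y)" "r *\<^sub>R x" "inverse r"] r by simp
      show "inverse r *\<^sub>R inf (r *\<^sub>R x) (r *\<^sub>R y) \<le> y"
        using scaleR_left_mono[of "inf (r *\<^sub>R x) (r *\<^sub>R y)" "r *\<^sub>R y" "inverse r"] r by simp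
    qed
    from scaleR_left_mono[OF this, of r] r
    show "inf (r *\<^sub>R x) (r *\<^sub>R y) \<le> r *\<^sub>R inf x y" by simp
  qed
qed simp

definition pos_part :: "'a::banach_lattice \<Rightarrow> 'a" where
  "pos_part x = sup x 0"

lemma pos_part_nonneg [simp]: "0 \<le> pos_part x"
  and pos_part_ge: "x \<le> pos_part x"
  and pos_part_least: "x \<le> y \<Longrightarrow> 0 \<le> y \<Longrightarrow> pos_part x \<le> y"
  by (auto simp: pos_part_def)

lemma pos_part_mono: "x \<le> y \<Longrightarrow> pos_part x \<le> pos_part y"
  by (meson order.trans pos_part_ge pos_part_least pos_part_nonneg)

lemma pos_part_uminus: "pos_part (- x) = pos_part x - x"
proof -
  have "pos_part x - x = sup x 0 + - x" by (simp add: pos_part_def)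
  also have "\<dots> = sup (x + - x) (0 + - x)" by (rule add_sup_distrib_right)
  finally have "pos_part x - x = sup 0 (- x)" by simp
  thus ?thesis by (simp add: pos_part_def sup_commute)
qed

lemma pos_part_diff: "pos_part x - pos_part (- x) = x"
  by (simp add: pos_part_uminus)

lemma pos_part_sum_abs: "pos_part x + pos_part (- x) = \<bar>x\<bar>"
proof -
  have "pprt x = pos_part x" "nprt x = - pos_part (- x)"
    by (auto simp: pprt_def nprt_def pos_part_def)
  thus ?thesis using abs_prts[of x] by simp
qed

lemma pos_part_disjoint: "inf (pos_part x) (pos_part (- x)) = 0"
proof -
  have "inf (pos_part x) (pos_part (- x)) = inf (x + pos_part (-x)) (0 + pos_part (- x))"
    using pos_part_diff[of x] by (simp add: algebra_simps)
  also have "\<dots> = inf x 0 + pos_part (- x)" by (simp add: add_inf_distrib_right)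
  also have "inf x 0 = - pos_part (- x)" by (simp add: pos_part_def)
  finally show ?thesis by simp
qed

lemma disjoint_scaleR:
  fixes x y :: "'a::banach_lattice"
  assumes "inf x y = 0" "0 \<le> r"
  shows "inf (r *\<^sub>R x) y = 0"
proof -
  have pos: "0 \<le> x" "0 \<le> y" using assms(1) by (metis inf_le1 inf_le2)+
  let ?r = "max r 1"
  have "inf (r *\<^sub>R x) y \<le> inf (?r *\<^sub>R x) (?r *\<^sub>R y)"
  proof (rule inf_mono)
    show "r *\<^sub>R x \<le> ?r *\<^sub>R x" using pos by (intro scaleR_right_mono) auto
    show "y \<le> ?r *\<^sub>R y" using scaleR_right_mono[of 1 ?r y] pos by auto
  qed
  also have "\<dots> = 0" using scaleR_inf[of ?r x y] assms by simp
  finally show ?thesis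
    using pos assms(2) by (intro order.antisym) (auto intro: scaleR_nonneg_nonneg)
qed

lemma disjoint_mono:
  fixes x y :: "'a::banach_lattice"
  assumes "inf x y = 0" "0 \<le> x'" "x' \<le> x" "0 \<le> y'" "y' \<le> y"
  shows "inf x' y' = 0"
  using inf_mono[OF assms(3,5)] assms by (intro order.antisym) auto

lemma inf_add_le:
  fixes x y z :: "'a::banach_lattice"
  assumes "0 \<le> x" "0 \<le> y" "0 \<le> z"
  shows "inf (x + y) z \<le> inf x z + inf y z"
proof -
  have "inf x z + inf y z = inf (inf (x + y) (z + y)) (inf (x + z) (z + z))"
    by (simp add: add_inf_distrib_left add_inf_distrib_right)
  moreover have "inf (x + y) z \<le> \<dots>"
    using assms by (auto intro!: le_infI intro: le_infI2 add_increasing add_increasing2)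
  ultimately show ?thesis by simp
qed

section \<open>The integral and band projections\<close>

text \<open>Every element is a difference of positive ones, so an additive map on the cone extends linearly. The
  bound survives with the same constant because \<open>\<parallel>x\<^sup>+\<parallel> + \<parallel>x\<^sup>-\<parallel> = \<parallel>x\<parallel>\<close> in an AL-space.\<close>

lemma cone_extension:
  fixes p :: "'a::al_space \<Rightarrow> 'b::real_normed_vector"
  assumes add: "\<And>x y. 0 \<le> x \<Longrightarrow> 0 \<le> y \<Longrightarrow> p (x + y) = p x + p y"
    and scale: "\<And>r x. 0 \<le> r \<Longrightarrow> 0 \<le> x \<Longrightarrow> p (r *\<^sub>R x) = r *\<^sub>R p x"
    and bound: "\<And>x. 0 \<le> x \<Longrightarrow> norm (p x) \<le> K * norm x"
  shows "\<exists>P :: 'a \<Rightarrow>\<^sub>L 'b. \<forall>x\<ge>0. P \<cdot> x = p x"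
proof -
  define f where "f x = p (pos_part x) - p (pos_part (- x))" for x
  have f_diff: "f (a - b) = p a - p b" if ab: "0 \<le> a" "0 \<le> b" for a b
  proof -
    have "pos_part (a - b) + b = pos_part (b - a) + a"
      using pos_part_diff[of "a - b"] by (simp add: algebra_simps)
    hence "p (pos_part (a - b)) + p b = p (pos_part (b - a)) + p a"
      using add[of "pos_part (a - b)" b] add[of "pos_part (b - a)" a] ab by simp
    thus ?thesis by (simp add: f_def algebra_simps)
  qed
  have "bounded_linear f"
  proof (rule bounded_linear_intro[where K = K])
    fix x y :: 'a and r :: real
    let ?q = "\<lambda>x :: 'a. pos_part (- x)"
    have "x + y = (pos_part x + pos_part y) - (?q x + ?q y)"
      using pos_part_diff[of x] pos_part_diff[of y] by (metis add_diff_add)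
    hence "f (x + y) = p (pos_part x + pos_part y) - p (?q x + ?q y)"
      using f_diff[of "pos_part x + pos_part y" "?q x + ?q y"] by simp
    thus "f (x + y) = f x + f y" by (simp add: add f_def)
    have pos: "f (r *\<^sub>R x) = r *\<^sub>R f x" if "0 \<le> r" for r x
    proof -
      have "r *\<^sub>R x = r *\<^sub>R pos_part x - r *\<^sub>R ?q x"
        using pos_part_diff[of x] by (metis scaleR_diff_right)
      hence "f (r *\<^sub>R x) = p (r *\<^sub>R pos_part x) - p (r *\<^sub>R ?q x)"
        using f_diff[of "r *\<^sub>R pos_part x" "r *\<^sub>R ?q x"] that by (simp add: scaleR_nonneg_nonneg)
      thus ?thesis using that by (simp add: scale f_def scaleR_diff_right)
    qed
    have neg: "f (- x) = - f x" for x by (simp add: f_def)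
    show "f (r *\<^sub>R x) = r *\<^sub>R f x"
      using pos[of r x] pos[of "- r" "- x"] neg[of x] by (cases "0 \<le> r") auto
    have "norm (f x) \<le> K * norm (pos_part x) + K * norm (?q x)"
      unfolding f_def by (rule order.trans[OF norm_triangle_ineq4]) (intro add_mono bound; simp)
    also have "\<dots> = K * norm (pos_part x + ?q x)"
      by (subst norm_add_nonneg) (auto simp: algebra_simps)
    finally show "norm (f x) \<le> norm x * K" by (simp add: pos_part_sum_abs mult.commute)
  qed
  hence "blinfun_apply (Blinfun f) = f" by (rule bounded_linear_Blinfun_apply)
  moreover have "f x = p x" if "0 \<le> x" for x
    using f_diff[of x 0] that add[of 0 0] by simp
  ultimately show ?thesis by metis
qed

text \<open>The norm is additive on the cone; \<open>total\<close> is its linear extension. On \<open>L\<^sub>1(\<mu>)\<close> it is the integral.\<close>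

definition total :: "'a::al_space \<Rightarrow>\<^sub>L real" where
  "total = (SOME P. \<forall>x\<ge>0. P \<cdot> x = norm x)"

lemma total_nonneg_eq: "0 \<le> x \<Longrightarrow> total \<cdot> x = norm x"
proof -
  have "\<exists>P :: 'a \<Rightarrow>\<^sub>L real. \<forall>x\<ge>0. P \<cdot> x = norm x"
    by (rule cone_extension[where K = 1]) (auto simp: norm_add_nonneg)
  from someI_ex[OF this] show "0 \<le> x \<Longrightarrow> total \<cdot> x = norm x"
    unfolding total_def by blast
qed

definition positive_op :: "('a::banach_lattice \<Rightarrow>\<^sub>L 'b::banach_lattice) \<Rightarrow> bool" where
  "positive_op Q \<longleftrightarrow> (\<forall>x\<ge>0. 0 \<le> Q \<cdot> x)"

lemma positive_op_mono: "positive_op Q \<Longrightarrow> x \<le> y \<Longrightarrow> Q \<cdot> x \<le> Q \<cdot> y"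
  unfolding positive_op_def using diff_ge_0_iff_ge[of y x]
  by (metis blinfun.diff_right diff_ge_0_iff_ge)

text \<open>Along an increasing positive sequence, additivity of the norm makes the distance of two members the
  difference of their norms. So the norms, being bounded, force convergence.\<close>

lemma incseq_bounded_convergent:
  fixes X :: "nat \<Rightarrow> 'a::al_space"
  assumes inc: "\<And>n. X n \<le> X (Suc n)" and pos: "\<And>n. 0 \<le> X n" and bd: "\<And>n. X n \<le> u"
  shows "convergent X"
proof -
  have mono: "m \<le> n \<Longrightarrow> X m \<le> X n" for m n
    using lift_Suc_mono_le[of X m n] inc by blast
  have nd: "norm (X n - X m) = norm (X n) - norm (X m)" if "m \<le> n" for m n
    using norm_add_nonneg[of "X m" "X n - X m"] mono[OF that] pos by simp
  have "convergent (\<lambda>n. norm (X n))"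
  proof (rule Bseq_mono_convergent)
    show "Bseq (\<lambda>n. norm (X n))"
      by (rule BseqI'[of _ "norm u"]) (use pos bd norm_mono_nonneg in auto)
  qed (use mono pos norm_mono_nonneg in blast)
  hence C: "Cauchy (\<lambda>n. norm (X n))" by (rule convergent_Cauchy)
  have d: "dist (X m) (X n) = dist (norm (X m)) (norm (X n))" for m n
    by (cases "m \<le> n") (use nd[of m n] nd[of n m] norm_ge_zero[of "X n - X m"] norm_ge_zero[of "X m - X n"] in
       \<open>auto simp: dist_norm norm_minus_commute\<close>)
  have "Cauchy X" using C unfolding Cauchy_def d by simp
  thus ?thesis by (rule Cauchy_convergent)
qed

text \<open>The limit is the component of \<open>x\<close> in the band generated by \<open>w\<close>. Passing to the limit in
  \<open>(x + y) \<and> n w \<le> x \<and> n w + y \<and> n w \<le> (x + y) \<and> 2 n w\<close> shows that it is additive in \<open>x\<close>.\<close>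

lemma band_projection_exists:
  fixes w :: "'a::al_space"
  assumes w: "0 \<le> w"
  shows "\<exists>Q :: 'a \<Rightarrow>\<^sub>L 'a. \<forall>x\<ge>0. (\<lambda>n. inf x (real n *\<^sub>R w)) \<longlonglongrightarrow> Q \<cdot> x"
proof -
  define p where "p x = lim (\<lambda>n. inf x (real n *\<^sub>R w))" for x
  have nw: "0 \<le> real n *\<^sub>R w" for n using w by (simp add: scaleR_nonneg_nonneg)
  have p: "(\<lambda>n. inf x (real n *\<^sub>R w)) \<longlonglongrightarrow> p x" if x: "0 \<le> x" for x
  proof -
    have "convergent (\<lambda>n. inf x (real n *\<^sub>R w))"
    proof (rule incseq_bounded_convergent[of _ x])
      show "inf x (real n *\<^sub>R w) \<le> inf x (real (Suc n) *\<^sub>R w)" for n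
        using w by (intro inf_mono scaleR_right_mono) auto
    qed (use x nw in auto)
    thus ?thesis by (simp add: p_def convergent_LIMSEQ_iff)
  qed
  have double: "filterlim (\<lambda>n::nat. 2 * n) sequentially sequentially"
    by (rule filterlim_subseq) (simp add: strict_mono_def)
  have "\<exists>P :: 'a \<Rightarrow>\<^sub>L 'a. \<forall>x\<ge>0. P \<cdot> x = p x"
  proof (rule cone_extension[where K = 1])
    fix x y :: 'a assume x: "0 \<le> x" and y: "0 \<le> y"
    have xy: "0 \<le> x + y" using x y by simp
    show "p (x + y) = p x + p y"
    proof (rule order.antisym)
      show "p (x + y) \<le> p x + p y"
        by (rule banach_lattice_le_limit[OF p[OF xy] tendsto_add[OF p[OF x] p[OF y]]])
          (rule inf_add_le[OF x y nw])
      show "p x + p y \<le> p (x + y)"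
      proof (rule banach_lattice_le_limit[OF tendsto_add[OF p[OF x] p[OF y]] filterlim_compose[OF p[OF xy] double]])
        fix n
        have "inf x (real n *\<^sub>R w) + inf y (real n *\<^sub>R w) \<le> x + y" by (intro add_mono) auto
        moreover have "inf x (real n *\<^sub>R w) + inf y (real n *\<^sub>R w) \<le> real n *\<^sub>R w + real n *\<^sub>R w"
          by (intro add_mono) auto
        ultimately show "inf x (real n *\<^sub>R w) + inf y (real n *\<^sub>R w) \<le> inf (x + y) (real (2 * n) *\<^sub>R w)"
          by (intro le_infI) (simp_all add: scaleR_left.add[symmetric])
      qed
    qed
  next
    fix r :: real and x :: 'a assume r: "0 \<le> r" and x: "0 \<le> x"
    have rx: "0 \<le> r *\<^sub>R x" using r x by (simp add: scaleR_nonneg_nonneg)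
    have le: "s *\<^sub>R p y \<le> p (s *\<^sub>R y)" if s: "0 \<le> s" and y: "0 \<le> y" for s y
    proof -
      have sy: "0 \<le> s *\<^sub>R y" using s y by (simp add: scaleR_nonneg_nonneg)
      obtain k0 where "s \<le> real k0" using real_arch_simple by blast
      then obtain k :: nat where k: "s \<le> real k" "0 < k"
        by (intro that[of "Suc k0"]) auto
      have sub: "filterlim (\<lambda>n::nat. k * n) sequentially sequentially"
        by (rule filterlim_subseq) (use k in \<open>simp add: strict_mono_def\<close>)
      show ?thesis
      proof (rule banach_lattice_le_limit[OF tendsto_scaleR[OF tendsto_const p[OF y]] filterlim_compose[OF p[OF sy] sub]])
        fix n
        have "s *\<^sub>R inf y (real n *\<^sub>R w) = inf (s *\<^sub>R y) ((s * real n) *\<^sub>R w)"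
          using scaleR_inf[OF s, of y "real n *\<^sub>R w"] by simp
        also have "\<dots> \<le> inf (s *\<^sub>R y) (real (k * n) *\<^sub>R w)"
          using w by (intro inf_mono scaleR_right_mono order.refl) (use k in \<open>auto intro: mult_right_mono\<close>)
        finally show "s *\<^sub>R inf y (real n *\<^sub>R w) \<le> inf (s *\<^sub>R y) (real (k * n) *\<^sub>R w)" .
      qed
    qed
    show "p (r *\<^sub>R x) = r *\<^sub>R p x"
    proof (cases "r = 0")
      case True
      have "p 0 = 0" using p[of 0] nw by (simp add: inf_absorb1 LIMSEQ_const_iff)
      thus ?thesis using True by simp
    next
      case False
      have "inverse r *\<^sub>R p (r *\<^sub>R x) \<le> p x" using le[of "inverse r" "r *\<^sub>R x"] r rx False by simp
      from scaleR_left_mono[OF this r] False have "p (r *\<^sub>R x) \<le> r *\<^sub>R p x" by simp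
      with le[OF r x] show ?thesis by simp
    qed
  next
    fix x :: 'a assume x: "0 \<le> x"
    have "0 \<le> p x" by (rule banach_lattice_nonneg_limit[OF p[OF x]]) (use x nw in auto)
    moreover have "p x \<le> x" by (rule banach_lattice_le_limit[OF p[OF x] tendsto_const]) simp
    ultimately show "norm (p x) \<le> 1 * norm x" using norm_mono_nonneg by auto
  qed
  then obtain P :: "'a \<Rightarrow>\<^sub>L 'a" where "\<forall>x\<ge>0. P \<cdot> x = p x" ..
  thus ?thesis using p by (intro exI[of _ P]) simp
qed

definition band_proj :: "'a::al_space \<Rightarrow> 'a \<Rightarrow>\<^sub>L 'a" where
  "band_proj w = (SOME Q. \<forall>x\<ge>0. (\<lambda>n. inf x (real n *\<^sub>R w)) \<longlonglongrightarrow> Q \<cdot> x)"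

lemma band_proj_limit:
  "0 \<le> w \<Longrightarrow> 0 \<le> x \<Longrightarrow> (\<lambda>n. inf x (real n *\<^sub>R w)) \<longlonglongrightarrow> (band_proj w) \<cdot> x"
  unfolding band_proj_def using someI_ex[OF band_projection_exists[of w]] by blast

context
  fixes w :: "'a::al_space"
  assumes w: "0 \<le> w"
begin

lemma band_proj_nonneg: "0 \<le> x \<Longrightarrow> 0 \<le> (band_proj w) \<cdot> x"
  by (rule banach_lattice_nonneg_limit[OF band_proj_limit[OF w]]) (auto simp: w scaleR_nonneg_nonneg)

lemma band_proj_le: "0 \<le> x \<Longrightarrow> (band_proj w) \<cdot> x \<le> x"
  by (rule banach_lattice_le_limit[OF band_proj_limit[OF w] tendsto_const]) auto

lemma band_proj_disjoint:
  assumes "inf x w = 0"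
  shows "band_proj w \<cdot> x = 0"
proof -
  have "0 \<le> x" using assms by (metis inf_le1)
  moreover have "inf x (real n *\<^sub>R w) = 0" for n
    using disjoint_scaleR[of w x "real n"] assms by (simp add: inf_commute)
  ultimately show ?thesis using band_proj_limit[OF w, of x] by (simp add: LIMSEQ_const_iff)
qed

lemma band_proj_self: "band_proj w \<cdot> w = w"
proof -
  have "inf w (real (Suc n) *\<^sub>R w) = w" for n
    using w scaleR_right_mono[of 1 "real (Suc n)" w] by (intro inf_absorb1) auto
  hence "(\<lambda>n. inf w (real (Suc n) *\<^sub>R w)) \<longlonglongrightarrow> w" by (simp only: tendsto_const)
  hence "(\<lambda>n. inf w (real n *\<^sub>R w)) \<longlonglongrightarrow> w" by (rule LIMSEQ_imp_Suc)
  with band_proj_limit[OF w w] show ?thesis by (rule LIMSEQ_unique)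
qed

end

lemma band_proj_pos_part: "band_proj (pos_part x) \<cdot> x = pos_part x"
proof -
  have "band_proj (pos_part x) \<cdot> (pos_part x - pos_part (- x)) = pos_part x"
    by (subst blinfun.diff_right)
      (simp add: band_proj_self band_proj_disjoint inf_commute pos_part_disjoint)
  thus ?thesis by (simp add: pos_part_diff)
qed

section \<open>Resolutions of the identity\<close>

text \<open>Resolutions play the role of finite partitions of the measure space: on \<open>L\<^sub>1(\<mu>)\<close> the basic example is
  multiplication by the indicator functions of the sets of a partition.\<close>

definition resolution :: "('a::banach_lattice \<Rightarrow>\<^sub>L 'a) list \<Rightarrow> bool" where
  "resolution Qs \<longleftrightarrow> (\<forall>Q\<in>set Qs. positive_op Q) \<and> sum_list Qs = id_blinfun"

lemma blinfun_sum_list_left: "sum_list Qs \<cdot> x = (\<Sum>Q\<leftarrow>Qs. Q \<cdot> x)"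
  by (induction Qs) (auto simp: blinfun.add_left)

lemma blinfun_sum_list_right:
  "F \<cdot> (\<Sum>Q\<leftarrow>Qs. g Q) = (\<Sum>Q\<leftarrow>Qs. F \<cdot> g Q)"
  by (induction Qs) (auto simp: blinfun.add_right)

lemma resolution_sum: "resolution Qs \<Longrightarrow> (\<Sum>Q\<leftarrow>Qs. Q \<cdot> x) = x"
  unfolding resolution_def by (metis blinfun_sum_list_left id_blinfun.rep_eq)

lemma resolution_sum_norm:
  fixes x :: "'a::al_space"
  assumes "resolution Qs" "0 \<le> x"
  shows "(\<Sum>Q\<leftarrow>Qs. norm (Q \<cdot> x)) = norm x"
proof -
  have "(\<Sum>Q\<leftarrow>Qs. norm (Q \<cdot> x)) = (\<Sum>Q\<leftarrow>Qs. total \<cdot> (Q \<cdot> x))"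
    by (intro arg_cong[of _ _ sum_list] map_cong)
      (use assms in \<open>auto simp: resolution_def positive_op_def total_nonneg_eq\<close>)
  also have "\<dots> = total \<cdot> (\<Sum>Q\<leftarrow>Qs. Q \<cdot> x)"
    by (simp add: blinfun_sum_list_right)
  also have "\<dots> = norm x" using assms by (simp add: resolution_sum total_nonneg_eq)
  finally show ?thesis .
qed

lemma sum_list_member_le:
  fixes f :: "'b \<Rightarrow> 'a::banach_lattice"
  assumes "\<And>q. q \<in> set qs \<Longrightarrow> 0 \<le> f q" "q \<in> set qs"
  shows "f q \<le> (\<Sum>q\<leftarrow>qs. f q)"
  using assms
proof (induction qs)
  case (Cons r qs)
  have "0 \<le> (\<Sum>q\<leftarrow>qs. f q)" using Cons.prems by (intro sum_list_nonneg) auto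
  moreover have "0 \<le> f r" using Cons.prems by auto
  ultimately show ?case using Cons by (auto intro: add_increasing add_increasing2)
qed simp

lemma resolution_le:
  assumes "resolution Qs" "Q \<in> set Qs" "0 \<le> x"
  shows "Q \<cdot> x \<le> x"
  using sum_list_member_le[of Qs "\<lambda>Q. Q \<cdot> x" Q] assms
  by (auto simp: resolution_sum[OF assms(1)] resolution_def positive_op_def)

text \<open>The members lie between \<open>0\<close> and the identity. Such an operator maps \<open>x\<^sup>+\<close> and \<open>x\<^sup>-\<close> below
  themselves, hence to disjoint elements, and so it preserves absolute values.\<close>

lemma resolution_abs:
  assumes Qs: "resolution Qs" "Q \<in> set Qs"
  shows "\<bar>Q \<cdot> x\<bar> = Q \<cdot> \<bar>x\<bar>"
proof -
  let ?a = "Q \<cdot> pos_part x" and ?b = "Q \<cdot> (pos_part (- x))"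
  have pos: "0 \<le> ?a" "0 \<le> ?b" using Qs by (auto simp: resolution_def positive_op_def)
  have "inf ?a ?b = 0"
    using disjoint_mono[OF pos_part_disjoint[of x] pos(1) _ pos(2)] resolution_le[OF Qs] by simp
  have 1: "\<bar>?a - ?b\<bar> = ?a + ?b"
  proof -
    have "pos_part (?a - ?b) + ?b = sup (?a - ?b + ?b) (0 + ?b)"
      unfolding pos_part_def by (rule add_sup_distrib_right)
    hence "pos_part (?a - ?b) = sup ?a ?b - ?b" by (simp add: algebra_simps)
    also have "sup ?a ?b = ?a + ?b - inf ?a ?b"
      using add_eq_inf_sup[of ?a ?b] by (simp only: eq_diff_eq)
    finally have "pos_part (?a - ?b) = ?a" using \<open>inf ?a ?b = 0\<close> by simp
    thus ?thesis using pos_part_sum_abs[of "?a - ?b"] pos_part_uminus[of "?a - ?b"] by simp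
  qed
  have "Q \<cdot> x = ?a - ?b" by (metis blinfun.diff_right pos_part_diff)
  moreover have "Q \<cdot> \<bar>x\<bar> = ?a + ?b" by (metis blinfun.add_right pos_part_sum_abs)
  ultimately show ?thesis using 1 by simp
qed

text \<open>The common refinement of two resolutions: summing over \<open>Rs\<close> recovers \<open>Qs\<close>, summing over \<open>Qs\<close> recovers
  \<open>Rs\<close>.\<close>

definition refine :: "('a::real_normed_vector \<Rightarrow>\<^sub>L 'a) list \<Rightarrow> ('a \<Rightarrow>\<^sub>L 'a) list \<Rightarrow> ('a \<Rightarrow>\<^sub>L 'a) list" where
  "refine Qs Rs = concat (map (\<lambda>Q. map (\<lambda>R. Q o\<^sub>L R) Rs) Qs)"

lemma sum_list_refine:
  "(\<Sum>P\<leftarrow>refine Qs Rs. f P) = (\<Sum>Q\<leftarrow>Qs. \<Sum>R\<leftarrow>Rs. f (Q o\<^sub>L R))"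
  by (induction Qs) (auto simp: refine_def o_def)

lemma positive_op_compose: "positive_op Q \<Longrightarrow> positive_op R \<Longrightarrow> positive_op (Q o\<^sub>L R)"
  by (simp add: positive_op_def)

lemma resolution_refine:
  assumes "resolution Qs" "resolution Rs"
  shows "resolution (refine Qs Rs)"
proof -
  have "sum_list (refine Qs Rs) = id_blinfun"
  proof (rule blinfun_eqI)
    fix x
    have "sum_list (refine Qs Rs) \<cdot> x = (\<Sum>Q\<leftarrow>Qs. \<Sum>R\<leftarrow>Rs. Q \<cdot> (R \<cdot> x))"
      by (simp add: blinfun_sum_list_left sum_list_refine)
    also have "\<dots> = x"
      by (simp add: blinfun_sum_list_right[symmetric] resolution_sum assms)
    finally show "sum_list (refine Qs Rs) \<cdot> x = id_blinfun \<cdot> x" by simp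
  qed
  thus ?thesis using assms by (auto simp: resolution_def refine_def positive_op_compose)
qed

definition split_at :: "'a::al_space \<Rightarrow> ('a \<Rightarrow>\<^sub>L 'a) list" where
  "split_at x = [band_proj (pos_part x), id_blinfun - band_proj (pos_part x)]"

lemma resolution_split_at: "resolution (split_at x)"
proof -
  have "positive_op (band_proj (pos_part x))"
    unfolding positive_op_def by (intro allI impI band_proj_nonneg pos_part_nonneg)
  moreover have "positive_op (id_blinfun - band_proj (pos_part x))"
    unfolding positive_op_def by (auto simp: blinfun.diff_left intro!: band_proj_le pos_part_nonneg)
  ultimately show ?thesis by (simp add: resolution_def split_at_def)
qed

text \<open>In function terms, finitely many functions have constant sign on the sets of a suitable partition.
  A new element \<open>z\<close> is handled by splitting each \<open>Q\<close> according to the sign of \<open>Q z\<close>, not of \<open>z\<close>. The new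
  operators are then of the form \<open>R Q\<close> with \<open>R\<close> positive, and such an \<open>R\<close> keeps the signs obtained before.\<close>

lemma signed_resolution_exists:
  fixes Z :: "'a::al_space set"
  assumes "finite Z"
  shows "\<exists>Qs. resolution Qs \<and> (\<forall>Q\<in>set Qs. \<forall>z\<in>Z. 0 \<le> Q \<cdot> z \<or> Q \<cdot> z \<le> 0)"
  using assms
proof (induction Z)
  case empty
  have "resolution [id_blinfun]" by (simp add: resolution_def positive_op_def)
  thus ?case by auto
next
  case (insert z Z)
  obtain Qs where Qs1: "resolution Qs"
    and Qs2: "\<forall>Q\<in>set Qs. \<forall>y\<in>Z. 0 \<le> Q \<cdot> y \<or> Q \<cdot> y \<le> 0"
    using insert.IH by (elim exE conjE)
  define S where "S Q = split_at (Q \<cdot> z)" for Q :: "'a \<Rightarrow>\<^sub>L 'a"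
  define Rs where "Rs = concat (map (\<lambda>Q. map (\<lambda>R. R o\<^sub>L Q) (S Q)) Qs)"
  have R: "\<exists>R Q. P = R o\<^sub>L Q \<and> Q \<in> set Qs \<and> R \<in> set (S Q)" if "P \<in> set Rs" for P
    using that by (auto simp: Rs_def)
  have Spos: "positive_op R" if "R \<in> set (S Q)" for R Q
    using resolution_split_at that by (auto simp: S_def resolution_def)
  have "(\<Sum>R\<leftarrow>S Q. R o\<^sub>L Q) = Q" for Q
    by (rule blinfun_eqI) (simp add: S_def split_at_def blinfun.add_left blinfun.diff_left)
  hence "sum_list Rs = sum_list Qs"
    unfolding Rs_def by (induction Qs) simp_all
  moreover have "\<forall>P\<in>set Rs. positive_op P"
  proof
    fix P assume "P \<in> set Rs"
    then obtain R Q where "P = R o\<^sub>L Q" "Q \<in> set Qs" "R \<in> set (S Q)" using R by blast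
    thus "positive_op P" using Spos Qs1 by (auto simp: resolution_def intro: positive_op_compose)
  qed
  ultimately have "resolution Rs" using Qs1 by (simp add: resolution_def)
  moreover have "0 \<le> P \<cdot> y \<or> P \<cdot> y \<le> 0" if P: "P \<in> set Rs" and y: "y \<in> insert z Z" for P y
  proof -
    obtain Q R where QR: "P = R o\<^sub>L Q" "Q \<in> set Qs" "R \<in> set (S Q)" using R[OF P] by (elim exE conjE)
    show ?thesis
    proof (cases "y = z")
      case True
      have "P \<cdot> z = R \<cdot> (Q \<cdot> z)" by (simp add: QR)
      moreover have "R = band_proj (pos_part (Q \<cdot> z)) \<or>
          R = id_blinfun - band_proj (pos_part (Q \<cdot> z))"
        using QR(3) by (simp add: S_def split_at_def)
      ultimately show ?thesis
        by (auto simp: True blinfun.diff_left band_proj_pos_part pos_part_ge)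
    next
      case False
      hence "0 \<le> Q \<cdot> y \<or> Q \<cdot> y \<le> 0" using Qs2 QR(2) y by simp
      thus ?thesis
        using positive_op_mono[OF Spos[OF QR(3)], of 0] positive_op_mono[OF Spos[OF QR(3)], of _ 0]
        by (auto simp: QR(1))
    qed
  qed
  ultimately show ?case by (intro exI[of _ Rs]) blast
qed

section \<open>Intersections of convex sets in the presence of a uniformly convex function\<close>

text \<open>The infimum of \<open>V\<close> over a finite intersection grows with the intersection; let \<open>v\<close> be the
  supremum of these infima. Two elements of one intersection at which \<open>V\<close> is almost minimal have their midpoint in
  the intersection too, so uniform convexity makes them close. Hence almost minimal points
  along a sequence of intersections form a Cauchy sequence, and intersecting in addition with any
  member of the family cannot change the limit, which therefore lies in that member.\<close>

lemma uniformly_convex_fip: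
  fixes V :: "'e::banach \<Rightarrow> real" and K :: "'e set"
  assumes \<kappa>: "0 < \<kappa>"
    and V: "\<And>z. z \<in> K \<Longrightarrow> 0 \<le> V z" "\<And>z. z \<in> K \<Longrightarrow> V z \<le> M"
    and V_mid: "\<And>z w. z \<in> K \<Longrightarrow> w \<in> K \<Longrightarrow>
      V ((1/2) *\<^sub>R (z + w)) + \<kappa> * (norm (z - w))\<^sup>2 \<le> (V z + V w) / 2"
    and K: "closed K" "\<And>z w. z \<in> K \<Longrightarrow> w \<in> K \<Longrightarrow> (1/2) *\<^sub>R (z + w) \<in> K"
    and \<C>: "\<And>C. C \<in> \<C> \<Longrightarrow> closed C"
      "\<And>C z w. C \<in> \<C> \<Longrightarrow> z \<in> C \<Longrightarrow> w \<in> C \<Longrightarrow> (1/2) *\<^sub>R (z + w) \<in> C"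
    and fip: "\<And>F. finite F \<Longrightarrow> F \<subseteq> \<C> \<Longrightarrow> K \<inter> \<Inter>F \<noteq> {}"
  shows "K \<inter> \<Inter>\<C> \<noteq> {}"
proof -
  define val where "val F = (INF z\<in>K \<inter> \<Inter>F. V z)" for F
  define Fin where "Fin = {F. finite F \<and> F \<subseteq> \<C>}"
  define v where "v = (SUP F\<in>Fin. val F)"
  define e where "e n = inverse (real (Suc n))" for n
  have e_pos: "0 < e n" for n by (simp add: e_def)
  have e_mono: "n \<le> m \<Longrightarrow> e m \<le> e n" for m n by (simp add: e_def field_simps)
  have e_lim: "e \<longlonglongrightarrow> 0" unfolding e_def by (rule LIMSEQ_inverse_real_of_nat)
  have ne: "K \<inter> \<Inter>F \<noteq> {}" if "F \<in> Fin" for F using fip that by (simp add: Fin_def)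
  have bdd: "bdd_below (V ` (K \<inter> \<Inter>F))" for F
    by (rule bdd_belowI2[of _ 0]) (use V(1) in auto)
  have val_le: "val F \<le> V z" if "z \<in> K \<inter> \<Inter>F" for F z
    unfolding val_def using that by (rule cINF_lower[OF bdd])
  have val_bd: "val F \<le> M" if "F \<in> Fin" for F
    using ne[OF that] val_le[of _ F] V(2) by (meson IntD1 equals0I order.trans)
  have val_v: "val F \<le> v" if "F \<in> Fin" for F
    unfolding v_def using that by (intro cSUP_upper bdd_aboveI2[of _ _ M] val_bd)
  have val_mono: "val F \<le> val F'" if "F \<subseteq> F'" "F' \<in> Fin" for F F'
    unfolding val_def by (rule cINF_superset_mono) (use that ne bdd in auto)
  have "\<exists>G\<in>Fin. v - e n < val G" for n
  proof -
    have "Fin \<noteq> {}" by (auto simp: Fin_def)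
    moreover have "v - e n < (SUP F\<in>Fin. val F)" using e_pos[of n] by (simp add: v_def)
    ultimately show ?thesis
      by (subst (asm) less_cSUP_iff) (auto intro: bdd_aboveI2[of _ _ M] val_bd)
  qed
  then obtain G where G: "\<And>n. G n \<in> Fin" "\<And>n. v - e n < val (G n)" by metis
  define F where "F n = (\<Union>k\<le>n. G k)" for n
  have F_Fin: "F n \<in> Fin" for n using G(1) by (auto simp: F_def Fin_def)
  have F_mono: "n \<le> m \<Longrightarrow> F n \<subseteq> F m" for m n by (fastforce simp: F_def)
  have F_val: "v - e n < val (F n)" for n
    using G(2)[of n] val_mono[of "G n" "F n"] F_Fin by (fastforce simp: F_def)
  have near: "\<exists>z. z \<in> K \<inter> \<Inter>H \<and> V z < v + e n" if "H \<in> Fin" for H n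
  proof -
    have "(INF z\<in>K \<inter> \<Inter>H. V z) < v + e n" using val_v[OF that] e_pos[of n] by (simp add: val_def)
    thus ?thesis using cINF_less_iff[OF ne[OF that] bdd] by blast
  qed
  have close: "\<kappa> * (norm (z - w))\<^sup>2 < 2 * e n"
    if z: "z \<in> K \<inter> \<Inter>(F n)" "V z < v + e n" and w: "w \<in> K \<inter> \<Inter>(F n)" "V w < v + e n" for z w n
  proof -
    have "(1/2) *\<^sub>R (z + w) \<in> \<Inter>(F n)"
      using \<C>(2) z(1) w(1) F_Fin[of n] by (fastforce simp: Fin_def)
    hence "(1/2) *\<^sub>R (z + w) \<in> K \<inter> \<Inter>(F n)" using K(2) z w by blast
    hence "v - e n < V ((1/2) *\<^sub>R (z + w))" using F_val[of n] val_le by (meson less_le_trans)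
    moreover have "V ((1/2) *\<^sub>R (z + w)) + \<kappa> * (norm (z - w))\<^sup>2 \<le> (V z + V w) / 2"
      using V_mid z w by blast
    ultimately show ?thesis using z(2) w(2) by argo
  qed
  have "\<exists>x. \<forall>n. x n \<in> K \<inter> \<Inter>(F n) \<and> V (x n) < v + e n"
    by (rule choice) (use near F_Fin in blast)
  then obtain x where x: "\<And>n. x n \<in> K \<inter> \<Inter>(F n)" "\<And>n. V (x n) < v + e n" by blast
  have x': "x m \<in> K \<inter> \<Inter>(F n)" "V (x m) < v + e n" if "n \<le> m" for m n
    using x[of m] F_mono[OF that] e_mono[OF that] by auto
  have small: "\<exists>N. \<forall>n\<ge>N. 2 * e n < \<kappa> * r\<^sup>2" if r: "0 < r" for r
  proof -
    have "(\<lambda>n. 2 * e n) \<longlonglongrightarrow> 2 * 0" by (intro tendsto_intros e_lim)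
    moreover have "2 * 0 < \<kappa> * r\<^sup>2" using \<kappa> r by simp
    ultimately have "eventually (\<lambda>n. 2 * e n < \<kappa> * r\<^sup>2) sequentially" by (rule order_tendstoD)
    thus ?thesis by (simp add: eventually_sequentially)
  qed
  have norm_lt: "norm (z - w) < r" if "\<kappa> * (norm (z - w))\<^sup>2 < \<kappa> * r\<^sup>2" "0 < r" for z w :: 'e and r
    using that \<kappa> by (simp add: power2_less_imp_less)
  have "Cauchy x"
  proof (rule metric_CauchyI)
    fix r :: real assume r: "0 < r"
    then obtain N where N: "\<And>n. n \<ge> N \<Longrightarrow> 2 * e n < \<kappa> * r\<^sup>2" using small by blast
    have "dist (x m) (x n) < r" if "N \<le> m" "N \<le> n" for m n
    proof -
      have "\<kappa> * (norm (x m - x n))\<^sup>2 < 2 * e N" using close x' that by blast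
      thus ?thesis using N[of N] norm_lt[of "x m" "x n" r] r by (simp add: dist_norm)
    qed
    thus "\<exists>M. \<forall>m\<ge>M. \<forall>n\<ge>M. dist (x m) (x n) < r" by blast
  qed
  then obtain l where l: "x \<longlonglongrightarrow> l" using Cauchy_convergent convergent_def by blast
  have "l \<in> C" if C: "C \<in> \<C>" for C
  proof -
    have ins: "insert C (F n) \<in> Fin" for n using F_Fin[of n] C by (auto simp: Fin_def)
    have "\<exists>y. \<forall>n. y n \<in> K \<inter> \<Inter>(insert C (F n)) \<and> V (y n) < v + e n"
      by (rule choice) (use near ins in blast)
    then obtain y where y: "\<And>n. y n \<in> K \<inter> \<Inter>(insert C (F n))" "\<And>n. V (y n) < v + e n" by blast
    have "(\<lambda>n. y n - x n) \<longlonglongrightarrow> 0"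
    proof (rule LIMSEQ_I)
      fix r :: real assume r: "0 < r"
      then obtain N where N: "\<And>n. n \<ge> N \<Longrightarrow> 2 * e n < \<kappa> * r\<^sup>2" using small by blast
      have "norm (y n - x n - 0) < r" if "N \<le> n" for n
      proof -
        have "y n \<in> K \<inter> \<Inter>(F n)" using y(1)[of n] by auto
        hence "\<kappa> * (norm (y n - x n))\<^sup>2 < 2 * e n" using close x y(2) by blast
        thus ?thesis using N[OF that] norm_lt[of "y n" "x n" r] r by simp
      qed
      thus "\<exists>no. \<forall>n\<ge>no. norm (y n - x n - 0) < r" by blast
    qed
    from tendsto_add[OF this l] have "y \<longlonglongrightarrow> l" by simp
    moreover have "y n \<in> C" for n using y(1)[of n] by simp
    ultimately show ?thesis using \<C>(1)[OF C] by (metis closed_sequentially)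
  qed
  moreover have "l \<in> K" using K(1) l x(1) by (metis IntD1 closed_sequentially)
  ultimately show ?thesis by blast
qed

section \<open>The energy of an element of an order interval\<close>

lemma sq_add_div_le:
  fixes a b p r :: real
  assumes "0 \<le> p" "0 \<le> r" "p = 0 \<Longrightarrow> a = 0" "r = 0 \<Longrightarrow> b = 0"
  shows "(a + b)\<^sup>2 / (p + r) \<le> a\<^sup>2 / p + b\<^sup>2 / r"
proof (cases "p = 0 \<or> r = 0")
  case False
  hence pr: "0 < p" "0 < r" using assms by auto
  have "0 \<le> (a * r - b * p)\<^sup>2" by simp
  hence "(a + b)\<^sup>2 * (p * r) \<le> (a\<^sup>2 * r + b\<^sup>2 * p) * (p + r)"
    by (simp add: power2_eq_square algebra_simps)
  thus ?thesis using pr by (simp add: field_simps)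
qed (use assms in auto)

text \<open>This form of the Cauchy--Schwarz inequality says that averaging decreases the energy below.\<close>

lemma sq_sum_list_div_le:
  fixes a p :: "'b \<Rightarrow> real"
  assumes "\<And>q. q \<in> set qs \<Longrightarrow> \<bar>a q\<bar> \<le> p q"
  shows "(\<Sum>q\<leftarrow>qs. a q)\<^sup>2 / (\<Sum>q\<leftarrow>qs. p q) \<le> (\<Sum>q\<leftarrow>qs. (a q)\<^sup>2 / p q)"
proof -
  have "\<bar>\<Sum>q\<leftarrow>qs. a q\<bar> \<le> (\<Sum>q\<leftarrow>qs. p q) \<and>
      (\<Sum>q\<leftarrow>qs. a q)\<^sup>2 / (\<Sum>q\<leftarrow>qs. p q) \<le> (\<Sum>q\<leftarrow>qs. (a q)\<^sup>2 / p q)"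
    using assms
  proof (induction qs)
    case (Cons q qs)
    let ?a = "\<Sum>q\<leftarrow>qs. a q" and ?p = "\<Sum>q\<leftarrow>qs. p q"
    have IH: "\<bar>?a\<bar> \<le> ?p" "?a\<^sup>2 / ?p \<le> (\<Sum>q\<leftarrow>qs. (a q)\<^sup>2 / p q)" using Cons by auto
    have q: "\<bar>a q\<bar> \<le> p q" using Cons.prems by simp
    have "(a q + ?a)\<^sup>2 / (p q + ?p) \<le> (a q)\<^sup>2 / p q + ?a\<^sup>2 / ?p"
      by (rule sq_add_div_le) (use IH(1) q in auto)
    thus ?case using IH q by auto
  qed simp
  thus ?thesis ..
qed

text \<open>For a partition of a measure space with sets \<open>A\<close>, this is \<open>\<Sum>A. (\<integral>\<^sub>A x)\<^sup>2 / \<integral>\<^sub>A u\<close>. With respect to the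
  measure with density \<open>u\<close> it is the squared \<open>L\<^sub>2\<close>-norm of the conditional expectation of \<open>x / u\<close>.\<close>

definition energy :: "'a::al_space \<Rightarrow> ('a \<Rightarrow>\<^sub>L 'a) list \<Rightarrow> 'a \<Rightarrow> real" where
  "energy u Qs x =
    (\<Sum>Q\<leftarrow>Qs. (total \<cdot> (Q \<cdot> x))\<^sup>2 / total \<cdot> (Q \<cdot> u))"

lemma abs_total_le: "\<bar>total \<cdot> x\<bar> \<le> norm x"
proof -
  have "total \<cdot> x = total \<cdot> pos_part x - total \<cdot> (pos_part (- x))"
    by (metis blinfun.diff_right pos_part_diff)
  hence "\<bar>total \<cdot> x\<bar> \<le> norm (pos_part x) + norm (pos_part (- x))"
    using norm_ge_zero[of "pos_part x"] norm_ge_zero[of "pos_part (- x)"]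
    unfolding total_nonneg_eq[OF pos_part_nonneg] by linarith
  also have "\<dots> = norm (pos_part x + pos_part (- x))" by (simp add: norm_add_nonneg)
  finally show ?thesis by (simp add: pos_part_sum_abs)
qed

lemma norm_resolution_le:
  assumes "resolution Qs" "Q \<in> set Qs" "\<bar>x\<bar> \<le> u"
  shows "norm (Q \<cdot> x) \<le> norm (Q \<cdot> u)"
proof (rule norm_mono_abs)
  have Q: "positive_op Q" using assms by (simp add: resolution_def)
  have "0 \<le> u" using assms(3) by (meson abs_ge_zero order.trans)
  hence "\<bar>u\<bar> = u" by simp
  thus "\<bar>Q \<cdot> x\<bar> \<le> \<bar>Q \<cdot> u\<bar>"
    using positive_op_mono[OF Q assms(3)] by (simp add: resolution_abs[OF assms(1,2)])
qed

lemma abs_total_resolution_le: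
  assumes "resolution Qs" "Q \<in> set Qs" "\<bar>x\<bar> \<le> u"
  shows "\<bar>total \<cdot> (Q \<cdot> x)\<bar> \<le> total \<cdot> (Q \<cdot> u)"
proof -
  have "0 \<le> u" using assms(3) by (meson abs_ge_zero order.trans)
  hence "0 \<le> Q \<cdot> u" using assms by (simp add: resolution_def positive_op_def)
  thus ?thesis
    using abs_total_le[of "Q \<cdot> x"] norm_resolution_le[OF assms] by (simp add: total_nonneg_eq)
qed

lemma sum_list_swap:
  "(\<Sum>x\<leftarrow>xs. \<Sum>y\<leftarrow>ys. f x y) = (\<Sum>y\<leftarrow>ys. \<Sum>x\<leftarrow>xs. f x y :: real)"
  by (induction xs) (auto simp: sum_list_addf)

lemma energy_nonneg:
  assumes "resolution Qs" "0 \<le> u"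
  shows "0 \<le> energy u Qs x"
  unfolding energy_def
proof (rule sum_list_nonneg)
  fix t assume "t \<in> set (map (\<lambda>Q. (total \<cdot> (Q \<cdot> x))\<^sup>2 / total \<cdot> (Q \<cdot> u)) Qs)"
  then obtain Q where "Q \<in> set Qs"
    "t = (total \<cdot> (Q \<cdot> x))\<^sup>2 / total \<cdot> (Q \<cdot> u)" by auto
  thus "0 \<le> t" using assms by (simp add: resolution_def positive_op_def total_nonneg_eq)
qed

context
  fixes u x :: "'a::al_space"
  assumes x: "\<bar>x\<bar> \<le> u"
begin

lemma energy_le:
  assumes Qs: "resolution Qs"
  shows "energy u Qs x \<le> norm u"
proof -
  have u: "0 \<le> u" using x by (meson abs_ge_zero order.trans)
  have "energy u Qs x \<le> (\<Sum>Q\<leftarrow>Qs. norm (Q \<cdot> u))"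
    unfolding energy_def
  proof (rule sum_list_mono)
    fix Q assume Q: "Q \<in> set Qs"
    let ?a = "total \<cdot> (Q \<cdot> x)" and ?p = "total \<cdot> (Q \<cdot> u)"
    have ap: "\<bar>?a\<bar> \<le> ?p" by (rule abs_total_resolution_le[OF Qs Q x])
    have "?a\<^sup>2 \<le> ?p * ?p"
      using mult_mono[OF ap ap order.trans[OF abs_ge_zero ap] abs_ge_zero] by (simp add: power2_eq_square)
    hence "?a\<^sup>2 / ?p \<le> ?p" using ap by (cases "?p = 0") (auto simp: field_simps)
    also have "?p = norm (Q \<cdot> u)"
      using Qs Q u by (simp add: resolution_def positive_op_def total_nonneg_eq)
    finally show "?a\<^sup>2 / ?p \<le> norm (Q \<cdot> u)" .
  qed
  thus ?thesis using resolution_sum_norm[OF Qs u] by simp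
qed

lemma energy_refine:
  assumes Qs: "resolution Qs" and Rs: "resolution Rs"
  shows "energy u Qs x \<le> energy u (refine Qs Rs) x"
    and "energy u Rs x \<le> energy u (refine Qs Rs) x"
proof -
  let ?a = "\<lambda>Q R. total \<cdot> ((Q o\<^sub>L R) \<cdot> x)"
  let ?p = "\<lambda>Q R. total \<cdot> ((Q o\<^sub>L R) \<cdot> u)"
  have le: "\<bar>?a Q R\<bar> \<le> ?p Q R" if "Q \<in> set Qs" "R \<in> set Rs" for Q R
    by (rule abs_total_resolution_le[OF resolution_refine[OF Qs Rs] _ x])
      (use that in \<open>auto simp: refine_def\<close>)
  have E: "energy u (refine Qs Rs) x = (\<Sum>Q\<leftarrow>Qs. \<Sum>R\<leftarrow>Rs. (?a Q R)\<^sup>2 / ?p Q R)"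
    unfolding energy_def by (rule sum_list_refine)
  have sR: "(\<Sum>R\<leftarrow>Rs. total \<cdot> ((Q o\<^sub>L R) \<cdot> y)) = total \<cdot> (Q \<cdot> y)" for Q y
    by (simp add: blinfun_sum_list_right[symmetric] resolution_sum[OF Rs])
  have sQ: "(\<Sum>Q\<leftarrow>Qs. total \<cdot> ((Q o\<^sub>L R) \<cdot> y)) = total \<cdot> (R \<cdot> y)" for R y
    by (simp add: blinfun_sum_list_right[symmetric] resolution_sum[OF Qs])
  show "energy u Qs x \<le> energy u (refine Qs Rs) x"
    unfolding E unfolding energy_def
  proof (rule sum_list_mono)
    fix Q assume Q: "Q \<in> set Qs"
    show "(total \<cdot> (Q \<cdot> x))\<^sup>2 / total \<cdot> (Q \<cdot> u)
        \<le> (\<Sum>R\<leftarrow>Rs. (?a Q R)\<^sup>2 / ?p Q R)"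
      using sq_sum_list_div_le[of Rs "?a Q" "?p Q", OF le[OF Q]] unfolding sR .
  qed
  show "energy u Rs x \<le> energy u (refine Qs Rs) x"
    unfolding E sum_list_swap[of _ Rs Qs] unfolding energy_def
  proof (rule sum_list_mono)
    fix R assume R: "R \<in> set Rs"
    show "(total \<cdot> (R \<cdot> x))\<^sup>2 / total \<cdot> (R \<cdot> u)
        \<le> (\<Sum>Q\<leftarrow>Qs. (?a Q R)\<^sup>2 / ?p Q R)"
      using sq_sum_list_div_le[of Qs "\<lambda>Q. ?a Q R" "\<lambda>Q. ?p Q R", OF le[OF _ R]] unfolding sQ .
  qed
qed

text \<open>Already the two blocks on which \<open>x\<close> is positive and negative suffice for the Cauchy--Schwarz estimate
  \<open>\<parallel>x\<parallel>\<^sup>2 \<le> \<parallel>u\<parallel> \<integral>x\<^sup>2 / u\<close>.\<close>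

lemma norm_sq_le_energy_split: "(norm x)\<^sup>2 / norm u \<le> energy u (split_at x) x"
proof -
  have u: "0 \<le> u" using x by (meson abs_ge_zero order.trans)
  let ?P = "band_proj (pos_part x)"
  let ?T = "blinfun_apply total"
  have P: "positive_op Q" "resolution (split_at x)" "Q \<in> set (split_at x)" if "Q = ?P \<or> Q = id_blinfun - ?P" for Q
    using resolution_split_at[of x] that by (auto simp: resolution_def split_at_def)
  have 1: "?T (?P \<cdot> x) = norm (pos_part x)"
    by (simp add: band_proj_pos_part total_nonneg_eq)
  have 2: "?T ((id_blinfun - ?P) \<cdot> x) = - norm (pos_part (- x))"
  proof -
    have "(id_blinfun - ?P) \<cdot> x = - pos_part (- x)"
      by (simp add: blinfun.diff_left band_proj_pos_part pos_part_uminus)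
    thus ?thesis by (simp add: blinfun.minus_right total_nonneg_eq)
  qed
  have 3: "\<bar>?T (Q \<cdot> x)\<bar> \<le> ?T (Q \<cdot> u)" if "Q = ?P \<or> Q = id_blinfun - ?P" for Q
    using abs_total_resolution_le[OF P(2,3)[OF that] x] .
  let ?p = "?T (?P \<cdot> u)" and ?r = "?T ((id_blinfun - ?P) \<cdot> u)"
  have "?p + ?r = ?T u"
    by (simp add: blinfun.diff_left blinfun.add_right[symmetric])
  hence pr: "?p + ?r = norm u" using u by (simp add: total_nonneg_eq)
  have "(norm (pos_part x) + norm (pos_part (- x)))\<^sup>2 / (?p + ?r)
      \<le> (norm (pos_part x))\<^sup>2 / ?p + (norm (pos_part (- x)))\<^sup>2 / ?r"
  proof -
    have "norm (pos_part x) \<le> ?p" "norm (pos_part (- x)) \<le> ?r"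
      using 3[of ?P] 3[of "id_blinfun - ?P"] 1 2 by auto
    thus ?thesis
      using norm_ge_zero[of "pos_part x"] norm_ge_zero[of "pos_part (- x)"]
      by (intro sq_add_div_le) linarith+
  qed
  moreover have "norm (pos_part x) + norm (pos_part (- x)) = norm x"
    using norm_add_nonneg[of "pos_part x" "pos_part (- x)"] by (simp add: pos_part_sum_abs)
  ultimately show ?thesis
    unfolding energy_def split_at_def pr by (simp add: 1 2)
qed

end

lemma energy_parallelogram:
  "energy u Qs ((1/2) *\<^sub>R (x + y)) + energy u Qs ((1/2) *\<^sub>R (x - y)) = (energy u Qs x + energy u Qs y) / 2"
proof -
  have "((a + b) / 2)\<^sup>2 / p + ((a - b) / 2)\<^sup>2 / p = (a\<^sup>2 / p + b\<^sup>2 / p) / 2" for a b p :: real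
    by (cases "p = 0") (simp_all add: power2_eq_square field_simps)
  note key = this
  have lin: "total \<cdot> (Q \<cdot> ((1/2) *\<^sub>R (x + y)))
        = (total \<cdot> (Q \<cdot> x) + total \<cdot> (Q \<cdot> y)) / 2"
      "total \<cdot> (Q \<cdot> ((1/2) *\<^sub>R (x - y)))
        = (total \<cdot> (Q \<cdot> x) - total \<cdot> (Q \<cdot> y)) / 2" for Q
    by (simp_all add: blinfun.scaleR_right blinfun.add_right blinfun.diff_right add_divide_distrib diff_divide_distrib)
  show ?thesis
    unfolding energy_def lin
  proof (induction Qs)
    case (Cons Q Qs)
    thus ?case
      using key[of "total \<cdot> (Q \<cdot> x)" "total \<cdot> (Q \<cdot> y)"
          "total \<cdot> (Q \<cdot> u)"]
      unfolding list.map sum_list.Cons by argo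
  qed simp
qed

text \<open>The counterpart of \<open>\<integral>x\<^sup>2 / u\<close>.\<close>

definition sup_energy :: "'a::al_space \<Rightarrow> 'a \<Rightarrow> real" where
  "sup_energy u x = (SUP Qs\<in>Collect resolution. energy u Qs x)"

lemma energy_le_sup_energy:
  assumes "\<bar>x\<bar> \<le> u" "resolution Qs"
  shows "energy u Qs x \<le> sup_energy u x"
  unfolding sup_energy_def
  by (rule cSUP_upper) (use assms in \<open>auto intro!: bdd_aboveI2[of _ _ "norm u"] energy_le\<close>)

lemma resolution_id: "resolution [id_blinfun]"
  by (simp add: resolution_def positive_op_def)

lemma sup_energy_le:
  assumes "\<bar>x\<bar> \<le> u"
  shows "sup_energy u x \<le> norm u"
  unfolding sup_energy_def by (rule cSUP_least) (use resolution_id energy_le[OF assms] in auto)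

lemma sup_energy_nonneg:
  assumes "\<bar>x\<bar> \<le> u"
  shows "0 \<le> sup_energy u x"
  using energy_le_sup_energy[OF assms resolution_id] energy_nonneg[OF resolution_id] assms
  by (meson abs_ge_zero order.trans)

lemma abs_scaleR_banach_lattice: "\<bar>r *\<^sub>R x\<bar> = \<bar>r\<bar> *\<^sub>R \<bar>x :: 'a::banach_lattice\<bar>"
proof -
  have le: "\<bar>c *\<^sub>R y\<bar> \<le> \<bar>c\<bar> *\<^sub>R \<bar>y\<bar>" for c and y :: 'a
    using scaleR_le_abs[of c y] scaleR_le_abs[of "- c" y] by (intro abs_leI) auto
  show ?thesis
  proof (cases "r = 0")
    case False
    have "\<bar>x\<bar> \<le> \<bar>inverse r\<bar> *\<^sub>R \<bar>r *\<^sub>R x\<bar>" using le[of "inverse r" "r *\<^sub>R x"] False by simp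
    hence "\<bar>r\<bar> *\<^sub>R \<bar>x\<bar> \<le> \<bar>r\<bar> *\<^sub>R \<bar>inverse r\<bar> *\<^sub>R \<bar>r *\<^sub>R x\<bar>" by (rule scaleR_left_mono) simp
    also have "\<dots> = \<bar>r *\<^sub>R x\<bar>" using False by (simp add: abs_mult[symmetric])
    finally show ?thesis using le[of r x] by simp
  qed simp
qed

lemma abs_half_add_le:
  fixes x y :: "'a::banach_lattice"
  assumes "\<bar>x\<bar> \<le> u" "\<bar>y\<bar> \<le> u"
  shows "\<bar>(1/2) *\<^sub>R (x + y)\<bar> \<le> u" "\<bar>(1/2) *\<^sub>R (x - y)\<bar> \<le> u"
proof -
  have h: "\<bar>(1/2) *\<^sub>R (x + y)\<bar> \<le> u" if "\<bar>x\<bar> \<le> u" "\<bar>y\<bar> \<le> u" for x y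
  proof -
    have "\<bar>x + y\<bar> \<le> u + u" using that by (meson abs_triangle_ineq add_mono order.trans)
    hence "(1/2) *\<^sub>R \<bar>x + y\<bar> \<le> (1/2) *\<^sub>R (u + u)" by (rule scaleR_left_mono) simp
    also have "(1/2) *\<^sub>R (u + u) = u" by (simp add: scaleR_2[symmetric])
    finally show ?thesis unfolding abs_scaleR_banach_lattice by simp
  qed
  show "\<bar>(1/2) *\<^sub>R (x + y)\<bar> \<le> u" using h assms by blast
  show "\<bar>(1/2) *\<^sub>R (x - y)\<bar> \<le> u" using h[of x "- y"] assms by simp
qed

text \<open>For one resolution the energy is a quadratic form and satisfies the parallelogram law. Refining a
  resolution that is almost optimal for the midpoint by the one that splits the difference according
  to its sign brings in the norm of the difference and does not lose energy of the midpoint. The summand \<open>1\<close> keeps the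
  denominator positive when \<open>u = 0\<close>.\<close>

lemma sup_energy_midpoint:
  assumes x: "\<bar>x\<bar> \<le> u" and y: "\<bar>y\<bar> \<le> u"
  shows "sup_energy u ((1/2) *\<^sub>R (x + y)) + (norm (x - y))\<^sup>2 / (4 * (norm u + 1)) \<le> (sup_energy u x + sup_energy u y) / 2"
proof -
  let ?m = "(1/2) *\<^sub>R (x + y)" and ?d = "(1/2) *\<^sub>R (x - y)"
  note md = abs_half_add_le[OF x y]
  have "sup_energy u ?m \<le> (sup_energy u x + sup_energy u y) / 2 - (norm ?d)\<^sup>2 / norm u"
    unfolding sup_energy_def[of u ?m]
  proof (rule cSUP_least)
    show "Collect resolution \<noteq> {}" using resolution_id by auto
    fix Qs :: "('a \<Rightarrow>\<^sub>L 'a) list" assume "Qs \<in> Collect resolution"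
    hence Qs: "resolution Qs" by simp
    let ?R = "refine Qs (split_at ?d)"
    have R: "resolution ?R" by (intro resolution_refine Qs resolution_split_at)
    have "energy u Qs ?m \<le> energy u ?R ?m" by (rule energy_refine(1)[OF md(1) Qs resolution_split_at])
    moreover have "(norm ?d)\<^sup>2 / norm u \<le> energy u ?R ?d"
      by (rule order.trans[OF norm_sq_le_energy_split[OF md(2)] energy_refine(2)[OF md(2) Qs resolution_split_at]])
    moreover have "energy u ?R x \<le> sup_energy u x" "energy u ?R y \<le> sup_energy u y"
      using energy_le_sup_energy R x y by auto
    ultimately show "energy u Qs ?m \<le> (sup_energy u x + sup_energy u y) / 2 - (norm ?d)\<^sup>2 / norm u"
      using energy_parallelogram[of u ?R x y] by argo
  qed
  moreover have "(norm (x - y))\<^sup>2 / (4 * (norm u + 1)) \<le> (norm ?d)\<^sup>2 / norm u"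
  proof (cases "norm u = 0")
    case True
    hence "\<bar>x\<bar> \<le> 0" "\<bar>y\<bar> \<le> 0" using x y by auto
    thus ?thesis by simp
  next
    case False
    hence "0 < norm u" by simp
    hence "(norm (x - y))\<^sup>2 / (4 * (norm u + 1)) \<le> (norm (x - y))\<^sup>2 / (4 * norm u)"
      by (intro frac_le) auto
    also have "\<dots> = (norm ?d)\<^sup>2 / norm u" by (simp add: power2_eq_square)
    finally show ?thesis .
  qed
  ultimately show ?thesis by argo
qed

lemma norm_sum_list_le: "norm (\<Sum>x\<leftarrow>xs. f x) \<le> (\<Sum>x\<leftarrow>xs. norm (f x))"
  by (induction xs) (auto intro: order.trans[OF norm_triangle_ineq])

section \<open>Real and complex spaces over an AL-space\<close>

text \<open>The two cases are treated at once: \<open>'e\<close> is \<open>'a\<close> itself or its complexification, \<open>m\<close> is the modulus,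
  \<open>emb\<close> the inclusion of \<open>'a\<close>, and \<open>\<i>'\<close> the imaginary unit, for which \<open>0\<close> serves in the real case.
  The assumption \<open>polar\<close> is an approximate polar decomposition: up to \<open>\<epsilon>\<close>, an element is the product of
  its modulus with a simple function whose values \<open>snd p\<close> are scalars of absolute value \<open>1\<close>.\<close>

locale al_scalars = vector_space scl
  for scl :: "'k::{real_normed_field, euclidean_space} \<Rightarrow> 'e::banach \<Rightarrow> 'e" +
  fixes m :: "'e \<Rightarrow> 'a::al_space" and emb :: "'a \<Rightarrow> 'e" and re im :: "'e \<Rightarrow> 'a" and \<i>' :: 'k
  assumes scl_of_real: "scl (of_real r) z = r *\<^sub>R z"
    and norm_m: "norm (m z) = norm z"
    and m_nonneg: "0 \<le> m z"
    and m_add: "m (z + w) \<le> m z + m w"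
    and m_scl: "m (scl c z) \<le> norm c *\<^sub>R m z"
    and emb_linear: "Real_Vector_Spaces.linear emb"
    and m_emb: "m (emb x) = \<bar>x\<bar>"
    and re_linear: "Real_Vector_Spaces.linear re" and im_linear: "Real_Vector_Spaces.linear im"
    and re_emb: "re (emb x) = x" and im_emb: "im (emb x) = 0"
    and abs_re: "\<bar>re z\<bar> \<le> m z" and abs_im: "\<bar>im z\<bar> \<le> m z"
    and decompose: "z = emb (re z) + scl \<i>' (emb (im z))"
    and norm_i: "norm \<i>' \<le> 1"
    and scl_parts: "\<exists>a b. c = of_real a + of_real b * \<i>' \<and> (b = 0 \<or> \<i>' * \<i>' = - 1) \<and>
      re (scl c z) = a *\<^sub>R re z - b *\<^sub>R im z \<and> im (scl c z) = a *\<^sub>R im z + b *\<^sub>R re z"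
    and functional_bound: "(\<And>x. 0 \<le> x \<Longrightarrow> 0 \<le> \<psi> \<cdot> x) \<Longrightarrow>
      norm (of_real (\<psi> \<cdot> re z) + \<i>' * of_real (\<psi> \<cdot> im z)) \<le> \<psi> \<cdot> m z"
    and polar: "0 < \<epsilon> \<Longrightarrow> \<exists>ps :: (('a \<Rightarrow>\<^sub>L 'a) \<times> 'k) list. resolution (map fst ps) \<and>
      (\<forall>p\<in>set ps. norm (snd p) = 1) \<and>
      (\<Sum>p\<leftarrow>ps. norm (emb (fst p \<cdot> re z) + scl \<i>' (emb (fst p \<cdot> im z))
        - scl (snd p) (emb (fst p \<cdot> m z)))) \<le> \<epsilon>"
begin

lemma norm_le_m: "m z \<le> x \<Longrightarrow> norm z \<le> norm x"
  using norm_mono_nonneg[OF m_nonneg, of z x] norm_m by metis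

lemma norm_scl_le: "norm (scl c z) \<le> norm c * norm z"
  using norm_le_m[OF m_scl[of c z]] by (simp add: norm_m)

lemma scl_scaleR: "scl c (r *\<^sub>R z) = r *\<^sub>R scl c z"
  by (metis scl_of_real scale_scale mult.commute)

lemma bounded_linear_scl: "bounded_linear (scl c)"
  by (rule bounded_linear_intro[where K = "norm c"])
    (use norm_scl_le[of c] in \<open>auto simp: scale_right_distrib scl_scaleR mult.commute\<close>)

lemma norm_emb: "norm (emb x) = norm x"
  using norm_m[of "emb x"] by (simp add: m_emb)

lemma norm_re: "norm (re z) \<le> norm z" and norm_im: "norm (im z) \<le> norm z"
  using norm_mono_nonneg[OF abs_ge_zero abs_re] norm_mono_nonneg[OF abs_ge_zero abs_im] by (simp_all add: norm_m)

lemma bounded_linear_emb: "bounded_linear emb" and bounded_linear_re: "bounded_linear re"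
  and bounded_linear_im: "bounded_linear im"
  by (rule bounded_linear_intro[where K = 1];
      use emb_linear re_linear im_linear norm_re norm_im in \<open>auto simp: linear_add linear_scale norm_emb\<close>)+

lemma norm_i_scl: "norm (scl \<i>' z) \<le> norm z"
  using norm_scl_le[of \<i>' z] mult_right_mono[OF norm_i norm_ge_zero[of z]] by simp

lemma norm_le_re_im: "norm z \<le> norm (re z) + norm (im z)"
proof -
  have "norm z = norm (emb (re z) + scl \<i>' (emb (im z)))" using decompose[of z] by simp
  also have "\<dots> \<le> norm (re z) + norm (im z)"
    using norm_triangle_ineq[of "emb (re z)" "scl \<i>' (emb (im z))"] norm_i_scl[of "emb (im z)"]
    by (simp add: norm_emb)
  finally show ?thesis .
qed

text \<open>The target is kept general in order to cover both operators into \<open>'e\<close> and functionals with values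
  in \<open>'k\<close>.\<close>

lemma extension_linear:
  fixes L :: "'a \<Rightarrow>\<^sub>L 'b::banach" and sc :: "'k \<Rightarrow> 'b \<Rightarrow> 'b"
  assumes sc: "vector_space sc" and scR: "\<And>r z. sc (of_real r) z = r *\<^sub>R z"
  shows "Vector_Spaces.linear scl sc (\<lambda>z. L \<cdot> re z + sc \<i>' (L \<cdot> im z))"
proof -
  interpret sc: vector_space sc by (rule sc)
  have comm: "sc c (r *\<^sub>R z) = r *\<^sub>R sc c z" for c r z by (metis scR sc.scale_scale mult.commute)
  show ?thesis
    unfolding Vector_Spaces.linear_iff
  proof (intro conjI allI)
    show "vector_space scl" by unfold_locales
    show "vector_space sc" by (rule sc)
    show "L \<cdot> (re (x + y)) + sc \<i>' (L \<cdot> (im (x + y)))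
      = L \<cdot> re x + sc \<i>' (L \<cdot> im x) + (L \<cdot> re y + sc \<i>' (L \<cdot> im y))" for x y
      by (simp add: linear_add[OF re_linear] linear_add[OF im_linear] blinfun.add_right sc.scale_right_distrib)
  next
    fix c z
    obtain a b where ab: "c = of_real a + of_real b * \<i>'" "b = 0 \<or> \<i>' * \<i>' = - 1"
      "re (scl c z) = a *\<^sub>R re z - b *\<^sub>R im z" "im (scl c z) = a *\<^sub>R im z + b *\<^sub>R re z"
      using scl_parts by blast
    let ?x = "L \<cdot> re z" and ?y = "L \<cdot> im z"
    have "sc c (?x + sc \<i>' ?y) = sc (of_real a) (?x + sc \<i>' ?y) + sc (of_real b) (sc \<i>' (?x + sc \<i>' ?y))"
      by (simp add: ab(1) sc.scale_left_distrib)
    also have "\<dots> = a *\<^sub>R (?x + sc \<i>' ?y) + b *\<^sub>R sc \<i>' (?x + sc \<i>' ?y)"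
      by (simp only: scR)
    also have "\<dots> = a *\<^sub>R ?x + a *\<^sub>R sc \<i>' ?y + b *\<^sub>R sc \<i>' ?x + b *\<^sub>R sc (\<i>' * \<i>') ?y"
      by (simp add: sc.scale_right_distrib scaleR_right_distrib)
    also have "b *\<^sub>R sc (\<i>' * \<i>') ?y = - (b *\<^sub>R ?y)" using ab(2) by auto
    finally show "L \<cdot> re (scl c z) + sc \<i>' (L \<cdot> im (scl c z)) = sc c (?x + sc \<i>' ?y)"
      by (simp add: ab(3,4) blinfun.add_right blinfun.diff_right blinfun.scaleR_right sc.scale_right_distrib comm)
  qed
qed

definition lift :: "('a \<Rightarrow>\<^sub>L 'e) \<Rightarrow> 'e \<Rightarrow>\<^sub>L 'e" where
  "lift L = Blinfun (\<lambda>z. L \<cdot> re z + scl \<i>' (L \<cdot> im z))"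

lemma lift_apply: "lift L \<cdot> z = L \<cdot> re z + scl \<i>' (L \<cdot> im z)"
proof -
  have "bounded_linear (\<lambda>z. L \<cdot> re z + scl \<i>' (L \<cdot> im z))"
    by (intro bounded_linear_add bounded_linear_compose[OF bounded_linear_scl]
        bounded_linear_compose[OF blinfun.bounded_linear_right] bounded_linear_re bounded_linear_im)
  thus ?thesis by (simp add: lift_def bounded_linear_Blinfun_apply)
qed

lemma linear_lift: "Vector_Spaces.linear scl scl (blinfun_apply (lift L))"
proof -
  have "vector_space scl" by unfold_locales
  from extension_linear[OF this scl_of_real, of L] show ?thesis by (simp add: lift_apply[abs_def])
qed

lemma lift_emb: "lift L \<cdot> emb x = L \<cdot> x"
  by (simp add: lift_apply re_emb im_emb)

lemma vector_space_field: "vector_space ((*) :: 'k \<Rightarrow> 'k \<Rightarrow> 'k)"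
  by unfold_locales (auto simp: algebra_simps)

lemma dualI:
  assumes "bounded_linear f" "\<And>c z. f (scl c z) = c * f z"
  shows "f \<in> dual scl"
proof -
  have "vector_space scl" by unfold_locales
  thus ?thesis using assms vector_space_field
    by (auto simp: dual_def Vector_Spaces.linear_iff linear_simps)
qed

lemma dualD:
  assumes "f \<in> dual scl"
  shows "bounded_linear f" "f (scl c z) = c * f z"
  using assms by (auto simp: dual_def Vector_Spaces.linear_iff)

definition flift :: "('a \<Rightarrow>\<^sub>L real) \<Rightarrow> 'e \<Rightarrow> 'k" where
  "flift \<psi> z = of_real (\<psi> \<cdot> re z) + \<i>' * of_real (\<psi> \<cdot> im z)"

lemma flift_dual: "flift \<psi> \<in> dual scl"
proof (rule dualI)
  show "bounded_linear (flift \<psi>)" unfolding flift_def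
    by (intro bounded_linear_add bounded_linear_compose[OF bounded_linear_of_real]
        bounded_linear_compose[OF bounded_linear_mult_right]
        bounded_linear_compose[OF blinfun.bounded_linear_right] bounded_linear_re bounded_linear_im)
  have "bounded_linear (\<lambda>x. of_real (\<psi> \<cdot> x) :: 'k)"
    by (intro bounded_linear_compose[OF bounded_linear_of_real] blinfun.bounded_linear_right)
  hence "blinfun_apply (Blinfun (\<lambda>x. of_real (\<psi> \<cdot> x) :: 'k)) = (\<lambda>x. of_real (\<psi> \<cdot> x))"
    by (rule bounded_linear_Blinfun_apply)
  moreover have "of_real r * z = r *\<^sub>R z" for r and z :: 'k by (simp add: scaleR_conv_of_real)
  ultimately show "flift \<psi> (scl c z) = c * flift \<psi> z" for c z
    using extension_linear[OF vector_space_field, of "Blinfun (\<lambda>x. of_real (\<psi> \<cdot> x))"]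
    by (auto simp: flift_def Vector_Spaces.linear_iff)
qed

lemma flift_emb: "flift \<psi> (emb x) = of_real (\<psi> \<cdot> x)"
  by (simp add: flift_def re_emb im_emb)

text \<open>With \<open>s\<close> a simple function such that \<open>z\<close> is close to \<open>s |z|\<close>, the functional is \<open>g \<mapsto> \<psi> (s\<^sup>-\<^sup>1 g)\<close>; it attains
  almost \<open>\<psi> |z|\<close> at \<open>z\<close> and is dominated by \<open>\<psi>\<close> because \<open>|s| = 1\<close>.\<close>

lemma positive_functional_polar:
  assumes pos: "\<And>x. 0 \<le> x \<Longrightarrow> 0 \<le> \<psi> \<cdot> x" and \<epsilon>: "0 < \<epsilon>"
  shows "\<exists>\<phi>\<in>dual scl. (\<forall>g. norm (\<phi> g) \<le> \<psi> \<cdot> m g) \<and> \<psi> \<cdot> m z - \<epsilon> \<le> norm (\<phi> z)"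
proof -
  define \<delta> where "\<delta> = \<epsilon> / (norm \<psi> + 1)"
  have "0 < norm \<psi> + 1" using norm_ge_zero[of \<psi>] by linarith
  hence \<delta>: "0 < \<delta>" "norm \<psi> * \<delta> \<le> \<epsilon>" using \<epsilon> by (auto simp: \<delta>_def field_simps)
  obtain ps :: "(('a \<Rightarrow>\<^sub>L 'a) \<times> 'k) list" where ps: "resolution (map fst ps)" "\<And>p. p \<in> set ps \<Longrightarrow> norm (snd p) = 1"
    "(\<Sum>p\<leftarrow>ps. norm (emb (fst p \<cdot> re z) + scl \<i>' (emb (fst p \<cdot> im z))
        - scl (snd p) (emb (fst p \<cdot> m z)))) \<le> \<delta>"
    using polar[OF \<delta>(1), of z] by blast
  have sumf: "(\<Sum>p\<leftarrow>ps. \<psi> \<cdot> (fst p \<cdot> x)) = \<psi> \<cdot> x" for x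
    using resolution_sum[OF ps(1), of x] blinfun_sum_list_right[of \<psi> "\<lambda>p. fst p \<cdot> x" ps]
    by (simp add: o_def)
  have fp: "positive_op (fst p)" if "p \<in> set ps" for p using ps(1) that by (auto simp: resolution_def)
  define \<phi> where "\<phi> g = (\<Sum>p\<leftarrow>ps. inverse (snd p) * flift (\<psi> o\<^sub>L fst p) g)" for g
  have gen: "(\<lambda>g. \<Sum>p\<leftarrow>qs. inverse (snd p) * flift (\<psi> o\<^sub>L fst p) g) \<in> dual scl" for qs :: "(('a \<Rightarrow>\<^sub>L 'a) \<times> 'k) list"
  proof (induction qs)
    case Nil
    show ?case by (rule dualI) auto
  next
    case (Cons p qs)
    show ?case
    proof (rule dualI)
      show "bounded_linear (\<lambda>g. \<Sum>p\<leftarrow>p # qs. inverse (snd p) * flift (\<psi> o\<^sub>L fst p) g)"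
        using bounded_linear_add[OF bounded_linear_compose[OF bounded_linear_mult_right dualD(1)[OF flift_dual]] dualD(1)[OF Cons.IH]]
        by simp
      show "(\<Sum>p\<leftarrow>p # qs. inverse (snd p) * flift (\<psi> o\<^sub>L fst p) (scl c z)) =
        c * (\<Sum>p\<leftarrow>p # qs. inverse (snd p) * flift (\<psi> o\<^sub>L fst p) z)" for c z
        using dualD(2)[OF Cons.IH, of c z] dualD(2)[OF flift_dual, of _ c z] by (simp add: algebra_simps)
    qed
  qed
  have dual: "\<phi> \<in> dual scl" unfolding \<phi>_def[abs_def] by (rule gen)
  have bound: "norm (\<phi> g) \<le> \<psi> \<cdot> m g" for g
  proof -
    have "norm (\<phi> g) \<le> (\<Sum>p\<leftarrow>ps. norm (inverse (snd p) * flift (\<psi> o\<^sub>L fst p) g))"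
      unfolding \<phi>_def by (rule norm_sum_list_le)
    also have "\<dots> \<le> (\<Sum>p\<leftarrow>ps. \<psi> \<cdot> (fst p \<cdot> m g))"
    proof (rule sum_list_mono)
      fix p assume p: "p \<in> set ps"
      have "norm (flift (\<psi> o\<^sub>L fst p) g) \<le> (\<psi> o\<^sub>L fst p) \<cdot> m g"
        unfolding flift_def by (rule functional_bound) (use fp[OF p] pos in \<open>auto simp: positive_op_def\<close>)
      thus "norm (inverse (snd p) * flift (\<psi> o\<^sub>L fst p) g) \<le> \<psi> \<cdot> (fst p \<cdot> m g)"
        using ps(2)[OF p] by (simp add: norm_mult norm_inverse)
    qed
    finally show ?thesis by (simp add: sumf)
  qed
  define err where "err p = emb (fst p \<cdot> re z) + scl \<i>' (emb (fst p \<cdot> im z))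
        - scl (snd p) (emb (fst p \<cdot> m z))" for p :: "('a \<Rightarrow>\<^sub>L 'a) \<times> 'k"
  have summand: "inverse (snd p) * flift (\<psi> o\<^sub>L fst p) z
      = of_real (\<psi> \<cdot> (fst p \<cdot> m z)) + inverse (snd p) * flift \<psi> (err p)"
    if p: "p \<in> set ps" for p
  proof -
    interpret f: bounded_linear "flift \<psi>" by (rule dualD(1)[OF flift_dual])
    have "flift (\<psi> o\<^sub>L fst p) z = flift \<psi> (emb (fst p \<cdot> re z) + scl \<i>' (emb (fst p \<cdot> im z)))"
      by (simp add: f.add dualD(2)[OF flift_dual] flift_emb) (simp add: flift_def)
    also have "\<dots> = flift \<psi> (scl (snd p) (emb (fst p \<cdot> m z)) + err p)"
      by (simp add: err_def)
    also have "\<dots> = snd p * of_real (\<psi> \<cdot> (fst p \<cdot> m z)) + flift \<psi> (err p)"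
      by (simp add: f.add dualD(2)[OF flift_dual] flift_emb)
    finally show ?thesis using ps(2)[OF p] by (simp add: algebra_simps) (auto simp: field_simps)
  qed
  have "\<phi> z = (\<Sum>p\<leftarrow>ps. of_real (\<psi> \<cdot> (fst p \<cdot> m z)) + inverse (snd p) * flift \<psi> (err p))"
    unfolding \<phi>_def by (intro arg_cong[of _ _ sum_list] map_cong refl summand)
  also have "\<dots> = of_real (\<Sum>p\<leftarrow>ps. \<psi> \<cdot> (fst p \<cdot> m z)) + (\<Sum>p\<leftarrow>ps. inverse (snd p) * flift \<psi> (err p))"
    unfolding sum_list_addf by (induction ps) auto
  finally have \<phi>z: "\<phi> z = of_real (\<psi> \<cdot> m z) + (\<Sum>p\<leftarrow>ps. inverse (snd p) * flift \<psi> (err p))"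
    by (simp add: sumf)
  have "norm (\<Sum>p\<leftarrow>ps. inverse (snd p) * flift \<psi> (err p)) \<le> (\<Sum>p\<leftarrow>ps. norm (inverse (snd p) * flift \<psi> (err p)))"
    by (rule norm_sum_list_le)
  also have "\<dots> \<le> (\<Sum>p\<leftarrow>ps. norm \<psi> * norm (err p))"
  proof (rule sum_list_mono)
    fix p assume p: "p \<in> set ps"
    have "norm (flift \<psi> (err p)) \<le> \<psi> \<cdot> m (err p)"
      unfolding flift_def by (rule functional_bound[OF pos])
    also have "\<dots> \<le> norm \<psi> * norm (err p)"
      using norm_blinfun[of \<psi> "m (err p)"] by (simp add: norm_m)
    finally show "norm (inverse (snd p) * flift \<psi> (err p)) \<le> norm \<psi> * norm (err p)"
      using ps(2)[OF p] by (simp add: norm_mult norm_inverse)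
  qed
  also have "\<dots> = norm \<psi> * (\<Sum>p\<leftarrow>ps. norm (err p))" by (rule sum_list_const_mult)
  also have "\<dots> \<le> norm \<psi> * \<delta>" using ps(3) by (intro mult_left_mono) (auto simp: err_def)
  finally have "norm (\<Sum>p\<leftarrow>ps. inverse (snd p) * flift \<psi> (err p)) \<le> \<epsilon>" using \<delta>(2) by linarith
  moreover have "norm (of_real (\<psi> \<cdot> m z) :: 'k) = \<psi> \<cdot> m z"
    using pos[OF m_nonneg] by simp
  ultimately have "\<psi> \<cdot> m z - \<epsilon> \<le> norm (\<phi> z)"
    unfolding \<phi>z using norm_diff_ineq[of "of_real (\<psi> \<cdot> m z) :: 'k" "\<Sum>p\<leftarrow>ps. inverse (snd p) * flift \<psi> (err p)"]
    by linarith
  with dual bound show ?thesis by blast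
qed

text \<open>This takes the place of the Hahn--Banach theorem: it separates points and computes norms.\<close>

lemma norming_functional:
  assumes "0 < \<epsilon>"
  shows "\<exists>\<phi>\<in>dual scl. (\<forall>g. norm (\<phi> g) \<le> norm g) \<and> norm z - \<epsilon> \<le> norm (\<phi> z)"
  using positive_functional_polar[of total \<epsilon> z] assms
  by (simp add: total_nonneg_eq m_nonneg norm_m)

lemma polar_sum:
  assumes "0 < \<epsilon>"
  shows "\<exists>ps :: (('a \<Rightarrow>\<^sub>L 'a) \<times> 'k) list. resolution (map fst ps) \<and> (\<forall>p\<in>set ps. norm (snd p) = 1) \<and>
    norm (z - (\<Sum>p\<leftarrow>ps. scl (snd p) (emb (fst p \<cdot> m z)))) \<le> \<epsilon>"
proof -
  obtain ps :: "(('a \<Rightarrow>\<^sub>L 'a) \<times> 'k) list" where ps: "resolution (map fst ps)" "\<And>p. p \<in> set ps \<Longrightarrow> norm (snd p) = 1"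
    "(\<Sum>p\<leftarrow>ps. norm (emb (fst p \<cdot> re z) + scl \<i>' (emb (fst p \<cdot> im z))
        - scl (snd p) (emb (fst p \<cdot> m z)))) \<le> \<epsilon>"
    using polar[OF assms, of z] by blast
  have lin: "F (\<Sum>p\<leftarrow>qs. fst p \<cdot> x) = (\<Sum>p\<leftarrow>qs. F (fst p \<cdot> x))"
    if "Real_Vector_Spaces.linear F" for F :: "'a \<Rightarrow> 'e" and x and qs :: "(('a \<Rightarrow>\<^sub>L 'a) \<times> 'k) list"
    by (induction qs) (simp_all add: linear_add[OF that] linear_0[OF that])
  have sx: "(\<Sum>p\<leftarrow>ps. fst p \<cdot> x) = x" for x
    using resolution_sum[OF ps(1), of x] by (simp add: o_def)
  have lin_i: "Real_Vector_Spaces.linear (\<lambda>x. scl \<i>' (emb x))"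
    using bounded_linear_compose[OF bounded_linear_scl bounded_linear_emb] bounded_linear.linear by blast
  have "z = (\<Sum>p\<leftarrow>ps. emb (fst p \<cdot> re z)) + (\<Sum>p\<leftarrow>ps. scl \<i>' (emb (fst p \<cdot> im z)))"
    using decompose[of z] lin[OF emb_linear, of "re z" ps] lin[OF lin_i, of "im z" ps] by (simp add: sx)
  hence "z - (\<Sum>p\<leftarrow>ps. scl (snd p) (emb (fst p \<cdot> m z)))
    = (\<Sum>p\<leftarrow>ps. emb (fst p \<cdot> re z) + scl \<i>' (emb (fst p \<cdot> im z))
        - scl (snd p) (emb (fst p \<cdot> m z)))"
    by (simp add: sum_list_addf sum_list_subtractf)
  hence "norm (z - (\<Sum>p\<leftarrow>ps. scl (snd p) (emb (fst p \<cdot> m z)))) \<le> \<epsilon>"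
    using order.trans[OF norm_sum_list_le ps(3)] by simp
  with ps(1,2) show ?thesis by blast
qed

lemma m_zero: "m 0 = 0" using norm_m[of 0] by simp

lemma m_sum_list_le: "m (\<Sum>p\<leftarrow>ps. f p) \<le> (\<Sum>p\<leftarrow>ps. m (f p))"
  by (induction ps) (auto simp: m_zero intro: order.trans[OF m_add])

lemma m_polar_sum_le:
  assumes "resolution (map fst ps)" "\<forall>p\<in>set ps. norm (snd p) = 1" "0 \<le> x"
  shows "m (\<Sum>p\<leftarrow>ps. scl (snd p) (emb (fst p \<cdot> x))) \<le> x"
proof -
  have "m (\<Sum>p\<leftarrow>ps. scl (snd p) (emb (fst p \<cdot> x))) \<le> (\<Sum>p\<leftarrow>ps. fst p \<cdot> x)"
  proof (rule order.trans[OF m_sum_list_le sum_list_mono])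
    fix p assume p: "p \<in> set ps"
    have "0 \<le> (fst p) \<cdot> x" using assms p by (auto simp: resolution_def positive_op_def)
    thus "m (scl (snd p) (emb (fst p \<cdot> x))) \<le> (fst p) \<cdot> x"
      using m_scl[of "snd p" "emb (fst p \<cdot> x)"] assms(2) p by (simp add: m_emb)
  qed
  thus ?thesis using resolution_sum[OF assms(1), of x] by (simp add: o_def)
qed

lemma diff_inf_eq: "x - inf x u = pos_part (x - u)" for x u :: 'a
proof -
  have "pos_part (x - u) + u = sup (x - u + u) (0 + u)" unfolding pos_part_def by (rule add_sup_distrib_right)
  moreover have "x + u = sup x u + inf x u" by (rule add_eq_inf_sup[of x u])
  ultimately have "x + u = pos_part (x - u) + inf x u + u" by (simp add: add_ac)
  hence "x = pos_part (x - u) + inf x u" by (rule add_right_imp_eq)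
  thus ?thesis by (simp only: diff_eq_eq)
qed

text \<open>With \<open>z\<close> close to \<open>s |z|\<close> for a simple \<open>s\<close>, take \<open>w = s (|z| \<and> u)\<close>.\<close>

lemma truncation:
  assumes u: "0 \<le> u" and c: "norm (pos_part (m z - u)) \<le> c" and \<epsilon>: "0 < \<epsilon>"
  shows "\<exists>w. m w \<le> u \<and> norm (z - w) \<le> c + \<epsilon>"
proof -
  obtain ps :: "(('a \<Rightarrow>\<^sub>L 'a) \<times> 'k) list" where ps: "resolution (map fst ps)" "\<forall>p\<in>set ps. norm (snd p) = 1"
    "norm (z - (\<Sum>p\<leftarrow>ps. scl (snd p) (emb (fst p \<cdot> m z)))) \<le> \<epsilon>"
    using polar_sum[OF \<epsilon>, of z] by blast
  define S where "S x = (\<Sum>p\<leftarrow>ps. scl (snd p) (emb (fst p \<cdot> x)))" for x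
  have S_diff: "S (x - y) = S x - S y" for x y
    unfolding S_def sum_list_subtractf[symmetric]
    by (simp add: blinfun.diff_right linear_diff[OF emb_linear] scale_right_diff_distrib)
  define w where "w = S (inf (m z) u)"
  have "m w \<le> inf (m z) u"
    unfolding w_def S_def by (rule m_polar_sum_le[OF ps(1,2)]) (simp add: m_nonneg u)
  hence "m w \<le> u" by simp
  moreover have "norm (S (m z) - w) \<le> c"
  proof -
    have "S (m z) - w = S (pos_part (m z - u))" unfolding w_def S_diff[symmetric] diff_inf_eq ..
    moreover have "m (S (pos_part (m z - u))) \<le> pos_part (m z - u)"
      unfolding S_def by (rule m_polar_sum_le[OF ps(1,2)]) simp
    ultimately show ?thesis using norm_le_m c by (metis order.trans)
  qed
  moreover have "norm (z - w) \<le> norm (z - S (m z)) + norm (S (m z) - w)"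
    using norm_triangle_ineq[of "z - S (m z)" "S (m z) - w"] by simp
  ultimately show ?thesis using ps(3) by (intro exI[of _ w]) (auto simp: S_def)
qed

text \<open>By the polar decomposition and additivity of the norm, the unit ball is the closed absolutely convex
  hull of its positive part.\<close>

lemma norm_le_on_cone:
  fixes R :: "'e \<Rightarrow>\<^sub>L 'e"
  assumes R: "Vector_Spaces.linear scl scl (blinfun_apply R)"
    and c: "\<And>x. 0 \<le> x \<Longrightarrow> norm (R \<cdot> emb x) \<le> c * norm x"
  shows "norm (R \<cdot> z) \<le> c * norm z"
proof (rule field_le_epsilon)
  fix \<epsilon> :: real assume \<epsilon>: "0 < \<epsilon>"
  define \<delta> where "\<delta> = \<epsilon> / (norm R + 1)"
  have "0 < norm R + 1" using norm_ge_zero[of R] by linarith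
  hence \<delta>: "0 < \<delta>" "norm R * \<delta> \<le> \<epsilon>" using \<epsilon> by (auto simp: \<delta>_def field_simps)
  have Rs: "R \<cdot> scl a y = scl a (R \<cdot> y)" for a y
    using R by (simp add: Vector_Spaces.linear_iff)
  obtain ps :: "(('a \<Rightarrow>\<^sub>L 'a) \<times> 'k) list" where ps: "resolution (map fst ps)" "\<forall>p\<in>set ps. norm (snd p) = 1"
    "norm (z - (\<Sum>p\<leftarrow>ps. scl (snd p) (emb (fst p \<cdot> m z)))) \<le> \<delta>"
    using polar_sum[OF \<delta>(1), of z] by blast
  let ?S = "\<Sum>p\<leftarrow>ps. scl (snd p) (emb (fst p \<cdot> m z))"
  have "norm (R \<cdot> ?S) \<le> (\<Sum>p\<leftarrow>ps. norm (scl (snd p) (R \<cdot> (emb (fst p \<cdot> m z)))))"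
    unfolding blinfun_sum_list_right Rs by (rule norm_sum_list_le)
  also have "\<dots> \<le> (\<Sum>p\<leftarrow>ps. c * norm (fst p \<cdot> m z))"
  proof (rule sum_list_mono)
    fix p assume p: "p \<in> set ps"
    have "0 \<le> (fst p) \<cdot> m z" using ps p m_nonneg by (auto simp: resolution_def positive_op_def)
    thus "norm (scl (snd p) (R \<cdot> (emb (fst p \<cdot> m z)))) \<le> c * norm (fst p \<cdot> m z)"
      using norm_scl_le[of "snd p" "R \<cdot> (emb (fst p \<cdot> m z))"] c ps(2) p by fastforce
  qed
  also have "\<dots> = c * norm z"
    using resolution_sum_norm[OF ps(1) m_nonneg[of z]] by (simp add: sum_list_const_mult o_def norm_m)
  finally have 1: "norm (R \<cdot> ?S) \<le> c * norm z" .
  have "norm (R \<cdot> (z - ?S)) \<le> norm R * \<delta>"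
    using norm_blinfun[of R "z - ?S"] mult_left_mono[OF ps(3) norm_ge_zero[of R]] by linarith
  moreover have "R \<cdot> z = R \<cdot> ?S + R \<cdot> (z - ?S)"
    by (simp add: blinfun.diff_right)
  ultimately show "norm (R \<cdot> z) \<le> c * norm z + \<epsilon>"
    using 1 \<delta>(2) norm_triangle_ineq[of "R \<cdot> ?S" "R \<cdot> (z - ?S)"] by simp
qed

end

text \<open>A finite version of Freudenthal's theorem: split according to the signs of \<open>f - (k / N) s\<close>. On
  each piece, \<open>f\<close> then lies between consecutive multiples of \<open>s\<close>.\<close>

lemma simultaneous_approximation:
  fixes s :: "'a::al_space"
  assumes F: "finite F" "\<And>f. f \<in> F \<Longrightarrow> \<bar>f\<bar> \<le> s" and \<delta>: "0 < \<delta>"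
  shows "\<exists>Qs. resolution Qs \<and> (\<forall>Q\<in>set Qs. \<forall>f\<in>F. \<exists>t.
    \<bar>Q \<cdot> f - t *\<^sub>R Q \<cdot> s\<bar> \<le> \<delta> *\<^sub>R Q \<cdot> s)"
proof -
  obtain n where n: "inverse (real (Suc n)) < \<delta>" using reals_Archimedean[OF \<delta>] by blast
  define N where "N = int (Suc n)"
  have N: "0 < N" "1 / of_int N \<le> \<delta>" using n by (auto simp: N_def inverse_eq_divide)
  define g where "g f k = f - (of_int k / of_int N) *\<^sub>R s" for f and k :: int
  have "finite ((\<lambda>(f, k). g f k) ` (F \<times> {- N..N}))" using F(1) by simp
  from signed_resolution_exists[OF this] obtain Qs where Qs: "resolution Qs"
    "\<forall>Q\<in>set Qs. \<forall>z\<in>(\<lambda>(f, k). g f k) ` (F \<times> {- N..N}). 0 \<le> Q \<cdot> z \<or> Q \<cdot> z \<le> 0"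
    by blast
  have "\<exists>t. \<bar>Q \<cdot> f - t *\<^sub>R Q \<cdot> s\<bar> \<le> \<delta> *\<^sub>R Q \<cdot> s"
    if Q: "Q \<in> set Qs" and f: "f \<in> F" for Q f
  proof -
    have pos: "positive_op Q" using Qs(1) Q by (simp add: resolution_def)
    have s: "0 \<le> s" using F(2)[OF f] by (meson abs_ge_zero order.trans)
    have Qs0: "0 \<le> Q \<cdot> s" using pos s by (simp add: positive_op_def)
    have sign: "0 \<le> Q \<cdot> g f k \<or> Q \<cdot> g f k \<le> 0" if "k \<in> {- N..N}" for k
      using Qs(2) Q f that by force
    define A where "A = {k \<in> {- N..N}. 0 \<le> Q \<cdot> g f k}"
    have "- N \<in> A"
    proof -
      have "- f \<le> s" using F(2)[OF f] by (meson abs_ge_minus_self order.trans)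
      hence "0 \<le> s - (- f)" by (simp only: diff_ge_0_iff_ge)
      also have "s - (- f) = g f (- N)" using N(1) by (simp add: g_def add.commute)
      finally have "0 \<le> g f (- N)" .
      thus ?thesis using pos N(1) by (simp add: A_def positive_op_def)
    qed
    moreover have "finite A" by (rule finite_subset[of _ "{- N..N}"]) (auto simp: A_def)
    ultimately have Max: "Max A \<in> A" "\<And>k. k \<in> A \<Longrightarrow> k \<le> Max A" by (auto intro: Max_in)
    let ?k = "Max A" and ?q = "Q \<cdot> s"
    have low: "(of_int ?k / of_int N) *\<^sub>R ?q \<le> Q \<cdot> f"
      using Max(1) by (simp add: A_def g_def blinfun.diff_right blinfun.scaleR_right)
    have "Q \<cdot> f \<le> (of_int ?k / of_int N) *\<^sub>R ?q + \<delta> *\<^sub>R ?q"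
    proof (cases "?k = N")
      case True
      have "f \<le> s" using F(2)[OF f] by (meson abs_ge_self order.trans)
      hence "Q \<cdot> f \<le> ?q" by (rule positive_op_mono[OF pos])
      moreover have "0 \<le> \<delta> *\<^sub>R ?q" using \<delta> Qs0 by (simp add: scaleR_nonneg_nonneg)
      ultimately show ?thesis using True N(1) by (simp add: add_increasing2)
    next
      case False
      have "?k \<in> {- N..N}" using Max(1) unfolding A_def by blast
      hence k: "?k + 1 \<in> {- N..N}" using False by auto
      hence "\<not> 0 \<le> Q \<cdot> (g f (?k + 1))" using Max(2)[of "?k + 1"] by (auto simp: A_def)
      hence "Q \<cdot> (g f (?k + 1)) \<le> 0" using sign[OF k] by blast
      hence "Q \<cdot> f \<le> ((of_int ?k + 1) / of_int N) *\<^sub>R ?q"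
        by (simp add: g_def blinfun.diff_right blinfun.scaleR_right)
      also have "\<dots> = (of_int ?k / of_int N) *\<^sub>R ?q + (1 / of_int N) *\<^sub>R ?q"
        by (simp add: add_divide_distrib scaleR_left_distrib)
      also have "\<dots> \<le> (of_int ?k / of_int N) *\<^sub>R ?q + \<delta> *\<^sub>R ?q"
        by (intro add_left_mono scaleR_right_mono N(2) Qs0)
      finally show ?thesis .
    qed
    moreover have "0 \<le> \<delta> *\<^sub>R ?q" using \<delta> Qs0 by (simp add: scaleR_nonneg_nonneg)
    ultimately have "\<bar>Q \<cdot> f - (of_int ?k / of_int N) *\<^sub>R ?q\<bar> \<le> \<delta> *\<^sub>R ?q"
    proof (intro abs_leI)
      assume *: "0 \<le> \<delta> *\<^sub>R ?q"
      have "(of_int ?k / of_int N) *\<^sub>R ?q - Q \<cdot> f \<le> 0" using low by simp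
      also note *
      finally show "- (Q \<cdot> f - (of_int ?k / of_int N) *\<^sub>R ?q) \<le> \<delta> *\<^sub>R ?q" by simp
    qed (simp add: diff_le_eq add.commute)
    thus ?thesis by blast
  qed
  with Qs(1) show ?thesis by blast
qed

context al_scalars
begin

section \<open>The weak topology\<close>

lemma topspace_weak: "topspace (weak_topology scl) = UNIV"
proof -
  have "(\<lambda>_. 0) \<in> dual scl" by (rule dualI) auto
  hence "(\<lambda>_. 0 :: 'k) -` UNIV \<in> {f -` U | f U. f \<in> dual scl \<and> open U}" by blast
  hence "UNIV \<in> {f -` U | f U. f \<in> dual scl \<and> open U}" by simp
  thus ?thesis unfolding weak_topology_def topology_generated_by_topspace by blast
qed

lemma openin_weak_vimage:
  assumes "f \<in> dual scl" "open U"
  shows "openin (weak_topology scl) (f -` U)"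
proof -
  have "f -` U \<in> {f -` U | f U. f \<in> dual scl \<and> open U}" using assms by auto
  thus ?thesis unfolding weak_topology_def by (rule topology_generated_by_Basis)
qed

lemma weak_continuous: "f \<in> dual scl \<Longrightarrow> continuous_map (weak_topology scl) euclidean f"
  unfolding continuous_map_def topspace_weak
proof (intro conjI allI impI)
  assume f: "f \<in> dual scl"
  fix U :: "'k set" assume "openin euclidean U"
  hence "openin (weak_topology scl) (f -` U)" using openin_weak_vimage[OF f] by simp
  thus "openin (weak_topology scl) {x \<in> UNIV. f x \<in> U}" by (simp add: vimage_def)
qed simp

lemma continuous_map_weakI:
  assumes "\<And>f. f \<in> dual scl \<Longrightarrow> continuous_map X euclidean (\<lambda>x. f (g x))"
  shows "continuous_map X (weak_topology scl) g"
  unfolding weak_topology_def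
proof (rule continuous_on_generated_topo)
  fix U assume "U \<in> {f -` U | f U. f \<in> dual scl \<and> open U}"
  then obtain f V where fV: "U = f -` V" "f \<in> dual scl" "open V" by blast
  have "openin X {x \<in> topspace X. f (g x) \<in> V}"
    using openin_continuous_map_preimage[OF assms[OF fV(2)], of V] fV(3) by simp
  moreover have "g -` U \<inter> topspace X = {x \<in> topspace X. f (g x) \<in> V}" using fV(1) by auto
  ultimately show "openin X (g -` U \<inter> topspace X)" by simp
next
  show "g ` topspace X \<subseteq> \<Union> {f -` U | f U. f \<in> dual scl \<and> open U}"
    unfolding topspace_weak[unfolded weak_topology_def topology_generated_by_topspace] by simp
qed

lemma dual_separates:
  assumes "\<And>f. f \<in> dual scl \<Longrightarrow> f z = 0"
  shows "z = 0"
proof (rule ccontr)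
  assume "z \<noteq> 0"
  hence "0 < norm z / 2" by simp
  then obtain \<phi> where "\<phi> \<in> dual scl" "norm z - norm z / 2 \<le> norm (\<phi> z)"
    using norming_functional[of "norm z / 2" z] by blast
  moreover from this have "\<phi> z = 0" using assms by blast
  ultimately show False using \<open>0 < norm z / 2\<close> by simp
qed

lemma Hausdorff_weak: "Hausdorff_space (weak_topology scl)"
  unfolding Hausdorff_space_def
proof (intro allI impI, elim conjE)
  fix x y :: 'e assume "x \<noteq> y"
  then obtain f where f: "f \<in> dual scl" "f (x - y) \<noteq> 0" using dual_separates[of "x - y"] by auto
  interpret f: bounded_linear f by (rule dualD(1)[OF f(1)])
  have "f x \<noteq> f y" using f(2) by (simp add: f.diff)
  then obtain U V where UV: "open U" "open V" "f x \<in> U" "f y \<in> V" "U \<inter> V = {}"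
    using hausdorff[OF \<open>f x \<noteq> f y\<close>] by blast
  have "openin (weak_topology scl) (f -` U)" "openin (weak_topology scl) (f -` V)"
    using openin_weak_vimage[OF f(1)] UV(1,2) by auto
  thus "\<exists>U V. openin (weak_topology scl) U \<and> openin (weak_topology scl) V \<and> x \<in> U \<and> y \<in> V \<and> disjnt U V"
    using UV(3-5) by (intro exI[of _ "f -` U"] exI[of _ "f -` V"] conjI) (auto simp: disjnt_def)
qed

section \<open>Order intervals are weakly compact\<close>

lemma closed_order_interval: "closed {z. m z \<le> u}"
proof -
  have "l \<in> {z. m z \<le> u}" if x: "\<forall>n. x n \<in> {z. m z \<le> u}" "x \<longlonglongrightarrow> l" for x l
  proof -
    have "norm (pos_part (m l - u)) \<le> norm (l - x n)" for n
    proof -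
      have "m l \<le> m (l - x n) + m (x n)" using m_add[of "l - x n" "x n"] by simp
      also have "\<dots> \<le> m (l - x n) + u" using x(1) by simp
      finally have "m l - u \<le> m (l - x n)" by (simp add: diff_le_eq)
      hence "pos_part (m l - u) \<le> m (l - x n)" by (rule pos_part_least[OF _ m_nonneg])
      thus ?thesis using norm_mono_nonneg[OF pos_part_nonneg] norm_m by metis
    qed
    moreover have "(\<lambda>n. norm (l - x n)) \<longlonglongrightarrow> norm (l - l)" by (intro tendsto_intros x(2))
    ultimately have "norm (pos_part (m l - u)) \<le> 0"
      by (intro LIMSEQ_le_const[of "\<lambda>n. norm (l - x n)"]) auto
    hence "m l - u \<le> 0" using pos_part_ge[of "m l - u"] by simp
    thus ?thesis by simp
  qed
  thus ?thesis unfolding closed_sequential_limits by blast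
qed

lemma m_scaleR_le: "m (r *\<^sub>R z) \<le> \<bar>r\<bar> *\<^sub>R m z"
  using m_scl[of "of_real r" z] by (simp add: scl_of_real)

lemma midpoint_order_interval:
  assumes "m z \<le> u" "m w \<le> u"
  shows "m ((1/2) *\<^sub>R (z + w)) \<le> u"
proof -
  have "m ((1/2) *\<^sub>R (z + w)) \<le> \<bar>1/2\<bar> *\<^sub>R m (z + w)" by (rule m_scaleR_le)
  also have "\<dots> \<le> \<bar>1/2\<bar> *\<^sub>R (u + u)"
    using order.trans[OF m_add add_mono[OF assms]] by (intro scaleR_left_mono) auto
  also have "\<dots> = u" by (simp add: scaleR_2[symmetric])
  finally show ?thesis .
qed

text \<open>Real and imaginary part each contribute their energy to the uniformly convex function.\<close>

lemma order_interval_fip: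
  assumes \<C>: "\<And>C. C \<in> \<C> \<Longrightarrow> closed C"
      "\<And>C z w. C \<in> \<C> \<Longrightarrow> z \<in> C \<Longrightarrow> w \<in> C \<Longrightarrow> (1/2) *\<^sub>R (z + w) \<in> C"
    and fip: "\<And>F. finite F \<Longrightarrow> F \<subseteq> \<C> \<Longrightarrow> {z. m z \<le> u} \<inter> \<Inter>F \<noteq> {}"
  shows "{z. m z \<le> u} \<inter> \<Inter>\<C> \<noteq> {}"
proof (rule uniformly_convex_fip[where V = "\<lambda>z. sup_energy u (re z) + sup_energy u (im z)"
      and M = "2 * norm u" and \<kappa> = "1 / (8 * (norm u + 1))"])
  have pos: "0 < norm u + 1" using norm_ge_zero[of u] by linarith
  thus "0 < 1 / (8 * (norm u + 1))" by simp
  have re: "\<bar>re z\<bar> \<le> u" and im: "\<bar>im z\<bar> \<le> u" if "z \<in> {z. m z \<le> u}" for z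
    using that abs_re abs_im by (auto intro: order.trans)
  fix z assume z: "z \<in> {z. m z \<le> u}"
  show "0 \<le> sup_energy u (re z) + sup_energy u (im z)"
    using sup_energy_nonneg[OF re[OF z]] sup_energy_nonneg[OF im[OF z]] by simp
  show "sup_energy u (re z) + sup_energy u (im z) \<le> 2 * norm u"
    using sup_energy_le[OF re[OF z]] sup_energy_le[OF im[OF z]] by simp
  fix w assume w: "w \<in> {z. m z \<le> u}"
  have lin: "re ((1/2) *\<^sub>R (z + w)) = (1/2) *\<^sub>R (re z + re w)" "re (z - w) = re z - re w"
    "im ((1/2) *\<^sub>R (z + w)) = (1/2) *\<^sub>R (im z + im w)" "im (z - w) = im z - im w"
    using re_linear im_linear by (simp_all add: linear_add linear_diff linear_scale)
  let ?a = "norm (re z - re w)" and ?b = "norm (im z - im w)"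
  have "(norm (z - w))\<^sup>2 \<le> (?a + ?b)\<^sup>2"
    using norm_le_re_im[of "z - w"] by (intro power_mono) (auto simp: lin)
  also have "\<dots> \<le> 2 * ?a\<^sup>2 + 2 * ?b\<^sup>2" using sum_squares_ge_zero[of "?a - ?b" 0]
    by (simp add: power2_eq_square algebra_simps)
  finally have "(norm (z - w))\<^sup>2 / (8 * (norm u + 1)) \<le> (2 * ?a\<^sup>2 + 2 * ?b\<^sup>2) / (8 * (norm u + 1))"
    using pos by (intro divide_right_mono) auto
  also have "\<dots> = ?a\<^sup>2 / (4 * (norm u + 1)) + ?b\<^sup>2 / (4 * (norm u + 1))"
  proof -
    have "(2 * a + 2 * b) / (8 * p) = a / (4 * p) + b / (4 * p)" for a b p :: real
      by (cases "p = 0") (simp_all add: field_simps)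
    thus ?thesis .
  qed
  finally show "sup_energy u (re ((1/2) *\<^sub>R (z + w))) + sup_energy u (im ((1/2) *\<^sub>R (z + w)))
      + 1 / (8 * (norm u + 1)) * (norm (z - w))\<^sup>2
    \<le> (sup_energy u (re z) + sup_energy u (im z) + (sup_energy u (re w) + sup_energy u (im w))) / 2"
    using sup_energy_midpoint[OF re[OF z] re[OF w]] sup_energy_midpoint[OF im[OF z] im[OF w]]
    unfolding lin times_divide_eq_left mult_1 by argo
next
  show "closed {z. m z \<le> u}" by (rule closed_order_interval)
  show "(1/2) *\<^sub>R (z + w) \<in> {z. m z \<le> u}" if "z \<in> {z. m z \<le> u}" "w \<in> {z. m z \<le> u}" for z w
    using midpoint_order_interval that by simp
next
  show "closed C" if "C \<in> \<C>" for C using \<C>(1)[OF that] .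
  show "(1/2) *\<^sub>R (z + w) \<in> C" if "C \<in> \<C>" "z \<in> C" "w \<in> C" for C z w using \<C>(2)[OF that] .
  show "{z. m z \<le> u} \<inter> \<Inter>F \<noteq> {}" if "finite F" "F \<subseteq> \<C>" for F using fip[OF that] .
qed

text \<open>By Alexander's subbase theorem it suffices to treat covers by open half-spaces. Their complements
  are closed and convex, so the finite intersection property above applies.\<close>

lemma weakly_compact_order_interval: "compactin (weak_topology scl) {z. m z \<le> u}"
proof -
  let ?K = "{z. m z \<le> u}"
  define B where "B = {{z. g \<cdot> z < a} | (g :: 'e \<Rightarrow>\<^sub>L real) a. True}"
  define X where "X = topology (arbitrary union_of (finite intersection_of (\<lambda>x. x \<in> B) relative_to ?K))"
  have top: "topspace X = ?K" unfolding X_def by (rule topspace_subbase)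
  have "compact_space X"
  proof (rule Alexander_subbase_alt[OF _ _ X_def[symmetric]])
    have "{z. (0 :: 'e \<Rightarrow>\<^sub>L real) \<cdot> z < 1} \<in> B" unfolding B_def by blast
    thus "?K \<subseteq> \<Union>B" by auto
    fix C assume C: "C \<subseteq> B" "?K \<subseteq> \<Union>C"
    show "\<exists>C'. finite C' \<and> C' \<subseteq> C \<and> ?K \<subseteq> \<Union>C'"
    proof (rule ccontr)
      assume no: "\<not> ?thesis"
      have "?K \<inter> \<Inter>(uminus ` C) \<noteq> {}"
      proof (rule order_interval_fip)
        fix D assume "D \<in> uminus ` C"
        then obtain b where b: "b \<in> B" "D = - b" using C(1) by blast
        then obtain g :: "'e \<Rightarrow>\<^sub>L real" and a where "b = {z. g \<cdot> z < a}"
          unfolding B_def by blast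
        with b have D: "D = {z. a \<le> g \<cdot> z}" by auto
        show "closed D" unfolding D
          by (intro closed_Collect_le continuous_on_const blinfun.continuous_on continuous_on_id)
        show "(1/2) *\<^sub>R (z + w) \<in> D" if "z \<in> D" "w \<in> D" for z w
          using that by (simp add: D blinfun.scaleR_right blinfun.add_right)
      next
        fix F assume F: "finite F" "F \<subseteq> uminus ` C"
        have "finite (uminus ` F)" "uminus ` F \<subseteq> C" using F by auto
        hence "\<not> ?K \<subseteq> \<Union>(uminus ` F)" using no by blast
        thus "?K \<inter> \<Inter>F \<noteq> {}" by auto
      qed
      thus False using C(2) by auto
    qed
  qed
  have sub: "openin X (?K \<inter> b)" if "b \<in> B" for b
  proof -
    have "(finite intersection_of (\<lambda>x. x \<in> B)) b"
      using that by (simp add: finite_intersection_of_inc)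
    hence "(finite intersection_of (\<lambda>x. x \<in> B) relative_to ?K) (?K \<inter> b)"
      by (rule relative_to_inc)
    hence "(arbitrary union_of (finite intersection_of (\<lambda>x. x \<in> B) relative_to ?K)) (?K \<inter> b)"
      by (rule arbitrary_union_of_inc)
    thus ?thesis unfolding X_def openin_subbase .
  qed
  have cont_real: "continuous_map X euclideanreal (blinfun_apply g)" for g :: "'e \<Rightarrow>\<^sub>L real"
    unfolding continuous_map_upper_lower_semicontinuous_lt
  proof (intro conjI allI)
    fix a
    have "?K \<inter> {z. g \<cdot> z < a} = {x \<in> topspace X. g \<cdot> x < a}" by (auto simp: top)
    moreover have "{z. g \<cdot> z < a} \<in> B" by (auto simp: B_def)
    ultimately show "openin X {x \<in> topspace X. g \<cdot> x < a}" using sub by metis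
    have "?K \<inter> {z. (- g) \<cdot> z < - a} = {x \<in> topspace X. a < g \<cdot> x}"
      by (auto simp: top blinfun.minus_left)
    moreover have "{z. (- g) \<cdot> z < - a} \<in> B" unfolding B_def by blast
    ultimately show "openin X {x \<in> topspace X. a < g \<cdot> x}" using sub by metis
  qed
  \<comment> \<open>The half-spaces generate a topology finer than the weak one, since coordinates of functionals are real functionals.\<close>
  have "continuous_map X (weak_topology scl) (\<lambda>x. x)"
  proof (rule continuous_map_weakI)
    fix f assume f: "f \<in> dual scl"
    have "continuous_map X euclidean (\<lambda>x. (f x \<bullet> b) *\<^sub>R b)" for b :: 'k
    proof -
      have "bounded_linear (\<lambda>x. f x \<bullet> b)"
        by (rule bounded_linear_compose[OF bounded_linear_inner_left dualD(1)[OF f]])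
      hence "continuous_map X euclideanreal (\<lambda>x. f x \<bullet> b)"
        using cont_real[of "Blinfun (\<lambda>x. f x \<bullet> b)"] by (simp add: bounded_linear_Blinfun_apply)
      moreover have "continuous_map euclideanreal euclidean (\<lambda>r. r *\<^sub>R b)"
        by (simp add: continuous_intros)
      ultimately show ?thesis using continuous_map_compose[of X euclideanreal "\<lambda>x. f x \<bullet> b" euclidean "\<lambda>r. r *\<^sub>R b"]
        by (simp add: o_def)
    qed
    hence "continuous_map X euclidean (\<lambda>x. \<Sum>b\<in>Basis. (f x \<bullet> b) *\<^sub>R b)"
      by (intro continuous_map_sum) auto
    thus "continuous_map X euclidean (\<lambda>x. f x)" by (simp add: euclidean_representation)
  qed
  from image_compactin[OF _ this, of ?K] show ?thesis
    using \<open>compact_space X\<close> by (simp add: compact_space_def top)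
qed

section \<open>Approximation by weakly compact operators\<close>

lemma m_sum_scaleR_le:
  "(\<And>q. q \<in> set qs \<Longrightarrow> m (w q) \<le> u) \<Longrightarrow> m (\<Sum>q\<leftarrow>qs. a q *\<^sub>R w q) \<le> (\<Sum>q\<leftarrow>qs. \<bar>a q\<bar>) *\<^sub>R u"
proof (induction qs)
  case (Cons q qs)
  have "m (a q *\<^sub>R w q) \<le> \<bar>a q\<bar> *\<^sub>R u"
    using order.trans[OF m_scaleR_le scaleR_left_mono[of "m (w q)" u "\<bar>a q\<bar>"]] Cons.prems by simp
  moreover have "m (\<Sum>q\<leftarrow>qs. a q *\<^sub>R w q) \<le> (\<Sum>q\<leftarrow>qs. \<bar>a q\<bar>) *\<^sub>R u" using Cons by simp
  ultimately have "m (a q *\<^sub>R w q) + m (\<Sum>q\<leftarrow>qs. a q *\<^sub>R w q) \<le> \<bar>a q\<bar> *\<^sub>R u + (\<Sum>q\<leftarrow>qs. \<bar>a q\<bar>) *\<^sub>R u"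
    by (rule add_mono)
  thus ?case using order.trans[OF m_add] by (simp add: scaleR_left_distrib)
qed (simp add: m_zero)

lemma sum_abs_total_resolution_le:
  fixes x :: 'a
  assumes "resolution Qs"
  shows "(\<Sum>Q\<leftarrow>Qs. \<bar>total \<cdot> (Q \<cdot> x)\<bar>) \<le> norm x"
proof -
  have "(\<Sum>Q\<leftarrow>Qs. \<bar>total \<cdot> (Q \<cdot> x)\<bar>) \<le> (\<Sum>Q\<leftarrow>Qs. norm (Q \<cdot> \<bar>x\<bar>))"
    by (rule sum_list_mono) (metis abs_total_le resolution_abs[OF assms] norm_abs_eq)
  also have "\<dots> = norm x" by (simp add: resolution_sum_norm[OF assms])
  finally show ?thesis .
qed

text \<open>On each piece of a fine resolution, every \<open>f\<close> in \<open>F\<close> is nearly a multiple of \<open>s\<close>, so replacing \<open>T\<close> on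
  this piece by one truncated value at the normalised piece of \<open>s\<close> changes \<open>T f\<close> little more than the
  truncation does. Weighting the truncated values with \<open>total (Q x)\<close> makes the result linear in \<open>x\<close>, and
  the bound by \<open>\<parallel>x\<parallel> u\<close> is additivity of the norm.\<close>

lemma finite_truncation:
  fixes T :: "'a \<Rightarrow>\<^sub>L 'e"
  assumes u: "0 \<le> u" and c: "\<And>f. 0 \<le> f \<Longrightarrow> norm f \<le> 1 \<Longrightarrow> norm (pos_part (m (T \<cdot> f) - u)) \<le> c"
    and F: "finite F" and \<eta>: "0 < \<eta>"
  shows "\<exists>W. Real_Vector_Spaces.linear W \<and> (\<forall>x. m (W x) \<le> norm x *\<^sub>R u) \<and>
    (\<forall>f\<in>F. norm (T \<cdot> f - W f) \<le> (c + \<eta>) * norm f + \<eta>)"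
proof -
  define s where "s = (\<Sum>f\<in>F. \<bar>f\<bar>)"
  have s: "0 \<le> s" unfolding s_def by (rule sum_nonneg) simp
  have Fs: "\<bar>f\<bar> \<le> s" if "f \<in> F" for f
    unfolding s_def sum.remove[OF F that] by (simp add: sum_nonneg)
  define \<delta> where "\<delta> = \<eta> / (2 * norm T * norm s + 1)"
  have den: "0 < 2 * norm T * norm s + 1"
    by (rule add_nonneg_pos) auto
  have \<delta>: "0 < \<delta>" unfolding \<delta>_def using \<eta> den by (rule divide_pos_pos)
  have "2 * norm T * norm s * \<delta> \<le> (2 * norm T * norm s + 1) * \<delta>"
    using \<delta> by (intro mult_right_mono) auto
  also have "\<dots> = \<eta>" using den by (simp add: \<delta>_def)
  finally have \<delta>_small: "2 * norm T * norm s * \<delta> \<le> \<eta>" .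
  obtain Qs where Qs: "resolution Qs" and Qs_approx: "\<And>Q f. Q \<in> set Qs \<Longrightarrow> f \<in> F \<Longrightarrow>
      \<exists>t. \<bar>Q \<cdot> f - t *\<^sub>R Q \<cdot> s\<bar> \<le> \<delta> *\<^sub>R Q \<cdot> s"
    using simultaneous_approximation[OF F Fs \<delta>] by metis
  define g where "g Q = inverse (norm (Q \<cdot> s)) *\<^sub>R Q \<cdot> s" for Q :: "'a \<Rightarrow>\<^sub>L 'a"
  have Qpos: "0 \<le> Q \<cdot> s" if "Q \<in> set Qs" for Q
    using Qs s that by (simp add: resolution_def positive_op_def)
  have g: "0 \<le> g Q" "norm (g Q) \<le> 1" "norm (Q \<cdot> s) *\<^sub>R g Q = Q \<cdot> s" if "Q \<in> set Qs" for Q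
    using Qpos[OF that] by (cases "Q \<cdot> s = 0"; auto simp: g_def scaleR_nonneg_nonneg)+
  have "\<forall>Q\<in>set Qs. \<exists>w. m w \<le> u \<and> norm (T \<cdot> g Q - w) \<le> c + \<eta>"
    using truncation[OF u _ \<eta>] c g by blast
  then obtain w where w: "\<And>Q. Q \<in> set Qs \<Longrightarrow> m (w Q) \<le> u"
      "\<And>Q. Q \<in> set Qs \<Longrightarrow> norm (T \<cdot> g Q - w Q) \<le> c + \<eta>" by metis
  define W where "W x = (\<Sum>Q\<leftarrow>Qs. total \<cdot> (Q \<cdot> x) *\<^sub>R w Q)" for x
  have "Real_Vector_Spaces.linear W"
  proof (rule linearI)
    fix x y :: 'a and r :: real
    show "W (x + y) = W x + W y"
      by (simp add: W_def blinfun.add_right scaleR_left_distrib sum_list_addf)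
    show "W (r *\<^sub>R x) = r *\<^sub>R W x"
      unfolding W_def by (induction Qs) (simp_all add: blinfun.scaleR_right scaleR_right_distrib)
  qed
  moreover have "m (W x) \<le> norm x *\<^sub>R u" for x
    unfolding W_def
    by (rule order.trans[OF m_sum_scaleR_le[OF w(1)] scaleR_right_mono[OF sum_abs_total_resolution_le[OF Qs] u]])
  moreover have "norm (T \<cdot> f - W f) \<le> (c + \<eta>) * norm f + \<eta>" if f: "f \<in> F" for f
  proof -
    have "0 \<le> c" by (rule order.trans[OF norm_ge_zero c[of 0]]) simp_all
    hence c\<eta>: "0 \<le> c + \<eta>" using \<eta> by simp
    let ?a = "\<lambda>Q. total \<cdot> (Q \<cdot> f)"
    have step: "norm (T \<cdot> (Q \<cdot> f) - ?a Q *\<^sub>R w Q)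
        \<le> (2 * norm T * \<delta>) * norm (Q \<cdot> s) + (c + \<eta>) * \<bar>?a Q\<bar>" if Q: "Q \<in> set Qs" for Q
    proof -
      obtain t where t: "\<bar>Q \<cdot> f - t *\<^sub>R Q \<cdot> s\<bar> \<le> \<delta> *\<^sub>R Q \<cdot> s"
        using Qs_approx[OF Q f] by blast
      let ?p = "norm (Q \<cdot> s)"
      have "norm \<bar>Q \<cdot> f - t *\<^sub>R Q \<cdot> s\<bar> \<le> norm (\<delta> *\<^sub>R Q \<cdot> s)"
        by (rule norm_mono_nonneg[OF abs_ge_zero t])
      hence d: "norm (Q \<cdot> f - t *\<^sub>R Q \<cdot> s) \<le> \<delta> * ?p" using \<delta> by simp
      have "?a Q - t * ?p = total \<cdot> (Q \<cdot> f - t *\<^sub>R Q \<cdot> s)"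
        using total_nonneg_eq[OF Qpos[OF Q]] by (simp add: blinfun.diff_right blinfun.scaleR_right)
      hence e: "\<bar>t * ?p - ?a Q\<bar> \<le> \<delta> * ?p"
        using abs_total_le[of "Q \<cdot> f - t *\<^sub>R Q \<cdot> s"] d by (simp add: abs_minus_commute)
      have "T \<cdot> (Q \<cdot> s) = ?p *\<^sub>R T \<cdot> g Q"
        using g(3)[OF Q] by (metis blinfun.scaleR_right)
      hence eq: "T \<cdot> (Q \<cdot> f) - ?a Q *\<^sub>R w Q
        = T \<cdot> (Q \<cdot> f - t *\<^sub>R Q \<cdot> s) + (t * ?p - ?a Q) *\<^sub>R T \<cdot> g Q
          + ?a Q *\<^sub>R (T \<cdot> g Q - w Q)"
        by (simp add: blinfun.diff_right blinfun.scaleR_right algebra_simps)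
      have tri: "norm (x + y + z) \<le> norm x + norm y + norm z" for x y z :: 'e
        using norm_triangle_ineq[of "x + y" z] norm_triangle_ineq[of x y] by linarith
      have "norm (T \<cdot> (Q \<cdot> f) - ?a Q *\<^sub>R w Q)
        \<le> norm (T \<cdot> (Q \<cdot> f - t *\<^sub>R Q \<cdot> s))
          + norm ((t * ?p - ?a Q) *\<^sub>R T \<cdot> g Q) + norm (?a Q *\<^sub>R (T \<cdot> g Q - w Q))"
        unfolding eq by (rule tri)
      moreover have "norm (T \<cdot> (Q \<cdot> f - t *\<^sub>R Q \<cdot> s)) \<le> norm T * (\<delta> * ?p)"
        by (rule order.trans[OF norm_blinfun mult_left_mono[OF d]]) simp
      moreover have "norm ((t * ?p - ?a Q) *\<^sub>R T \<cdot> g Q) \<le> (\<delta> * ?p) * norm T"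
      proof -
        have "norm (T \<cdot> g Q) \<le> norm T * 1"
          by (rule order.trans[OF norm_blinfun mult_left_mono[OF g(2)[OF Q]]]) simp
        thus ?thesis using mult_mono[OF e, of "norm (T \<cdot> g Q)" "norm T"] \<delta> by simp
      qed
      moreover have "norm (?a Q *\<^sub>R (T \<cdot> g Q - w Q)) \<le> \<bar>?a Q\<bar> * (c + \<eta>)"
        using mult_left_mono[OF w(2)[OF Q] abs_ge_zero] by simp
      ultimately show ?thesis by (simp add: algebra_simps)
    qed
    have "T \<cdot> f = (\<Sum>Q\<leftarrow>Qs. T \<cdot> (Q \<cdot> f))"
      using resolution_sum[OF Qs, of f] by (metis blinfun_sum_list_right)
    hence "T \<cdot> f - W f = (\<Sum>Q\<leftarrow>Qs. T \<cdot> (Q \<cdot> f) - ?a Q *\<^sub>R w Q)"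
      by (simp add: W_def sum_list_subtractf)
    hence "norm (T \<cdot> f - W f) \<le> (\<Sum>Q\<leftarrow>Qs. norm (T \<cdot> (Q \<cdot> f) - ?a Q *\<^sub>R w Q))"
      by (simp add: norm_sum_list_le)
    also have "\<dots> \<le> (\<Sum>Q\<leftarrow>Qs. (2 * norm T * \<delta>) * norm (Q \<cdot> s) + (c + \<eta>) * \<bar>?a Q\<bar>)"
      by (rule sum_list_mono[OF step])
    also have "\<dots> = (2 * norm T * \<delta>) * norm s + (c + \<eta>) * (\<Sum>Q\<leftarrow>Qs. \<bar>?a Q\<bar>)"
      by (simp add: sum_list_addf sum_list_const_mult resolution_sum_norm[OF Qs s])
    also have "\<dots> \<le> \<eta> + (c + \<eta>) * norm f"
      using \<delta>_small by (intro add_mono mult_left_mono sum_abs_total_resolution_le[OF Qs] c\<eta>) (simp add: mult_ac)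
    finally show ?thesis by simp
  qed
  ultimately show ?thesis by blast
qed

text \<open>The maps \<open>W\<close> with \<open>|W x| \<le> \<parallel>x\<parallel> u\<close> form a product of weakly compact order intervals. Linearity and
  closeness to \<open>T\<close> at a given point are closed conditions, once expressed by functionals, and any
  finitely many of them can be met by the preceding lemma.\<close>

lemma truncated_operator:
  fixes T :: "'a \<Rightarrow>\<^sub>L 'e"
  assumes u: "0 \<le> u" and c: "\<And>f. 0 \<le> f \<Longrightarrow> norm f \<le> 1 \<Longrightarrow> norm (pos_part (m (T \<cdot> f) - u)) \<le> c"
  shows "\<exists>W :: 'a \<Rightarrow>\<^sub>L 'e. (\<forall>x. m (W \<cdot> x) \<le> norm x *\<^sub>R u) \<and>
    (\<forall>x. norm (T \<cdot> x - W \<cdot> x) \<le> c * norm x)"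
proof -
  let ?X = "product_topology (\<lambda>_. weak_topology scl) (UNIV :: 'a set)"
  have topX: "topspace ?X = UNIV" by (simp add: topspace_product_topology topspace_weak)
  define P where "P = (\<Pi>\<^sub>E x\<in>(UNIV :: 'a set). {z. m z \<le> norm x *\<^sub>R u})"
  have P: "compactin ?X P"
    unfolding P_def compactin_PiE using weakly_compact_order_interval by blast
  have cont: "continuous_map ?X euclidean (\<lambda>W. \<phi> (W x))" if "\<phi> \<in> dual scl" for \<phi> x
    using continuous_map_compose[OF continuous_map_product_projection[of x UNIV "\<lambda>_. weak_topology scl"] weak_continuous[OF that]]
    by (simp add: o_def)
  have diff: "\<phi> (a - b) = \<phi> a - \<phi> b" "\<phi> (r *\<^sub>R a) = of_real r * \<phi> a" if "\<phi> \<in> dual scl" for \<phi> a b r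
    using bounded_linear.linear[OF dualD(1)[OF that]] by (simp_all add: linear_diff linear_scale scaleR_conv_of_real)
  define Lin where "Lin = {W :: 'a \<Rightarrow> 'e. Real_Vector_Spaces.linear W}"
  have "closedin ?X Lin"
  proof -
    define AA where "AA = {{W :: 'a \<Rightarrow> 'e. \<phi> (W (x + y)) - \<phi> (W x) - \<phi> (W y) = 0} | \<phi> x y. \<phi> \<in> dual scl}"
    define HH where "HH = {{W :: 'a \<Rightarrow> 'e. \<phi> (W (r *\<^sub>R x)) - of_real r * \<phi> (W x) = 0} | \<phi> (r::real) x. \<phi> \<in> dual scl}"
    have "closedin ?X S" if "S \<in> AA \<union> HH" for S
    proof -
      have cl: "closedin ?X {W. h W = 0}" if "continuous_map ?X euclidean h" for h :: "('a \<Rightarrow> 'e) \<Rightarrow> 'k"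
        using closedin_continuous_map_preimage[OF that, of "{0}", unfolded topX] by simp
      have "continuous_map ?X euclidean (\<lambda>W. \<phi> (W (x + y)) - \<phi> (W x) - \<phi> (W y))" if "\<phi> \<in> dual scl" for \<phi> x y
        by (intro continuous_map_diff cont that)
      moreover have "continuous_map ?X euclidean (\<lambda>W. \<phi> (W (r *\<^sub>R x)) - of_real r * \<phi> (W x))" if "\<phi> \<in> dual scl" for \<phi> x and r :: real
      proof (rule continuous_map_diff[OF cont[OF that]])
        have "(\<lambda>z. of_real r * \<phi> z) \<in> dual scl"
          using dualD[OF that] by (intro dualI bounded_linear_compose[OF bounded_linear_mult_right]) auto
        thus "continuous_map ?X euclidean (\<lambda>W. of_real r * \<phi> (W x))" by (rule cont)
      qed
      ultimately show ?thesis using that cl unfolding AA_def HH_def by blast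
    qed
    moreover have "AA \<noteq> {}" using flift_dual by (auto simp: AA_def)
    ultimately have "closedin ?X (\<Inter>(AA \<union> HH))" by (intro closedin_Inter) auto
    also have "\<Inter>(AA \<union> HH) = Lin"
    proof (intro equalityI subsetI)
      fix W assume W: "W \<in> \<Inter>(AA \<union> HH)"
      have 1: "\<phi> (W (x + y)) - \<phi> (W x) - \<phi> (W y) = 0" if "\<phi> \<in> dual scl" for \<phi> x y
      proof -
        have "{W. \<phi> (W (x + y)) - \<phi> (W x) - \<phi> (W y) = 0} \<in> AA \<union> HH" using that by (auto simp: AA_def)
        with W have "W \<in> {W. \<phi> (W (x + y)) - \<phi> (W x) - \<phi> (W y) = 0}" by (rule InterD)
        thus ?thesis by simp
      qed
      have 2: "\<phi> (W (r *\<^sub>R x)) - of_real r * \<phi> (W x) = 0" if "\<phi> \<in> dual scl" for \<phi> x and r :: real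
      proof -
        have "{W. \<phi> (W (r *\<^sub>R x)) - of_real r * \<phi> (W x) = 0} \<in> AA \<union> HH" using that by (auto simp: HH_def)
        with W have "W \<in> {W. \<phi> (W (r *\<^sub>R x)) - of_real r * \<phi> (W x) = 0}" by (rule InterD)
        thus ?thesis by simp
      qed
      have "Real_Vector_Spaces.linear W"
      proof (rule linearI)
        fix x y and r :: real
        have "W (x + y) - W x - W y = 0" by (rule dual_separates) (use 1 in \<open>simp add: diff\<close>)
        thus "W (x + y) = W x + W y" by (simp add: algebra_simps)
        have "W (r *\<^sub>R x) - r *\<^sub>R W x = 0" by (rule dual_separates) (use 2 in \<open>simp add: diff\<close>)
        thus "W (r *\<^sub>R x) = r *\<^sub>R W x" by simp
      qed
      thus "W \<in> Lin" by (simp add: Lin_def)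
    next
      fix W assume "W \<in> Lin"
      hence W: "Real_Vector_Spaces.linear W" by (simp add: Lin_def)
      have "\<phi> (a + b) = \<phi> a + \<phi> b" if "\<phi> \<in> dual scl" for \<phi> a b
        using bounded_linear.linear[OF dualD(1)[OF that]] by (simp add: linear_add)
      thus "W \<in> \<Inter>(AA \<union> HH)"
        using diff by (auto simp: AA_def HH_def linear_add[OF W] linear_scale[OF W])
    qed
    finally show ?thesis .
  qed
  hence K: "compactin ?X (Lin \<inter> P)" using P by (rule closed_Int_compactin)
  define I where "I = {(x :: 'a, \<phi> :: 'e \<Rightarrow> 'k, \<eta> :: real). \<phi> \<in> dual scl \<and> (\<forall>g. norm (\<phi> g) \<le> norm g) \<and> 0 < \<eta>}"
  define D where "D = (\<lambda>(x :: 'a, \<phi> :: 'e \<Rightarrow> 'k, \<eta> :: real). {W. norm (\<phi> (W x) - \<phi> (T \<cdot> x)) \<le> (c + \<eta>) * norm x + \<eta>})"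
  have closed_D: "closedin ?X (D i)" if "i \<in> I" for i
  proof -
    obtain x \<phi> \<eta> where i: "i = (x, \<phi>, \<eta>)" by (cases i) auto
    have "\<phi> \<in> dual scl" using that by (simp add: i I_def)
    hence "continuous_map ?X euclideanreal (\<lambda>W. norm (\<phi> (W x) - \<phi> (T \<cdot> x)))"
      by (intro continuous_map_norm continuous_map_diff[OF cont]) simp_all
    from closedin_continuous_map_preimage[OF this, of "{..(c + \<eta>) * norm x + \<eta>}", unfolded topX]
    show ?thesis by (simp add: i D_def)
  qed
  have fip: "Lin \<inter> P \<inter> \<Inter>F \<noteq> {}" if F: "finite F" "F \<subseteq> D ` I" for F
  proof -
    obtain J where J: "finite J" "J \<subseteq> I" "F = D ` J" using finite_subset_image[OF F] by blast
    \<comment> \<open>The element 1 covers the case that J is empty.\<close>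
    define \<eta> where "\<eta> = Min (insert 1 ((\<lambda>(x, \<phi>, \<eta>). \<eta>) ` J))"
    have fin: "finite (insert 1 ((\<lambda>(x, \<phi>, \<eta>). \<eta>) ` J))" using J(1) by simp
    have "0 < \<eta>" unfolding \<eta>_def using J(2) fin by (subst Min_gr_iff) (auto simp: I_def)
    then obtain W where W: "Real_Vector_Spaces.linear W" "\<And>x. m (W x) \<le> norm x *\<^sub>R u"
      "\<And>f. f \<in> fst ` J \<Longrightarrow> norm (T \<cdot> f - W f) \<le> (c + \<eta>) * norm f + \<eta>"
      using finite_truncation[OF u c, of "fst ` J" \<eta>] J(1) by blast
    have "W \<in> D i" if i: "i \<in> J" for i
    proof -
      obtain x \<phi> \<eta>' where xi: "i = (x, \<phi>, \<eta>')" by (cases i) auto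
      have \<phi>: "\<phi> \<in> dual scl" "\<And>g. norm (\<phi> g) \<le> norm g" using J(2) i by (auto simp: xi I_def)
      have le: "\<eta> \<le> \<eta>'" unfolding \<eta>_def by (rule Min_le[OF fin]) (use i in \<open>force simp: xi\<close>)
      have "x \<in> fst ` J" using i by (force simp: xi)
      have "norm (\<phi> (W x) - \<phi> (T \<cdot> x)) \<le> norm (W x - T \<cdot> x)"
        using \<phi>(2)[of "W x - T \<cdot> x"] diff(1)[OF \<phi>(1)] by simp
      also have "\<dots> \<le> (c + \<eta>) * norm x + \<eta>" using W(3)[OF \<open>x \<in> fst ` J\<close>] by (simp add: norm_minus_commute)
      also have "\<dots> \<le> (c + \<eta>') * norm x + \<eta>'" using le by (intro add_mono mult_right_mono) auto
      finally show ?thesis by (simp add: xi D_def)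
    qed
    moreover have "W \<in> Lin \<inter> P" using W(1,2) by (simp add: Lin_def P_def PiE_iff)
    ultimately have "W \<in> Lin \<inter> P \<inter> \<Inter>F" unfolding J(3) by blast
    thus ?thesis by blast
  qed
  have "Lin \<inter> P \<inter> \<Inter>(D ` I) \<noteq> {}"
  proof (rule K[unfolded compactin_fip, THEN conjunct2, THEN spec, THEN mp], intro conjI ballI allI impI)
    fix C assume "C \<in> D ` I"
    thus "closedin ?X C" using closed_D by blast
  next
    fix F assume "finite F \<and> F \<subseteq> D ` I"
    thus "Lin \<inter> P \<inter> \<Inter>F \<noteq> {}" using fip by simp
  qed
  then obtain W where W: "W \<in> Lin" "W \<in> P" "\<And>i. i \<in> I \<Longrightarrow> W \<in> D i" by blast
  have Wm: "m (W x) \<le> norm x *\<^sub>R u" for x using W(2) by (simp add: P_def PiE_iff)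
  have lin: "Real_Vector_Spaces.linear W" using W(1) by (simp add: Lin_def)
  have "bounded_linear W"
    by (rule bounded_linear_intro[where K = "norm u"])
      (use norm_le_m[OF Wm] in \<open>simp_all add: linear_add[OF lin] linear_scale[OF lin]\<close>)
  hence app: "blinfun_apply (Blinfun W) = W" by (rule bounded_linear_Blinfun_apply)
  have "norm (T \<cdot> x - W x) \<le> c * norm x" for x
  proof (rule field_le_epsilon)
    fix \<epsilon> :: real assume \<epsilon>: "0 < \<epsilon>"
    define \<eta> where "\<eta> = \<epsilon> / (norm x + 2)"
    have den: "0 < norm x + 2" by (rule add_nonneg_pos) auto
    have "\<eta> * (norm x + 2) = \<epsilon>" using den by (simp add: \<eta>_def)
    moreover have "0 < \<eta>" unfolding \<eta>_def using \<epsilon> den by (rule divide_pos_pos)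
    ultimately have \<eta>: "0 < \<eta>" "\<eta> * norm x + \<eta> + \<eta> = \<epsilon>"
      by (simp_all add: algebra_simps)
    obtain \<phi> where \<phi>: "\<phi> \<in> dual scl" "\<forall>g. norm (\<phi> g) \<le> norm g"
      "norm (W x - T \<cdot> x) - \<eta> \<le> norm (\<phi> (W x - T \<cdot> x))"
      using norming_functional[OF \<eta>(1), of "W x - T \<cdot> x"] by blast
    have "(x, \<phi>, \<eta>) \<in> I" using \<phi> \<eta> by (simp add: I_def)
    hence "norm (\<phi> (W x - T \<cdot> x)) \<le> (c + \<eta>) * norm x + \<eta>"
      using W(3) by (force simp: D_def diff(1)[OF \<phi>(1)])
    hence "norm (W x - T \<cdot> x) \<le> c * norm x + (\<eta> * norm x + \<eta> + \<eta>)"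
      using \<phi>(3) by (simp add: algebra_simps)
    thus "norm (T \<cdot> x - W x) \<le> c * norm x + \<epsilon>" unfolding \<eta>(2) by (simp add: norm_minus_commute)
  qed
  with Wm show ?thesis by (intro exI[of _ "Blinfun W"]) (simp add: app)
qed

lemma carrier_operator_algebra: "T \<in> carrier (operator_algebra scl) \<longleftrightarrow> Vector_Spaces.linear scl scl (blinfun_apply T)"
  by (simp add: operator_algebra_def)

lemma lift_order_bounded_weakly_compact:
  assumes W: "\<And>x. m (W \<cdot> x) \<le> norm x *\<^sub>R u" and u: "0 \<le> u"
  shows "lift W \<in> weakly_compact_operators scl"
proof -
  have "blinfun_apply (lift W) ` cball 0 1 \<subseteq> {z. m z \<le> 2 *\<^sub>R u}"
  proof safe
    fix z :: 'e assume "z \<in> cball 0 1"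
    hence z: "norm z \<le> 1" by simp
    have b: "m (W \<cdot> x) \<le> u" if "norm x \<le> 1" for x
      using order.trans[OF W scaleR_right_mono[OF that u]] by simp
    have "m (scl \<i>' (W \<cdot> im z)) \<le> norm \<i>' *\<^sub>R m (W \<cdot> im z)" by (rule m_scl)
    also have "\<dots> \<le> 1 *\<^sub>R m (W \<cdot> im z)" by (rule scaleR_right_mono[OF norm_i m_nonneg])
    also have "\<dots> \<le> u" using b[of "im z"] norm_im[of z] z by simp
    finally have "m (lift W \<cdot> z) \<le> u + u"
      unfolding lift_apply using b[of "re z"] norm_re[of z] z
      by (intro order.trans[OF m_add add_mono]) auto
    thus "m (lift W \<cdot> z) \<le> 2 *\<^sub>R u" by (simp add: scaleR_2)
  qed
  hence "Abstract_Topology.closure_of (weak_topology scl) (blinfun_apply (lift W) ` cball 0 1) \<subseteq> {z. m z \<le> 2 *\<^sub>R u}"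
    by (rule closure_of_minimal) (rule compactin_imp_closedin[OF Hausdorff_weak weakly_compact_order_interval])
  hence "compactin (weak_topology scl) (Abstract_Topology.closure_of (weak_topology scl) (blinfun_apply (lift W) ` cball 0 1))"
    by (rule closed_compactin[OF weakly_compact_order_interval]) simp
  thus ?thesis
    by (simp add: weakly_compact_operators_def carrier_operator_algebra linear_lift)
qed

theorem weakly_compact_approximation:
  assumes T: "T \<in> carrier (operator_algebra scl)" and u: "0 \<le> u"
    and c: "\<And>f. 0 \<le> f \<Longrightarrow> norm f \<le> 1 \<Longrightarrow> norm (pos_part (m (T \<cdot> emb f) - u)) \<le> c"
  shows "\<exists>W\<in>weakly_compact_operators scl. norm (T - W) \<le> c"
proof -
  let ?T = "T o\<^sub>L Blinfun emb"
  have e: "blinfun_apply (Blinfun emb) = emb" by (rule bounded_linear_Blinfun_apply[OF bounded_linear_emb])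
  obtain W :: "'a \<Rightarrow>\<^sub>L 'e" where W: "\<And>x. m (W \<cdot> x) \<le> norm x *\<^sub>R u"
    "\<And>x. norm (?T \<cdot> x - W \<cdot> x) \<le> c * norm x"
    using truncated_operator[OF u, of ?T c] c by (auto simp: e)
  have lin: "Vector_Spaces.linear scl scl (blinfun_apply (T - lift W))"
    using T linear_lift[of W] unfolding carrier_operator_algebra Vector_Spaces.linear_iff
    by (simp add: blinfun.diff_left blinfun.add_right scale_right_diff_distrib)
  have "0 \<le> c" by (rule order.trans[OF norm_ge_zero c[of 0]]) simp_all
  have "norm (T - lift W) \<le> c"
    by (rule norm_blinfun_bound[OF \<open>0 \<le> c\<close> norm_le_on_cone[OF lin]])
      (use W(2) in \<open>simp add: blinfun.diff_left lift_emb e\<close>)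
  thus ?thesis using lift_order_bounded_weakly_compact[OF W(1) u] by blast
qed

end

section \<open>Disjoint sequences and Rosenthal's lemma\<close>

text \<open>Split \<open>M\<close> into infinitely many infinite pieces. If no piece will do, every piece contains an index \<open>b p\<close>
  and a finite set, disjoint from all the indices chosen, that carries more than \<open>\<delta>\<close> of the column of
  \<open>b p\<close>. Restricted to the set of these indices, the columns have lost \<open>\<delta>\<close>, which can happen only
  finitely often.\<close>

lemma rosenthal_step:
  fixes a :: "nat \<Rightarrow> nat \<Rightarrow> real"
  assumes a: "\<And>m n. 0 \<le> a m n" and \<delta>: "0 < \<delta>"
  shows "infinite M \<Longrightarrow> (\<And>n S. n \<in> M \<Longrightarrow> finite S \<Longrightarrow> S \<subseteq> M \<Longrightarrow> (\<Sum>m\<in>S. a m n) \<le> real k * \<delta>) \<Longrightarrow>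
    \<exists>M'\<subseteq>M. infinite M' \<and> (\<forall>n\<in>M'. \<forall>S. finite S \<longrightarrow> S \<subseteq> M' - {n} \<longrightarrow> (\<Sum>m\<in>S. a m n) \<le> \<delta>)"
proof (induction k arbitrary: M)
  case 0
  have "(\<Sum>m\<in>S. a m n) \<le> \<delta>" if "n \<in> M" "finite S" "S \<subseteq> M - {n}" for n S
  proof -
    have "(\<Sum>m\<in>S. a m n) \<le> real 0 * \<delta>" using 0(2)[of n S] that by auto
    thus ?thesis using \<delta> by simp
  qed
  thus ?case using 0(1) by blast
next
  case (Suc k)
  define N where "N p = range (\<lambda>q. enumerate M (prod_encode (p, q)))" for p
  have inj: "inj (enumerate M)" by (rule strict_mono_imp_inj_on[OF strict_mono_enumerate[OF Suc.prems(1)]])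
  have NM: "N p \<subseteq> M" for p unfolding N_def using enumerate_in_set[OF Suc.prems(1)] by auto
  have N_inf: "infinite (N p)" for p unfolding N_def
    by (rule range_inj_infinite) (auto simp: inj_on_def dest: injD[OF inj])
  have N_disj: "p = p'" if "x \<in> N p" "x \<in> N p'" for x p p'
    using that unfolding N_def by (auto dest!: injD[OF inj])
  show ?case
  proof (cases "\<exists>p. \<forall>n\<in>N p. \<forall>S. finite S \<longrightarrow> S \<subseteq> N p - {n} \<longrightarrow> (\<Sum>m\<in>S. a m n) \<le> \<delta>")
    case True
    then obtain p where "\<forall>n\<in>N p. \<forall>S. finite S \<longrightarrow> S \<subseteq> N p - {n} \<longrightarrow> (\<Sum>m\<in>S. a m n) \<le> \<delta>" ..
    thus ?thesis by (intro exI[of _ "N p"] conjI NM N_inf)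
  next
    case False
    hence "\<forall>p. \<exists>n S. n \<in> N p \<and> finite S \<and> S \<subseteq> N p - {n} \<and> \<delta> < (\<Sum>m\<in>S. a m n)"
      by (simp only: not_all not_ex not_imp not_le bex_simps ball_simps) blast
    then obtain b S where b: "\<And>p. b p \<in> N p" and S: "\<And>p. finite (S p)" "\<And>p. S p \<subseteq> N p - {b p}"
      "\<And>p. \<delta> < (\<Sum>m\<in>S p. a m (b p))" by metis
    have "inj b" by (rule injI) (metis N_disj b)
    hence inf: "infinite (range b)" by (rule range_inj_infinite)
    have bM: "range b \<subseteq> M" using b NM by blast
    have le: "(\<Sum>m\<in>R. a m n) \<le> real k * \<delta>" if n: "n \<in> range b" and R: "finite R" "R \<subseteq> range b" for n R
    proof -
      obtain p where p: "n = b p" using n by blast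
      have disj: "R \<inter> S p = {}"
      proof (rule ccontr)
        assume "R \<inter> S p \<noteq> {}"
        then obtain x where x: "x \<in> R" "x \<in> S p" by blast
        then obtain p' where "x = b p'" using R by blast
        moreover have "x \<in> N p" "x \<noteq> b p" using x S(2) by auto
        ultimately show False using N_disj b by metis
      qed
      have "(\<Sum>m\<in>R. a m n) + (\<Sum>m\<in>S p. a m n) = (\<Sum>m\<in>R \<union> S p. a m n)"
        by (rule sum.union_disjoint[symmetric, OF R(1) S(1) disj])
      also have "\<dots> \<le> real (Suc k) * \<delta>"
      proof (rule Suc.prems(2))
        show "n \<in> M" using n bM by blast
        show "finite (R \<union> S p)" using R S by simp
        show "R \<union> S p \<subseteq> M" using R(2) bM S(2) NM by blast
      qed
      finally show ?thesis using S(3)[of p] p by (simp add: algebra_simps)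
    qed
    from Suc.IH[OF inf le] obtain M' where "M' \<subseteq> range b" "infinite M'"
      "\<forall>n\<in>M'. \<forall>S. finite S \<longrightarrow> S \<subseteq> M' - {n} \<longrightarrow> (\<Sum>m\<in>S. a m n) \<le> \<delta>" by auto
    thus ?thesis using bM by (intro exI[of _ M'] conjI) auto
  qed
qed

text \<open>Known as Rosenthal's lemma; the step above applies with \<open>k\<close> such that \<open>k \<delta>\<close> exceeds \<open>C\<close>.\<close>

lemma rosenthal:
  fixes a :: "nat \<Rightarrow> nat \<Rightarrow> real"
  assumes a: "\<And>m n. 0 \<le> a m n" and C: "\<And>n N. (\<Sum>m<N. a m n) \<le> C" and \<delta>: "0 < \<delta>"
  shows "\<exists>r :: nat \<Rightarrow> nat. strict_mono r \<and> (\<forall>i J. finite J \<longrightarrow> i \<notin> J \<longrightarrow> (\<Sum>j\<in>J. a (r j) (r i)) \<le> \<delta>)"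
proof -
  obtain k :: nat where k: "C \<le> real k * \<delta>" using ex_less_of_nat_mult[OF \<delta>, of C] less_imp_le by blast
  have "(\<Sum>m\<in>S. a m n) \<le> real k * \<delta>" if fin: "finite S" for n S
  proof -
    obtain N where "S \<subseteq> {..<N}" using fin finite_nat_iff_bounded[THEN iffD1] by blast
    hence "(\<Sum>m\<in>S. a m n) \<le> (\<Sum>m<N. a m n)" by (intro sum_mono2) (auto simp: a)
    thus ?thesis using C[of n N] k by linarith
  qed
  hence "\<exists>M\<subseteq>UNIV. infinite M \<and> (\<forall>n\<in>M. \<forall>S. finite S \<longrightarrow> S \<subseteq> M - {n} \<longrightarrow> (\<Sum>m\<in>S. a m n) \<le> \<delta>)"
    by (intro rosenthal_step[OF a \<delta>] infinite_UNIV_nat)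
  then obtain M where M1: "infinite M"
    and M2: "\<forall>n\<in>M. \<forall>S. finite S \<longrightarrow> S \<subseteq> M - {n} \<longrightarrow> (\<Sum>m\<in>S. a m n) \<le> \<delta>"
    by (elim exE conjE)
  define r where "r = enumerate M"
  have r: "strict_mono r" unfolding r_def by (rule strict_mono_enumerate[OF M1])
  have "(\<Sum>j\<in>J. a (r j) (r i)) \<le> \<delta>" if "finite J" "i \<notin> J" for i J
  proof -
    have inj: "inj r" using r by (rule strict_mono_imp_inj_on)
    have "(\<Sum>j\<in>J. a (r j) (r i)) = (\<Sum>m\<in>r ` J. a m (r i))"
      by (subst sum.reindex) (auto intro: inj_on_subset[OF inj])
    also have "\<dots> \<le> \<delta>"
    proof (rule M2[rule_format])
      have "r j \<in> M" for j unfolding r_def by (rule enumerate_in_set[OF M1])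
      thus "r i \<in> M" "r ` J \<subseteq> M - {r i}" using that(2) injD[OF inj] by auto
    qed (use that(1) in simp)
    finally show ?thesis .
  qed
  hence fin: "strict_mono r \<and> (\<forall>i J. finite J \<longrightarrow> i \<notin> J \<longrightarrow> (\<Sum>j\<in>J. a (r j) (r i)) \<le> \<delta>)" using r by simp
  show ?thesis by (rule exI[of _ r], rule fin)
qed

lemma sum_disjoint_le:
  fixes a :: "nat \<Rightarrow> 'a::banach_lattice"
  assumes a: "\<And>n. 0 \<le> a n" "\<And>n. a n \<le> x" and disj: "\<And>i j. i < j \<Longrightarrow> inf (a i) (a j) = 0"
  shows "(\<Sum>n<N. a n) \<le> x"
proof (induction N)
  case 0
  show ?case using order.trans[OF a(1) a(2)] by simp
next
  case (Suc N)
  have "inf (\<Sum>n<M. a n) (a N) = 0" if "M \<le> N" for M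
    using that
  proof (induction M)
    case 0
    show ?case using a(1) by (simp add: inf_absorb1)
  next
    case (Suc M)
    have "inf ((\<Sum>n<M. a n) + a M) (a N) \<le> inf (\<Sum>n<M. a n) (a N) + inf (a M) (a N)"
      by (intro inf_add_le sum_nonneg a(1))
    also have "\<dots> = 0" using Suc disj[of M N] by simp
    finally show ?case using a(1) by (intro order.antisym) (simp_all add: sum_nonneg add_nonneg_nonneg)
  qed
  hence "inf (\<Sum>n<N. a n) (a N) = 0" by simp
  hence "(\<Sum>n<N. a n) + a N = sup (\<Sum>n<N. a n) (a N)" using add_eq_inf_sup[of "\<Sum>n<N. a n" "a N"] by simp
  also have "\<dots> \<le> x" using Suc a(2) by simp
  finally show ?case by simp
qed

text \<open>Disjoint elements have their supremum as sum, so the components of \<open>x\<close> in disjoint bands sum to at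
  most \<open>x\<close>.\<close>

lemma sum_band_proj_le:
  fixes w :: "nat \<Rightarrow> 'a::al_space"
  assumes w: "\<And>n. 0 \<le> w n" and disj: "\<And>i j. i < j \<Longrightarrow> inf (w i) (w j) = 0" and x: "0 \<le> x"
  shows "(\<Sum>n<N. total \<cdot> (band_proj (w n) \<cdot> x)) \<le> norm x"
proof -
  have "(\<Sum>n<N. band_proj (w n) \<cdot> x) \<le> x"
  proof (rule banach_lattice_le_limit[OF _ tendsto_const])
    show "(\<lambda>j. \<Sum>n<N. inf x (real j *\<^sub>R w n)) \<longlonglongrightarrow> (\<Sum>n<N. band_proj (w n) \<cdot> x)"
      by (intro tendsto_sum band_proj_limit w x)
    fix j :: nat
    have pos: "0 \<le> inf x (real j *\<^sub>R w n)" for n using x w by (simp add: scaleR_nonneg_nonneg)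
    show "(\<Sum>n<N. inf x (real j *\<^sub>R w n)) \<le> x"
    proof (rule sum_disjoint_le[OF pos])
      fix i k :: nat assume "i < k"
      hence "inf (real j *\<^sub>R w i) (w k) = 0" by (intro disjoint_scaleR disj) auto
      hence "inf (w k) (real j *\<^sub>R w i) = 0" by (simp add: inf_commute)
      hence "inf (real j *\<^sub>R w k) (real j *\<^sub>R w i) = 0" by (intro disjoint_scaleR) auto
      hence "inf (real j *\<^sub>R w i) (real j *\<^sub>R w k) = 0" by (simp add: inf_commute)
      thus "inf (inf x (real j *\<^sub>R w i)) (inf x (real j *\<^sub>R w k)) = 0"
        by (rule disjoint_mono) (simp_all add: x w scaleR_nonneg_nonneg)
    qed simp
  qed
  moreover have p: "0 \<le> (band_proj (w n)) \<cdot> x" for n by (rule band_proj_nonneg[OF w x])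
  ultimately have "norm (\<Sum>n<N. band_proj (w n) \<cdot> x) \<le> norm x"
    by (intro norm_mono_nonneg sum_nonneg) auto
  moreover have "norm (\<Sum>n<N. band_proj (w n) \<cdot> x) = total \<cdot> (\<Sum>n<N. band_proj (w n) \<cdot> x)"
    using p by (simp add: total_nonneg_eq sum_nonneg)
  ultimately show ?thesis by (simp add: blinfun.sum_right)
qed

text \<open>Put \<open>w n = (h n - K 4\<^sup>n (\<Sum>k<n. h k) - y / (K 2\<^sup>n))\<^sup>+\<close> with \<open>y = \<Sum>k. h k / 2\<^sup>k\<close>. For \<open>n < k\<close>, the
  second term gives \<open>w k \<le> (h k - K 4\<^sup>k h n)\<^sup>+\<close>, and the third, as \<open>2\<^sup>n 2\<^sup>k \<le> 4\<^sup>k\<close>, bounds \<open>w n\<close> by a multiple of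
  \<open>(h k - K 4\<^sup>k h n)\<^sup>-\<close>. So \<open>w n\<close> and \<open>w k\<close> are disjoint, and the third term costs at most \<open>2 C / K\<close> in norm.\<close>

lemma almost_disjoint_sequence:
  fixes h :: "nat \<Rightarrow> 'a::al_space"
  assumes h: "\<And>n. 0 \<le> h n" "\<And>n. norm (h n) \<le> C" and K: "1 \<le> K" "2 * C / K \<le> \<epsilon>"
    and big: "\<And>n. c < norm (pos_part (h n - (K * 4 ^ n) *\<^sub>R (\<Sum>k<n. h k)))"
  shows "\<exists>w. (\<forall>n. 0 \<le> w n \<and> w n \<le> h n \<and> c - \<epsilon> \<le> norm (w n)) \<and> (\<forall>i j. i < j \<longrightarrow> inf (w i) (w j) = 0)"
proof -
  have C: "0 \<le> C" using h(2)[of 0] norm_ge_zero order.trans by blast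
  define y where "y = (\<Sum>k. (1/2) ^ k *\<^sub>R h k)"
  have nb: "norm ((1/2) ^ k *\<^sub>R h k) \<le> C * (1/2) ^ k" for k
    using mult_left_mono[OF h(2)[of k], of "(1/2) ^ k"] by (simp add: mult.commute)
  have geo: "(\<lambda>k. C * (1/2 :: real) ^ k) sums (C * 2)"
    using sums_mult[OF geometric_sums[of "1/2 :: real"], of C] by simp
  have sn: "summable (\<lambda>k. norm ((1/2) ^ k *\<^sub>R h k))"
    by (rule summable_comparison_test_ev[OF _ sums_summable[OF geo]]) (use nb in simp)
  hence sm: "summable (\<lambda>k. (1/2) ^ k *\<^sub>R h k)" by (rule summable_norm_cancel)
  have "norm y \<le> (\<Sum>k. C * (1/2) ^ k)"
    unfolding y_def by (rule order.trans[OF summable_norm[OF sn] suminf_le[OF nb sn sums_summable[OF geo]]])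
  hence ny: "norm y \<le> C * 2" using sums_unique[OF geo] by simp
  have pos: "0 \<le> (1/2) ^ k *\<^sub>R h k" for k using h by (simp add: scaleR_nonneg_nonneg)
  have yh: "(1/2) ^ k *\<^sub>R h k \<le> y" for k
  proof (rule banach_lattice_le_limit[OF tendsto_const])
    show "(\<lambda>n. \<Sum>i<n + Suc k. (1/2) ^ i *\<^sub>R h i) \<longlonglongrightarrow> y"
      using LIMSEQ_ignore_initial_segment[OF summable_LIMSEQ[OF sm], of "Suc k"] by (simp only: y_def)
    show "(1/2) ^ k *\<^sub>R h k \<le> (\<Sum>i<n + Suc k. (1/2) ^ i *\<^sub>R h i)" for n
      using sum.remove[of "{..<n + Suc k}" k "\<lambda>i. (1/2) ^ i *\<^sub>R h i"] pos by (simp add: sum_nonneg)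
  qed
  have y0: "0 \<le> y" using order.trans[OF pos yh] .
  define s where "s n = (\<Sum>k<n. h k)" for n
  define e where "e n = 1 / (K * 2 ^ n)" for n :: nat
  have e: "0 < e n" "e n \<le> 1 / K" for n
  proof -
    have "1 \<le> (2::real) ^ n" by simp
    hence "K * 1 \<le> K * 2 ^ n" using K(1) by (intro mult_left_mono) auto
    thus "0 < e n" "e n \<le> 1 / K" using K(1) by (auto simp: e_def intro!: divide_left_mono mult_pos_pos)
  qed
  define w where "w n = pos_part (h n - (K * 4 ^ n) *\<^sub>R s n - e n *\<^sub>R y)" for n
  have s0: "0 \<le> (K * 4 ^ n) *\<^sub>R s n" for n using K h by (simp add: s_def sum_nonneg scaleR_nonneg_nonneg)
  have ey: "0 \<le> e n *\<^sub>R y" for n using e(1)[of n] y0 by (simp add: scaleR_nonneg_nonneg less_imp_le)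
  have "w n \<le> h n" for n
  proof -
    have "h n - (K * 4 ^ n) *\<^sub>R s n - e n *\<^sub>R y \<le> h n"
      using s0[of n] ey[of n] by (simp add: diff_le_eq add_increasing2)
    thus ?thesis unfolding w_def by (rule pos_part_least[OF _ h(1)])
  qed
  moreover have "c - \<epsilon> \<le> norm (w n)" for n
  proof -
    let ?a = "h n - (K * 4 ^ n) *\<^sub>R s n"
    have "?a = (?a - e n *\<^sub>R y) + e n *\<^sub>R y" by simp
    also have "\<dots> \<le> w n + e n *\<^sub>R y" unfolding w_def by (intro add_right_mono pos_part_ge)
    finally have "pos_part ?a \<le> w n + e n *\<^sub>R y"
      by (rule pos_part_least) (use ey in \<open>simp add: w_def add_nonneg_nonneg\<close>)
    hence "norm (pos_part ?a) \<le> norm (w n + e n *\<^sub>R y)" by (intro norm_mono_nonneg) auto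
    also have "\<dots> \<le> norm (w n) + e n * norm y"
      using norm_triangle_ineq[of "w n" "e n *\<^sub>R y"] e(1)[of n] by simp
    also have "e n * norm y \<le> (1 / K) * (C * 2)" using e[of n] ny C K(1) by (intro mult_mono) auto
    also have "\<dots> \<le> \<epsilon>" using K(2) by (simp add: mult.commute)
    finally show ?thesis using big[of n] by (simp add: s_def)
  qed
  moreover have "inf (w n) (w k) = 0" if nk: "n < k" for n k
  proof -
    let ?d = "h k - (K * 4 ^ k) *\<^sub>R h n"
    define t where "t = 1 / (K * 4 ^ k)"
    have t: "0 < t" "t * (K * 4 ^ k) = 1" using K(1) by (auto simp: t_def)
    have wk: "w k \<le> pos_part ?d"
      unfolding w_def
    proof (rule pos_part_mono)
      have "h n \<le> s k"
        using sum.remove[of "{..<k}" n h] nk h(1) by (simp add: s_def sum_nonneg)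
      hence "(K * 4 ^ k) *\<^sub>R h n \<le> (K * 4 ^ k) *\<^sub>R s k + e k *\<^sub>R y"
        using K(1) ey[of k] scaleR_left_mono[of "h n" "s k" "K * 4 ^ k"] by (simp add: add_increasing2)
      thus "h k - (K * 4 ^ k) *\<^sub>R s k - e k *\<^sub>R y \<le> ?d"
        unfolding diff_diff_eq by (rule diff_left_mono)
    qed
    have wn: "w n \<le> t *\<^sub>R pos_part (- ?d)"
      unfolding w_def
    proof (rule pos_part_least)
      have "t *\<^sub>R h k \<le> (e n * (1/2) ^ k) *\<^sub>R h k"
      proof (rule scaleR_right_mono[OF _ h(1)])
        have "(2::real) ^ n * 2 ^ k \<le> 2 ^ k * 2 ^ k"
          using nk by (intro mult_right_mono power_increasing) auto
        also have "\<dots> = 4 ^ k" by (simp add: power_mult_distrib[symmetric])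
        finally have "K * (2 ^ n * 2 ^ k) \<le> K * 4 ^ k" using K(1) by (intro mult_left_mono) auto
        hence "1 / (K * 4 ^ k) \<le> 1 / (K * (2 ^ n * 2 ^ k))" using K(1) by (intro divide_left_mono mult_pos_pos) auto
        thus "t \<le> e n * (1/2) ^ k" by (simp add: t_def e_def power_one_over mult.assoc)
      qed
      also have "\<dots> = e n *\<^sub>R ((1/2) ^ k *\<^sub>R h k)" by simp
      also have "\<dots> \<le> e n *\<^sub>R y" using e(1)[of n] by (intro scaleR_left_mono yh) simp
      also have "\<dots> \<le> (K * 4 ^ n) *\<^sub>R s n + e n *\<^sub>R y" using s0[of n] by (simp add: add_increasing)
      finally have "h n - (K * 4 ^ n) *\<^sub>R s n - e n *\<^sub>R y \<le> h n - t *\<^sub>R h k"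
        unfolding diff_diff_eq by (rule diff_left_mono)
      also have "\<dots> = t *\<^sub>R (- ?d)" using t(2) by (simp add: scaleR_diff_right)
      also have "\<dots> \<le> t *\<^sub>R pos_part (- ?d)" using t(1) by (intro scaleR_left_mono pos_part_ge) simp
      finally show "h n - (K * 4 ^ n) *\<^sub>R s n - e n *\<^sub>R y \<le> t *\<^sub>R pos_part (- ?d)" .
      show "0 \<le> t *\<^sub>R pos_part (- ?d)" using t(1) by (simp add: scaleR_nonneg_nonneg)
    qed
    have "inf (pos_part (- ?d)) (pos_part ?d) = 0"
      using pos_part_disjoint[of ?d] by (simp only: inf_commute)
    hence "inf (t *\<^sub>R pos_part (- ?d)) (pos_part ?d) = 0" by (rule disjoint_scaleR) (use t(1) in simp)
    thus ?thesis by (rule disjoint_mono) (use wn wk in \<open>simp_all add: w_def\<close>)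
  qed
  moreover have "0 \<le> w n" for n by (simp add: w_def)
  ultimately have fin: "(\<forall>n. 0 \<le> w n \<and> w n \<le> h n \<and> c - \<epsilon> \<le> norm (w n)) \<and> (\<forall>i j. i < j \<longrightarrow> inf (w i) (w j) = 0)"
    by simp
  show ?thesis by (rule exI[of _ w], rule fin)
qed

context al_scalars
begin

text \<open>The functional \<open>\<phi> n\<close> integrates over the band of the \<open>n\<close>-th disjoint element, with the phase of
  \<open>T (f n)\<close> removed.\<close>

lemma disjoint_functionals:
  assumes T: "bounded_linear T" and c: "\<And>u. 0 \<le> u \<Longrightarrow> \<exists>f. 0 \<le> f \<and> norm f \<le> 1 \<and> c < norm (pos_part (m (T (emb f)) - u))"
    and \<epsilon>: "0 < \<epsilon>"
  shows "\<exists>(f :: nat \<Rightarrow> 'e) (\<phi> :: nat \<Rightarrow> 'e \<Rightarrow> 'k). (\<forall>n. norm (f n) \<le> 1 \<and> \<phi> n \<in> dual scl \<and> c - \<epsilon> \<le> norm (\<phi> n (T (f n)))) \<and>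
    (\<forall>g N. (\<Sum>n<N. norm (\<phi> n g)) \<le> norm g)"
proof -
  obtain C where C: "\<And>z. norm (T z) \<le> norm z * C" "0 < C"
    using bounded_linear.pos_bounded[OF T] by blast
  \<comment> \<open>Half of the admissible loss goes to making the parts disjoint, half to the rounded phase.\<close>
  define K where "K = max 1 (4 * C / \<epsilon>)"
  have K: "1 \<le> K" "2 * C / K \<le> \<epsilon> / 2"
  proof -
    show "1 \<le> K" by (simp add: K_def)
    have "4 * C / \<epsilon> \<le> K" by (simp add: K_def)
    hence "4 * C \<le> \<epsilon> * K" using \<epsilon> by (simp add: field_simps)
    thus "2 * C / K \<le> \<epsilon> / 2" using \<open>1 \<le> K\<close> by (simp add: field_simps)
  qed
  obtain F where F: "\<And>u. 0 \<le> u \<Longrightarrow> 0 \<le> F u \<and> norm (F u) \<le> 1 \<and> c < norm (pos_part (m (T (emb (F u))) - u))"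
    using c by metis
  \<comment> \<open>The recursion carries the sum of the moduli so far, on which alone the next choice depends.\<close>
  define s where "s = rec_nat 0 (\<lambda>n v. v + m (T (emb (F ((K * 4 ^ n) *\<^sub>R v)))))"
  define f where "f n = F ((K * 4 ^ n) *\<^sub>R s n)" for n
  define h where "h n = m (T (emb (f n)))" for n
  have s: "s n = (\<Sum>k<n. h k)" for n by (induction n) (simp_all add: s_def h_def f_def)
  have h0: "0 \<le> h n" for n by (simp add: h_def m_nonneg)
  have u: "0 \<le> (K * 4 ^ n) *\<^sub>R s n" for n using K(1) h0 by (simp add: s sum_nonneg scaleR_nonneg_nonneg)
  have f: "norm (f n) \<le> 1" for n using F[OF u] by (simp add: f_def)
  have hC: "norm (h n) \<le> C" for n
    using C(1)[of "emb (f n)"] mult_right_mono[OF f[of n] less_imp_le[OF C(2)]] by (simp add: h_def norm_m norm_emb)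
  have big: "c < norm (pos_part (h n - (K * 4 ^ n) *\<^sub>R (\<Sum>k<n. h k)))" for n
    using F[OF u[of n]] by (simp add: s[symmetric]) (simp add: h_def f_def)
  obtain w where "(\<forall>n. 0 \<le> w n \<and> w n \<le> h n \<and> c - \<epsilon> / 2 \<le> norm (w n)) \<and>
      (\<forall>i j. i < j \<longrightarrow> inf (w i) (w j) = 0)"
    using almost_disjoint_sequence[OF h0 hC K big] by (elim exE)
  hence w: "\<And>n. 0 \<le> w n" "\<And>n. w n \<le> h n" "\<And>n. c - \<epsilon> / 2 \<le> norm (w n)"
    "\<And>i j. i < j \<Longrightarrow> inf (w i) (w j) = 0" by simp_all
  define \<psi> where "\<psi> n = total o\<^sub>L band_proj (w n)" for n
  have \<psi>0: "0 \<le> (\<psi> n) \<cdot> x" if "0 \<le> x" for n x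
    using band_proj_nonneg[OF w(1) that] by (simp add: \<psi>_def total_nonneg_eq)
  have "\<forall>n. \<exists>\<phi>\<in>dual scl. (\<forall>g. norm (\<phi> g) \<le> (\<psi> n) \<cdot> m g) \<and>
      \<psi> n \<cdot> (m (T (emb (f n)))) - \<epsilon> / 2 \<le> norm (\<phi> (T (emb (f n))))"
    using positive_functional_polar[OF \<psi>0] \<epsilon> by simp
  then obtain \<phi> where \<phi>: "\<And>n. \<phi> n \<in> dual scl" "\<And>n g. norm (\<phi> n g) \<le> (\<psi> n) \<cdot> m g"
      "\<And>n. \<psi> n \<cdot> h n - \<epsilon> / 2 \<le> norm (\<phi> n (T (emb (f n))))"
    unfolding h_def by metis
  have "c - \<epsilon> \<le> norm (\<phi> n (T (emb (f n))))" for n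
  proof -
    have "norm (w n) = \<psi> n \<cdot> w n"
      by (simp add: \<psi>_def band_proj_self[OF w(1)] total_nonneg_eq[OF w(1)])
    also have "\<dots> \<le> (\<psi> n) \<cdot> h n"
      using \<psi>0[of "h n - w n" n] w(2)[of n] by (simp add: blinfun.diff_right)
    finally show ?thesis using \<phi>(3)[of n] w(3)[of n] by linarith
  qed
  moreover have "(\<Sum>n<N. norm (\<phi> n g)) \<le> norm g" for N g
  proof -
    have "(\<Sum>n<N. norm (\<phi> n g)) \<le> (\<Sum>n<N. \<psi> n \<cdot> m g)" by (rule sum_mono) (rule \<phi>(2))
    also have "\<dots> \<le> norm (m g)"
      using sum_band_proj_le[OF w(1) w(4) m_nonneg] by (simp add: \<psi>_def)
    finally show ?thesis by (simp add: norm_m)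
  qed
  ultimately have fin: "(\<forall>n. norm (emb (f n)) \<le> 1 \<and> \<phi> n \<in> dual scl \<and> c - \<epsilon> \<le> norm (\<phi> n (T (emb (f n))))) \<and>
    (\<forall>g N. (\<Sum>n<N. norm (\<phi> n g)) \<le> norm g)" using f \<phi>(1) by (simp add: norm_emb)
  show ?thesis by (rule exI[of _ "\<lambda>n. emb (f n)"], rule exI[of _ \<phi>], rule fin)
qed

text \<open>Rosenthal's lemma applies to \<open>|\<phi> m (T (f n))|\<close>, whose column sums are at most \<open>\<parallel>T (f n)\<parallel>\<close>. Dividing by the
  diagonal, which is at least \<open>c'\<close>, normalises it to \<open>1\<close>.\<close>

lemma almost_biorthogonal_system:
  assumes T: "bounded_linear T" and c: "\<And>u. 0 \<le> u \<Longrightarrow> \<exists>f. 0 \<le> f \<and> norm f \<le> 1 \<and> c < norm (pos_part (m (T (emb f)) - u))"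
    and c': "0 < c'" "c' < c" and \<delta>: "0 < \<delta>"
  shows "\<exists>(f :: nat \<Rightarrow> 'e) (\<phi> :: nat \<Rightarrow> 'e \<Rightarrow> 'k). (\<forall>n. norm (f n) \<le> 1 \<and> \<phi> n \<in> dual scl \<and> \<phi> n (T (f n)) = 1) \<and>
    (\<forall>g N. (\<Sum>n<N. norm (\<phi> n g)) \<le> norm g / c') \<and>
    (\<forall>i J. finite J \<longrightarrow> i \<notin> J \<longrightarrow> (\<Sum>j\<in>J. norm (\<phi> j (T (f i)))) \<le> \<delta>)"
proof -
  obtain f and \<phi> :: "nat \<Rightarrow> 'e \<Rightarrow> 'k" where f: "\<And>n. norm (f n) \<le> 1" and \<phi>: "\<And>n. \<phi> n \<in> dual scl"
    "\<And>n. c' \<le> norm (\<phi> n (T (f n)))" "\<And>g N. (\<Sum>n<N. norm (\<phi> n g)) \<le> norm g"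
    using disjoint_functionals[OF T c, of "c - c'"] c' by auto
  obtain C where C: "\<And>z. norm (T z) \<le> norm z * C" "0 < C"
    using bounded_linear.pos_bounded[OF T] by blast
  have "norm (T (f n)) \<le> C" for n
    using C(1)[of "f n"] mult_right_mono[OF f[of n] less_imp_le[OF C(2)]] by simp
  hence bd: "(\<Sum>k<N. norm (\<phi> k (T (f n)))) \<le> C" for n N using \<phi>(3)[of "T (f n)" N] order.trans by blast
  have "0 < c' * \<delta>" using c'(1) \<delta> by simp
  from rosenthal[of "\<lambda>k n. norm (\<phi> k (T (f n)))", OF norm_ge_zero bd this]
  obtain r :: "nat \<Rightarrow> nat" where "strict_mono r \<and>
    (\<forall>i J. finite J \<longrightarrow> i \<notin> J \<longrightarrow> (\<Sum>j\<in>J. norm (\<phi> (r j) (T (f (r i))))) \<le> c' * \<delta>)" by (elim exE)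
  hence r: "strict_mono r"
    "\<And>i J. finite J \<Longrightarrow> i \<notin> J \<Longrightarrow> (\<Sum>j\<in>J. norm (\<phi> (r j) (T (f (r i))))) \<le> c' * \<delta>" by simp_all
  define d where "d n = \<phi> (r n) (T (f (r n)))" for n
  have d: "c' \<le> norm (d n)" "d n \<noteq> 0" for n using \<phi>(2)[of "r n"] c'(1) by (auto simp: d_def)
  define \<phi>' where "\<phi>' n g = inverse (d n) * \<phi> (r n) g" for n g
  have dual: "\<phi>' n \<in> dual scl" for n
    unfolding \<phi>'_def[abs_def] using dualD[OF \<phi>(1)]
    by (intro dualI bounded_linear_compose[OF bounded_linear_mult_right]) auto
  have n\<phi>': "norm (\<phi>' n g) \<le> norm (\<phi> (r n) g) / c'" for n g
  proof -
    have "norm (\<phi>' n g) = norm (\<phi> (r n) g) / norm (d n)"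
      by (simp add: \<phi>'_def norm_mult norm_inverse divide_inverse mult.commute)
    also have "\<dots> \<le> norm (\<phi> (r n) g) / c'" using d c'(1) by (intro divide_left_mono mult_pos_pos) auto
    finally show ?thesis .
  qed
  have "(\<Sum>n<N. norm (\<phi>' n g)) \<le> norm g / c'" for N g
  proof -
    have inj: "inj r" using r(1) by (rule strict_mono_imp_inj_on)
    obtain M where M: "r ` {..<N} \<subseteq> {..<M}" using finite_nat_iff_bounded[THEN iffD1, of "r ` {..<N}"] by auto
    have "(\<Sum>n<N. norm (\<phi>' n g)) \<le> (\<Sum>n<N. norm (\<phi> (r n) g) / c')" by (rule sum_mono) (rule n\<phi>')
    also have "\<dots> = (\<Sum>n\<in>r ` {..<N}. norm (\<phi> n g)) / c'"
      by (subst sum.reindex) (auto intro: inj_on_subset[OF inj] simp: sum_divide_distrib)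
    also have "\<dots> \<le> (\<Sum>n<M. norm (\<phi> n g)) / c'"
      using M c'(1) by (intro divide_right_mono sum_mono2) auto
    also have "\<dots> \<le> norm g / c'" using \<phi>(3)[of g M] c'(1) by (intro divide_right_mono) auto
    finally show ?thesis .
  qed
  moreover have "(\<Sum>j\<in>J. norm (\<phi>' j (T (f (r i))))) \<le> \<delta>" if "finite J" "i \<notin> J" for i J
  proof -
    have "(\<Sum>j\<in>J. norm (\<phi>' j (T (f (r i))))) \<le> (\<Sum>j\<in>J. norm (\<phi> (r j) (T (f (r i)))) / c')"
      by (rule sum_mono) (rule n\<phi>')
    also have "\<dots> \<le> (c' * \<delta>) / c'" unfolding sum_divide_distrib[symmetric]
      using r(2)[OF that] c'(1) by (intro divide_right_mono) auto
    finally show ?thesis using c'(1) by simp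
  qed
  moreover have "\<phi>' n (T (f (r n))) = 1" for n using d[of n] by (simp add: \<phi>'_def d_def)
  ultimately have fin: "(\<forall>n. norm (f (r n)) \<le> 1 \<and> \<phi>' n \<in> dual scl \<and> \<phi>' n (T (f (r n))) = 1) \<and>
    (\<forall>g N. (\<Sum>n<N. norm (\<phi>' n g)) \<le> norm g / c') \<and>
    (\<forall>i J. finite J \<longrightarrow> i \<notin> J \<longrightarrow> (\<Sum>j\<in>J. norm (\<phi>' j (T (f (r i))))) \<le> \<delta>)"
    using f dual by simp
  show ?thesis by (rule exI[of _ "\<lambda>n. f (r n)"], rule exI[of _ \<phi>'], rule fin)
qed

section \<open>An idempotent from an almost biorthogonal system\<close>

lemma linear_dual: "\<phi> \<in> dual scl \<Longrightarrow> linear \<phi>"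
  using dualD(1) bounded_linear.linear by blast

context
  fixes T :: "'e \<Rightarrow>\<^sub>L 'e" and f :: "nat \<Rightarrow> 'e" and \<phi> :: "nat \<Rightarrow> 'e \<Rightarrow> 'k" and c \<delta> :: real
  assumes T: "Vector_Spaces.linear scl scl (blinfun_apply T)"
    and f: "\<And>n. norm (f n) \<le> 1"
    and \<phi>: "\<And>n. \<phi> n \<in> dual scl"
    and diag: "\<And>n. \<phi> n (T \<cdot> f n) = 1"
    and sum\<phi>: "\<And>g N. (\<Sum>n<N. norm (\<phi> n g)) \<le> norm g / c"
    and off: "\<And>i J. finite J \<Longrightarrow> i \<notin> J \<Longrightarrow> (\<Sum>j\<in>J. norm (\<phi> j (T \<cdot> f i))) \<le> \<delta>"
    and c: "0 < c" and \<delta>: "0 < \<delta>" "\<delta> < 1"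
begin

text \<open>The combinations of the \<open>f n\<close> with summable coefficients are the image of \<open>\<ell>\<^sub>1\<close> in \<open>'e\<close>; the first
  argument bounds the \<open>\<ell>\<^sub>1\<close>-norm of the coefficients.\<close>

definition combination :: "real \<Rightarrow> 'e \<Rightarrow> bool" where
  "combination A g \<longleftrightarrow> (\<exists>a :: nat \<Rightarrow> 'k. summable (\<lambda>n. norm (a n)) \<and> (\<Sum>n. norm (a n)) \<le> A \<and> g = (\<Sum>n. scl (a n) (f n)))"

lemma norm_scl_f_le: "norm (scl a (f n)) \<le> norm a"
  using norm_scl_le[of a "f n"] mult_left_mono[OF f[of n] norm_ge_zero[of a]] by simp

lemma summable_scl_f:
  assumes "summable (\<lambda>n. norm (a n))"
  shows "summable (\<lambda>n. norm (scl (a n) (f n)))"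
  by (rule summable_comparison_test_ev[OF _ assms]) (simp add: norm_scl_f_le)

lemma norm_combination_le:
  assumes "combination A g"
  shows "norm g \<le> A"
proof -
  obtain a :: "nat \<Rightarrow> 'k" where a: "summable (\<lambda>n. norm (a n))" "(\<Sum>n. norm (a n)) \<le> A" "g = (\<Sum>n. scl (a n) (f n))"
    using assms unfolding combination_def by blast
  have "norm g \<le> (\<Sum>n. norm (scl (a n) (f n)))" unfolding a(3) by (rule summable_norm[OF summable_scl_f[OF a(1)]])
  also have "\<dots> \<le> (\<Sum>n. norm (a n))" by (rule suminf_le[OF norm_scl_f_le summable_scl_f[OF a(1)] a(1)])
  finally show ?thesis using a(2) by simp
qed

lemma combination_f: "combination 1 (f n)"
proof -
  let ?a = "\<lambda>k. if k = n then 1 else 0 :: 'k"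
  have s: "(\<lambda>k. norm (?a k)) sums 1" using sums_single[of n "\<lambda>_. 1 :: real"] by (simp add: if_distrib[of norm] cong: if_cong)
  have "(\<lambda>k. scl (?a k) (f k)) = (\<lambda>k. if k = n then f k else 0)" by (auto simp: scale_one)
  hence "(\<lambda>k. scl (?a k) (f k)) sums f n" using sums_single[of n f] by simp
  thus ?thesis unfolding combination_def using s
    by (intro exI[of _ ?a]) (auto simp: sums_iff)
qed

lemma coefficients_summable: "summable (\<lambda>n. norm (\<phi> n g))" and coefficients_suminf: "(\<Sum>n. norm (\<phi> n g)) \<le> norm g / c"
proof -
  show "summable (\<lambda>n. norm (\<phi> n g))"
    by (rule summableI_nonneg_bounded[OF norm_ge_zero sum\<phi>])
  thus "(\<Sum>n. norm (\<phi> n g)) \<le> norm g / c" by (rule suminf_le_const[OF _ sum\<phi>])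
qed

definition expansion :: "'e \<Rightarrow> 'e" where
  "expansion x = (\<Sum>n. scl (\<phi> n x) (f n))"

lemma combination_expansion: "combination (norm x / c) (expansion x)"
  unfolding combination_def expansion_def
  by (intro exI[of _ "\<lambda>n. \<phi> n x"] conjI coefficients_summable coefficients_suminf refl)

lemma summable_expansion: "summable (\<lambda>n. scl (\<phi> n x) (f n))"
  by (rule summable_norm_cancel[OF summable_scl_f[OF coefficients_summable]])

lemma expansion_add: "expansion (x + y) = expansion x + expansion y"
  using suminf_add[OF summable_expansion[of x] summable_expansion[of y]]
  by (simp add: expansion_def linear_add[OF linear_dual[OF \<phi>]] scale_left_distrib)

lemma expansion_scl: "expansion (scl a x) = scl a (expansion x)"
  using bounded_linear.suminf[OF bounded_linear_scl summable_expansion, of a x]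
  by (simp add: expansion_def dualD(2)[OF \<phi>])

definition expansion_op :: "'e \<Rightarrow>\<^sub>L 'e" where "expansion_op = Blinfun expansion"

lemma expansion_op_apply: "blinfun_apply expansion_op = expansion"
proof -
  have "bounded_linear expansion"
  proof (rule bounded_linear_intro[where K = "1 / c"])
    show "expansion (r *\<^sub>R x) = r *\<^sub>R expansion x" for r x
      using expansion_scl[of "of_real r" x] by (simp add: scl_of_real)
    show "norm (expansion x) \<le> norm x * (1 / c)" for x
      using norm_combination_le[OF combination_expansion] by simp
  qed (rule expansion_add)
  thus ?thesis unfolding expansion_op_def by (rule bounded_linear_Blinfun_apply)
qed

definition defect :: "'e \<Rightarrow>\<^sub>L 'e" where "defect = id_blinfun - (expansion_op o\<^sub>L T)"

text \<open>If \<open>a\<close> are the coefficients of \<open>g\<close>, those of the defect are \<open>a n - \<phi> n (T g)\<close>. Expanding \<open>T g\<close>, the diagonal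
  cancels \<open>a n\<close>, and the off-diagonal columns, which sum to at most \<open>\<delta>\<close>, remain. So the defect is a
  contraction on the combinations, but in general not on the whole space.\<close>

lemma combination_defect:
  assumes "combination A g"
  shows "combination (\<delta> * A) (defect \<cdot> g)"
proof -
  obtain a :: "nat \<Rightarrow> 'k" where a: "summable (\<lambda>n. norm (a n))" "(\<Sum>n. norm (a n)) \<le> A" "g = (\<Sum>n. scl (a n) (f n))"
    using assms unfolding combination_def by blast
  have sm: "summable (\<lambda>n. scl (a n) (f n))" by (rule summable_norm_cancel[OF summable_scl_f[OF a(1)]])
  define b where "b n = a n - \<phi> n (T \<cdot> g)" for n
  have eq: "defect \<cdot> g = (\<Sum>n. scl (b n) (f n))"
    unfolding defect_def using suminf_diff[OF sm summable_expansion[of "T \<cdot> g"]]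
    by (simp add: blinfun.diff_left expansion_op_apply expansion_def b_def scale_left_diff_distrib a(3)[symmetric])
  have bound: "(\<Sum>n<N. norm (b n)) \<le> \<delta> * A" for N
  proof -
    define r where "r n k = (if n = k then 0 else norm (\<phi> n (T \<cdot> f k)))" for n k
    have r1: "(\<Sum>n<N. r n k) \<le> \<delta>" for k N
    proof -
      have "(\<Sum>n<N. r n k) = (\<Sum>n\<in>{..<N} - {k}. norm (\<phi> n (T \<cdot> f k)))"
        by (rule sum.mono_neutral_cong_right) (auto simp: r_def)
      also have "\<dots> \<le> \<delta>" by (rule off) auto
      finally show ?thesis .
    qed
    have r0: "0 \<le> r n k" for n k by (simp add: r_def)
    have r: "r n k \<le> \<delta>" for n k
      using order.trans[OF member_le_sum[of n "{..<Suc n}" "\<lambda>n. r n k"] r1] r0 by simp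
    have sar: "summable (\<lambda>k. norm (a k) * r n k)" for n
    proof (rule summable_comparison_test_ev[OF _ summable_mult2[OF a(1), of \<delta>]])
      show "eventually (\<lambda>k. norm (norm (a k) * r n k) \<le> norm (a k) * \<delta>) sequentially"
        using r0 r by (intro always_eventually allI) (simp add: abs_mult mult_left_mono)
    qed
    have b: "norm (b n) \<le> (\<Sum>k. norm (a k) * r n k)" for n
    proof -
      have lin: "bounded_linear (\<lambda>g. \<phi> n (T \<cdot> g))"
        by (intro bounded_linear_compose[OF dualD(1)[OF \<phi>]] blinfun.bounded_linear_right)
      have Ts: "T \<cdot> scl u x = scl u (T \<cdot> x)" for u x
        using T by (simp add: Vector_Spaces.linear_iff)
      let ?d = "\<lambda>k. a k * \<phi> n (T \<cdot> f k)"
      have "\<phi> n (T \<cdot> g) = (\<Sum>k. \<phi> n (T \<cdot> scl (a k) (f k)))"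
        unfolding a(3) by (rule bounded_linear.suminf[OF lin sm])
      hence e1: "\<phi> n (T \<cdot> g) = (\<Sum>k. ?d k)" by (simp add: Ts dualD(2)[OF \<phi>])
      have s1: "summable ?d" using bounded_linear.summable[OF lin sm] by (simp add: Ts dualD(2)[OF \<phi>])
      have s2: "(\<lambda>k. if k = n then a k else 0) sums a n" by (rule sums_single)
      have "b n = (\<Sum>k. (if k = n then a k else 0) - ?d k)"
        unfolding b_def e1 using suminf_diff[OF sums_summable[OF s2] s1] sums_unique[OF s2] by simp
      also have "(\<lambda>k. (if k = n then a k else 0) - ?d k) = (\<lambda>k. if k = n then 0 else - ?d k)"
        using diag[of n] by (auto simp: fun_eq_iff)
      finally have bn: "b n = (\<Sum>k. if k = n then 0 else - ?d k)" .
      have ne: "norm (if k = n then 0 else - ?d k) = norm (a k) * r n k" for k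
        by (simp add: r_def norm_mult)
      have "norm (\<Sum>k. if k = n then 0 else - ?d k) \<le> (\<Sum>k. norm (if k = n then 0 else - ?d k))"
        by (rule summable_norm) (simp only: ne sar)
      thus ?thesis unfolding bn ne .
    qed
    have "(\<Sum>n<N. norm (b n)) \<le> (\<Sum>n<N. \<Sum>k. norm (a k) * r n k)" by (rule sum_mono) (rule b)
    also have "\<dots> = (\<Sum>k. \<Sum>n<N. norm (a k) * r n k)" by (rule suminf_sum[symmetric]) (rule sar)
    also have "\<dots> \<le> (\<Sum>k. norm (a k) * \<delta>)"
    proof (rule suminf_le)
      show "(\<Sum>n<N. norm (a k) * r n k) \<le> norm (a k) * \<delta>" for k
        unfolding sum_distrib_left[symmetric] by (intro mult_left_mono r1) simp
    qed (intro summable_sum summable_mult2 sar a(1))+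
    also have "\<dots> = (\<Sum>k. norm (a k)) * \<delta>" by (rule suminf_mult2[OF a(1), symmetric])
    also have "\<dots> \<le> A * \<delta>" using a(2) \<delta> by (intro mult_right_mono) auto
    finally show ?thesis by (simp add: mult.commute)
  qed
  have sb: "summable (\<lambda>n. norm (b n))" by (rule summableI_nonneg_bounded[OF norm_ge_zero bound])
  show ?thesis unfolding combination_def
    by (intro exI[of _ b] conjI sb suminf_le_const[OF sb bound] eq)
qed

definition defect_power :: "nat \<Rightarrow> 'e \<Rightarrow>\<^sub>L 'e" where
  "defect_power k = ((\<lambda>U. defect o\<^sub>L U) ^^ k) id_blinfun"

lemma defect_power_0: "defect_power 0 = id_blinfun" and defect_power_Suc: "defect_power (Suc k) = defect o\<^sub>L defect_power k"
  by (simp_all add: defect_power_def)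

lemma combination_defect_power: "combination A g \<Longrightarrow> combination (\<delta> ^ k * A) (defect_power k \<cdot> g)"
  by (induction k) (auto simp: defect_power_0 defect_power_Suc mult.assoc dest: combination_defect)

lemma norm_defect_power_expansion: "norm (defect_power k o\<^sub>L expansion_op) \<le> \<delta> ^ k / c"
proof (rule norm_blinfun_bound)
  show "0 \<le> \<delta> ^ k / c" using \<delta> c by simp
  fix x
  have "norm (defect_power k \<cdot> expansion x) \<le> \<delta> ^ k * (norm x / c)"
    by (rule norm_combination_le[OF combination_defect_power[OF combination_expansion]])
  thus "norm ((defect_power k o\<^sub>L expansion_op) \<cdot> x) \<le> \<delta> ^ k / c * norm x" by (simp add: expansion_op_apply)
qed

lemma geometric_\<delta>: "(\<lambda>k. \<delta> ^ k / c) sums (1 / (1 - \<delta>) / c)"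
  using geometric_sums[of \<delta>] \<delta> by (intro sums_divide) simp

lemma summable_norm_defect_power_expansion: "summable (\<lambda>k. norm (defect_power k o\<^sub>L expansion_op))"
  by (rule summable_comparison_test_ev[OF _ sums_summable[OF geometric_\<delta>]]) (simp add: norm_defect_power_expansion)

text \<open>The Neumann series of \<open>(expansion_op o T)\<^sup>-\<^sup>1\<close>, applied to the range of \<open>expansion_op\<close>, where it
  converges since this range consists of combinations.\<close>

definition left_inverse :: "'e \<Rightarrow>\<^sub>L 'e" where "left_inverse = (\<Sum>k. defect_power k o\<^sub>L expansion_op)"

lemma norm_left_inverse: "norm left_inverse \<le> 1 / (1 - \<delta>) / c"
proof -
  have "norm left_inverse \<le> (\<Sum>k. norm (defect_power k o\<^sub>L expansion_op))" unfolding left_inverse_def by (rule summable_norm[OF summable_norm_defect_power_expansion])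
  also have "\<dots> \<le> (\<Sum>k. \<delta> ^ k / c)"
    by (rule suminf_le[OF norm_defect_power_expansion summable_norm_defect_power_expansion sums_summable[OF geometric_\<delta>]])
  finally show ?thesis using sums_unique[OF geometric_\<delta>] by simp
qed

lemma left_inverse_sums: "(\<lambda>k. defect_power k \<cdot> expansion x) sums left_inverse \<cdot> x"
proof -
  have "(\<lambda>k. (defect_power k o\<^sub>L expansion_op) \<cdot> x) sums left_inverse \<cdot> x"
    unfolding left_inverse_def
    by (rule bounded_linear.sums[OF blinfun.bounded_linear_left summable_sums[OF summable_norm_cancel[OF summable_norm_defect_power_expansion]]])
  thus ?thesis by (simp add: expansion_op_apply)
qed

lemma linear_left_inverse: "Vector_Spaces.linear scl scl (blinfun_apply left_inverse)"
proof -
  have Ts: "T \<cdot> scl u x = scl u (T \<cdot> x)" for u x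
    using T by (simp add: Vector_Spaces.linear_iff)
  have "defect \<cdot> scl a x = scl a (defect \<cdot> x)" for a x
    by (simp add: defect_def blinfun.diff_left Ts expansion_op_apply expansion_scl scale_right_diff_distrib)
  hence Es: "defect_power k \<cdot> scl a x = scl a (defect_power k \<cdot> x)" for a x k
    by (induction k) (simp_all add: defect_power_0 defect_power_Suc)
  have "left_inverse \<cdot> scl a x = scl a (left_inverse \<cdot> x)" for a x
    using bounded_linear.sums[OF bounded_linear_scl left_inverse_sums[of x], of a] left_inverse_sums[of "scl a x"]
    by (simp add: expansion_scl Es) (metis sums_unique2)
  moreover have "vector_space scl" by unfold_locales
  ultimately show ?thesis by (simp add: Vector_Spaces.linear_iff blinfun.add_right)
qed

text \<open>The series telescopes: applied to \<open>T g\<close> its terms are \<open>D\<^sup>k g - D\<^sup>k\<^sup>+\<^sup>1 g\<close>, where \<open>D\<close> is the defect, and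
  \<open>D\<^sup>k g\<close> tends to \<open>0\<close> for a combination \<open>g\<close>.\<close>

lemma left_inverse_combination:
  assumes g: "combination A g"
  shows "left_inverse \<cdot> (T \<cdot> g) = g"
proof -
  have "expansion (T \<cdot> g) = g - defect \<cdot> g"
    by (simp add: defect_def blinfun.diff_left expansion_op_apply)
  moreover have "defect_power k \<cdot> (defect \<cdot> g) = defect_power (Suc k) \<cdot> g" for k
    by (induction k) (simp_all add: defect_power_0 defect_power_Suc)
  ultimately have "(\<lambda>k. defect_power k \<cdot> g - defect_power (Suc k) \<cdot> g) sums left_inverse \<cdot> (T \<cdot> g)"
    using left_inverse_sums[of "T \<cdot> g"] by (simp add: blinfun.diff_right)
  moreover have "(\<lambda>k. defect_power k \<cdot> g - defect_power (Suc k) \<cdot> g) sums ((defect_power 0) \<cdot> g - 0)"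
  proof (rule telescope_sums')
    show "(\<lambda>k. defect_power k \<cdot> g) \<longlonglongrightarrow> 0"
    proof (rule Lim_null_comparison)
      show "eventually (\<lambda>k. norm (defect_power k \<cdot> g) \<le> \<delta> ^ k * A) sequentially"
        by (intro always_eventually allI norm_combination_le combination_defect_power g)
      show "(\<lambda>k. \<delta> ^ k * A) \<longlonglongrightarrow> 0"
        using tendsto_mult_left_zero[OF LIMSEQ_realpow_zero[of \<delta>], of A] \<delta> by simp
    qed
  qed
  ultimately show ?thesis using sums_unique2 by (fastforce simp: defect_power_0)
qed

lemma idempotent_left_inverse: "left_inverse \<cdot> (T \<cdot> (left_inverse \<cdot> x)) = left_inverse \<cdot> x"
proof -
  have "(\<lambda>k. left_inverse \<cdot> (T \<cdot> (defect_power k \<cdot> expansion x))) sums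
      left_inverse \<cdot> (T \<cdot> (left_inverse \<cdot> x))"
    by (intro bounded_linear.sums[OF blinfun.bounded_linear_right] left_inverse_sums)
  moreover have "left_inverse \<cdot> (T \<cdot> (defect_power k \<cdot> expansion x)) = defect_power k \<cdot> expansion x" for k
    by (rule left_inverse_combination[OF combination_defect_power[OF combination_expansion]])
  ultimately show ?thesis using left_inverse_sums[of x] by (simp add: sums_unique2)
qed

text \<open>The functionals \<open>\<psi> k = \<Sum>n\<ge>k. \<phi> n \<circ> T\<close> are within \<open>\<delta> < 1\<close> of \<open>1\<close> at \<open>f n\<close> for all \<open>n \<ge> k\<close>. If the \<open>f n\<close> lay
  in a weakly compact set, some \<open>g\<close> would satisfy all these inequalities, but \<open>\<psi> k g\<close> tends to \<open>0\<close>.\<close>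

lemma not_weakly_compact:
  assumes P: "\<And>n. P \<cdot> f n = f n"
  shows "P \<notin> weakly_compact_operators scl"
proof
  assume "P \<in> weakly_compact_operators scl"
  hence cpt: "compactin (weak_topology scl)
       (Abstract_Topology.closure_of (weak_topology scl) (blinfun_apply P ` cball 0 1))" (is "compactin _ ?K")
    by (simp add: weakly_compact_operators_def)
  have fK: "f n \<in> ?K" for n
  proof -
    have "f n = P \<cdot> f n" "f n \<in> cball 0 1" using P f by auto
    hence "f n \<in> blinfun_apply P ` cball 0 1" by (rule image_eqI)
    thus ?thesis using closure_of_subset[of "blinfun_apply P ` cball 0 1" "weak_topology scl"] topspace_weak by auto
  qed
  define \<psi> where "\<psi> k g = (\<Sum>n. \<phi> (n + k) (T \<cdot> g))" for k g
  have Ts: "T \<cdot> scl u x = scl u (T \<cdot> x)" for u x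
    using T by (simp add: Vector_Spaces.linear_iff)
  have sn: "summable (\<lambda>n. norm (\<phi> (n + k) (T \<cdot> g)))" for k g
    by (rule summable_ignore_initial_segment[OF coefficients_summable])
  have s: "summable (\<lambda>n. \<phi> (n + k) (T \<cdot> g))" for k g by (rule summable_norm_cancel[OF sn])
  have \<psi>_le: "norm (\<psi> k g) \<le> norm (T \<cdot> g) / c" for k g
  proof -
    have "norm (\<psi> k g) \<le> (\<Sum>n. norm (\<phi> (n + k) (T \<cdot> g)))" unfolding \<psi>_def by (rule summable_norm[OF sn])
    also have "\<dots> \<le> (\<Sum>n. norm (\<phi> n (T \<cdot> g)))"
      using suminf_split_initial_segment[OF coefficients_summable, of "T \<cdot> g" k] by (simp add: sum_nonneg)
    also have "\<dots> \<le> norm (T \<cdot> g) / c" by (rule coefficients_suminf)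
    finally show ?thesis .
  qed
  have \<psi>: "\<psi> k \<in> dual scl" for k
  proof (rule dualI)
    show sc: "\<psi> k (scl a g) = a * \<psi> k g" for a g
      unfolding \<psi>_def Ts dualD(2)[OF \<phi>] by (rule suminf_mult[OF s])
    show "bounded_linear (\<psi> k)"
    proof (rule bounded_linear_intro[where K = "norm T / c"])
      show "\<psi> k (x + y) = \<psi> k x + \<psi> k y" for x y
        unfolding \<psi>_def blinfun.add_right linear_add[OF linear_dual[OF \<phi>]]
        by (rule suminf_add[symmetric, OF s s])
      show "\<psi> k (r *\<^sub>R x) = r *\<^sub>R \<psi> k x" for r x
        using sc[of "of_real r" x] by (simp add: scl_of_real scaleR_conv_of_real)
      show "norm (\<psi> k x) \<le> norm x * (norm T / c)" for x
        using order.trans[OF \<psi>_le divide_right_mono[OF norm_blinfun]] c by (simp add: mult.commute)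
    qed
  qed
  have close: "norm (\<psi> k (f n) - 1) \<le> \<delta>" if kn: "k \<le> n" for k n
  proof -
    let ?t = "\<lambda>j. \<phi> (j + k) (T \<cdot> f n)"
    have s1: "(\<lambda>j. if j = n - k then 1 else 0 :: 'k) sums 1" by (rule sums_single)
    have "\<psi> k (f n) - 1 = (\<Sum>j. ?t j - (if j = n - k then 1 else 0))"
      unfolding \<psi>_def using suminf_diff[OF s sums_summable[OF s1]] sums_unique[OF s1] by simp
    also have "(\<lambda>j. ?t j - (if j = n - k then 1 else 0)) = (\<lambda>j. if j = n - k then 0 else ?t j)"
      using diag[of n] kn by (auto simp: fun_eq_iff)
    finally have e: "\<psi> k (f n) - 1 = (\<Sum>j. if j = n - k then 0 else ?t j)" .
    have bd: "(\<Sum>j<N. norm (if j = n - k then 0 else ?t j)) \<le> \<delta>" for N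
    proof -
      have "(\<Sum>j<N. norm (if j = n - k then 0 else ?t j)) = (\<Sum>j\<in>{..<N} - {n - k}. norm (?t j))"
        by (rule sum.mono_neutral_cong_right) auto
      also have "\<dots> = (\<Sum>j\<in>(\<lambda>j. j + k) ` ({..<N} - {n - k}). norm (\<phi> j (T \<cdot> f n)))"
        by (subst sum.reindex) auto
      also have "\<dots> \<le> \<delta>" by (rule off) (use kn in auto)
      finally show ?thesis .
    qed
    have sm: "summable (\<lambda>j. norm (if j = n - k then 0 else ?t j))"
      by (rule summableI_nonneg_bounded[OF norm_ge_zero bd])
    show ?thesis unfolding e
      by (rule order.trans[OF summable_norm[OF sm] suminf_le_const[OF sm bd]])
  qed
  define D where "D k = {g. norm (\<psi> k g - 1) \<le> \<delta>}" for k
  have closed_D: "closedin (weak_topology scl) (D k)" for k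
  proof -
    have "continuous_map (weak_topology scl) euclideanreal (\<lambda>g. norm (\<psi> k g - 1))"
      by (intro continuous_map_norm continuous_map_diff[OF weak_continuous[OF \<psi>]]) simp
    from closedin_continuous_map_preimage[OF this, of "{..\<delta>}", unfolded topspace_weak]
    show ?thesis by (simp add: D_def)
  qed
  have "?K \<inter> \<Inter>(range D) \<noteq> {}"
  proof (rule cpt[unfolded compactin_fip, THEN conjunct2, THEN spec, THEN mp], intro conjI ballI allI impI)
    fix C assume "C \<in> range D"
    thus "closedin (weak_topology scl) C" using closed_D by blast
  next
    fix F assume F: "finite F \<and> F \<subseteq> range D"
    then obtain J where J: "finite J" "F = D ` J" using finite_subset_image[of F D UNIV] by blast
    obtain n where n: "\<forall>k\<in>J. k \<le> n" using J(1) finite_nat_set_iff_bounded_le by blast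
    have "f n \<in> ?K \<inter> \<Inter>F" using fK[of n] close n by (auto simp: J(2) D_def)
    thus "?K \<inter> \<Inter>F \<noteq> {}" by blast
  qed
  then obtain g where g: "\<And>k. norm (\<psi> k g - 1) \<le> \<delta>" by (auto simp: D_def)
  have "(\<lambda>k. \<psi> k g) \<longlonglongrightarrow> 0" unfolding \<psi>_def
    by (rule suminf_exist_split2) (rule s[of 0, simplified])
  hence "(\<lambda>k. norm (\<psi> k g - 1)) \<longlonglongrightarrow> norm (0 - 1 :: 'k)" by (intro tendsto_intros)
  hence "norm (0 - 1 :: 'k) \<le> \<delta>" by (rule LIMSEQ_le_const2) (use g in auto)
  thus False using \<delta> by simp
qed

lemma idempotent_exists:
  "\<exists>U\<in>carrier (operator_algebra scl). norm U \<le> 1 / (1 - \<delta>) / c \<and>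
    (U o\<^sub>L T) o\<^sub>L (U o\<^sub>L T) = U o\<^sub>L T \<and> U o\<^sub>L T \<notin> weakly_compact_operators scl"
proof (intro bexI[of _ left_inverse] conjI)
  show "left_inverse \<in> carrier (operator_algebra scl)" by (simp add: carrier_operator_algebra linear_left_inverse)
  show "norm left_inverse \<le> 1 / (1 - \<delta>) / c" by (rule norm_left_inverse)
  show "(left_inverse o\<^sub>L T) o\<^sub>L (left_inverse o\<^sub>L T) = left_inverse o\<^sub>L T" by (rule blinfun_eqI) (simp add: idempotent_left_inverse)
  show "left_inverse o\<^sub>L T \<notin> weakly_compact_operators scl"
    by (rule not_weakly_compact) (simp add: left_inverse_combination[OF combination_f])
qed

end

text \<open>The alternative for \<open>u\<close> decides: if the parts of all \<open>|T f|\<close> above one common \<open>u\<close> have norm at most \<open>c\<close>,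
  \<open>T\<close> can be truncated to a weakly compact operator, and otherwise \<open>T\<close> has an almost biorthogonal
  system.\<close>

theorem dichotomy:
  assumes T: "T \<in> carrier (operator_algebra scl)" and c: "0 < c'" "c' < c" and \<delta>: "0 < \<delta>" "\<delta> < 1"
  shows "(\<exists>W\<in>weakly_compact_operators scl. norm (T - W) \<le> c) \<or>
    (\<exists>U\<in>carrier (operator_algebra scl). norm U \<le> 1 / (1 - \<delta>) / c' \<and>
    (U o\<^sub>L T) o\<^sub>L (U o\<^sub>L T) = U o\<^sub>L T \<and> U o\<^sub>L T \<notin> weakly_compact_operators scl)"
proof (cases "\<exists>u\<ge>0. \<forall>f. 0 \<le> f \<longrightarrow> norm f \<le> 1 \<longrightarrow> norm (pos_part (m (T \<cdot> emb f) - u)) \<le> c")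
  case True
  thus ?thesis using weakly_compact_approximation[OF T] by blast
next
  case False
  hence big: "\<exists>f. 0 \<le> f \<and> norm f \<le> 1 \<and> c < norm (pos_part (m (T \<cdot> emb f) - u))" if "0 \<le> u" for u
    using that by (meson not_le)
  have "\<exists>(f :: nat \<Rightarrow> 'e) (\<phi> :: nat \<Rightarrow> 'e \<Rightarrow> 'k).
    (\<forall>n. norm (f n) \<le> 1 \<and> \<phi> n \<in> dual scl \<and> \<phi> n (T \<cdot> f n) = 1) \<and>
    (\<forall>g N. (\<Sum>n<N. norm (\<phi> n g)) \<le> norm g / c') \<and>
    (\<forall>i J. finite J \<longrightarrow> i \<notin> J \<longrightarrow> (\<Sum>j\<in>J. norm (\<phi> j (T \<cdot> f i))) \<le> \<delta>)"
    by (rule almost_biorthogonal_system[OF blinfun.bounded_linear_right _ c \<delta>(1)]) (rule big)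
  then obtain f :: "nat \<Rightarrow> 'e" and \<phi> :: "nat \<Rightarrow> 'e \<Rightarrow> 'k" where
    "(\<forall>n. norm (f n) \<le> 1 \<and> \<phi> n \<in> dual scl \<and> \<phi> n (T \<cdot> f n) = 1) \<and>
    (\<forall>g N. (\<Sum>n<N. norm (\<phi> n g)) \<le> norm g / c') \<and>
    (\<forall>i J. finite J \<longrightarrow> i \<notin> J \<longrightarrow> (\<Sum>j\<in>J. norm (\<phi> j (T \<cdot> f i))) \<le> \<delta>)"
    by (elim exE)
  hence fs: "\<And>n. norm (f n) \<le> 1" "\<And>n. \<phi> n \<in> dual scl" "\<And>n. \<phi> n (T \<cdot> f n) = 1"
    "\<And>g N. (\<Sum>n<N. norm (\<phi> n g)) \<le> norm g / c'"
    "\<And>i J. finite J \<Longrightarrow> i \<notin> J \<Longrightarrow> (\<Sum>j\<in>J. norm (\<phi> j (T \<cdot> f i))) \<le> \<delta>"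
    by simp_all
  have "Vector_Spaces.linear scl scl (blinfun_apply T)" using T by (simp add: carrier_operator_algebra)
  from idempotent_exists[OF this fs c(1) \<delta>] show ?thesis ..
qed

end

lemma weak_calkin_algebra_simps:
  "carrier (weak_calkin_algebra s) = carrier (operator_algebra s Quot weakly_compact_operators s)"
  "mult (weak_calkin_algebra s) = mult (operator_algebra s Quot weakly_compact_operators s)"
  "zero (weak_calkin_algebra s) = zero (operator_algebra s Quot weakly_compact_operators s)"
  by (simp_all add: weak_calkin_algebra_def Let_def ring.defs module.defs)

context al_scalars
begin

section \<open>The ideal of weakly compact operators\<close>

text \<open>The closure in the definition may be replaced by any weakly compact superset, the weak topology being
  Hausdorff.\<close>

lemma weakly_compact_operators_iff:
  "T \<in> weakly_compact_operators scl \<longleftrightarrow> Vector_Spaces.linear scl scl (blinfun_apply T) \<and>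
    (\<exists>K. compactin (weak_topology scl) K \<and> blinfun_apply T ` cball 0 1 \<subseteq> K)"
proof (intro iffI conjI; (elim conjE exE)?)
  assume "T \<in> weakly_compact_operators scl"
  thus "Vector_Spaces.linear scl scl (blinfun_apply T)" "\<exists>K. compactin (weak_topology scl) K \<and> blinfun_apply T ` cball 0 1 \<subseteq> K"
    using closure_of_subset[of "blinfun_apply T ` cball 0 1" "weak_topology scl"]
    by (auto simp: weakly_compact_operators_def carrier_operator_algebra topspace_weak)
next
  fix K assume T: "Vector_Spaces.linear scl scl (blinfun_apply T)"
    and K: "compactin (weak_topology scl) K" "blinfun_apply T ` cball 0 1 \<subseteq> K"
  have "Abstract_Topology.closure_of (weak_topology scl) (blinfun_apply T ` cball 0 1) \<subseteq> K"
    by (rule closure_of_minimal[OF K(2) compactin_imp_closedin[OF Hausdorff_weak K(1)]])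
  hence "compactin (weak_topology scl) (Abstract_Topology.closure_of (weak_topology scl) (blinfun_apply T ` cball 0 1))"
    by (rule closed_compactin[OF K(1)]) simp
  thus "T \<in> weakly_compact_operators scl"
    using T by (simp add: weakly_compact_operators_def carrier_operator_algebra)
qed

lemma linear_scl_iff: "Vector_Spaces.linear scl scl f \<longleftrightarrow>
    (\<forall>x y. f (x + y) = f x + f y) \<and> (\<forall>c x. f (scl c x) = scl c (f x))"
  using vector_space_axioms by (simp add: Vector_Spaces.linear_iff)

lemma weak_continuous_operator:
  assumes "Vector_Spaces.linear scl scl (blinfun_apply T)"
  shows "continuous_map (weak_topology scl) (weak_topology scl) (blinfun_apply T)"
proof (rule continuous_map_weakI[OF weak_continuous])
  fix f assume f: "f \<in> dual scl"
  show "(\<lambda>x. f (T \<cdot> x)) \<in> dual scl"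
    using assms by (intro dualI bounded_linear_compose[OF dualD(1)[OF f]] blinfun.bounded_linear_right)
      (simp add: linear_scl_iff dualD(2)[OF f])
qed

lemma ring_operator_algebra: "ring (operator_algebra scl)"
proof (rule ringI)
  show "abelian_group (operator_algebra scl)"
  proof (rule abelian_groupI)
    fix T assume "T \<in> carrier (operator_algebra scl)"
    hence "- T \<in> carrier (operator_algebra scl)" "- T \<oplus>\<^bsub>operator_algebra scl\<^esub> T = \<zero>\<^bsub>operator_algebra scl\<^esub>"
      by (auto simp: operator_algebra_def linear_scl_iff blinfun.minus_left)
    thus "\<exists>U\<in>carrier (operator_algebra scl). U \<oplus>\<^bsub>operator_algebra scl\<^esub> T = \<zero>\<^bsub>operator_algebra scl\<^esub>" by blast
  qed (auto simp: operator_algebra_def linear_scl_iff blinfun.add_left scale_right_distrib algebra_simps)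
  show "monoid (operator_algebra scl)"
    by (rule monoidI) (auto simp: operator_algebra_def linear_scl_iff intro!: blinfun_eqI)
qed (auto simp: operator_algebra_def intro!: blinfun_eqI simp: blinfun.add_left blinfun.add_right)

lemma weakly_compact_add:
  assumes "T \<in> weakly_compact_operators scl" "U \<in> weakly_compact_operators scl"
  shows "T + U \<in> weakly_compact_operators scl"
proof -
  let ?w = "weak_topology scl"
  obtain K L where K: "compactin ?w K" "blinfun_apply T ` cball 0 1 \<subseteq> K"
    and L: "compactin ?w L" "blinfun_apply U ` cball 0 1 \<subseteq> L"
    using assms by (auto simp: weakly_compact_operators_iff)
  have "continuous_map (prod_topology ?w ?w) ?w (\<lambda>p. fst p + snd p)"
  proof (rule continuous_map_weakI)
    fix f assume f: "f \<in> dual scl"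
    have "continuous_map (prod_topology ?w ?w) euclidean (\<lambda>p. f (fst p))"
      "continuous_map (prod_topology ?w ?w) euclidean (\<lambda>p. f (snd p))"
      using continuous_map_compose[OF continuous_map_fst weak_continuous[OF f]]
        continuous_map_compose[OF continuous_map_snd weak_continuous[OF f]] by (simp_all add: o_def)
    thus "continuous_map (prod_topology ?w ?w) euclidean (\<lambda>p. f (fst p + snd p))"
      unfolding linear_add[OF linear_dual[OF f]] by (rule continuous_map_add)
  qed
  hence "compactin ?w ((\<lambda>p. fst p + snd p) ` (K \<times> L))"
    by (rule image_compactin[rotated]) (simp add: compactin_Times K L)
  moreover have "blinfun_apply (T + U) ` cball 0 1 \<subseteq> (\<lambda>p. fst p + snd p) ` (K \<times> L)"
  proof safe
    fix x :: 'e assume "x \<in> cball 0 1"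
    hence "(T \<cdot> x, U \<cdot> x) \<in> K \<times> L" using K(2) L(2) by blast
    thus "(T + U) \<cdot> x \<in> (\<lambda>p. fst p + snd p) ` (K \<times> L)"
      by (rule rev_image_eqI) (simp add: blinfun.add_left)
  qed
  moreover have "Vector_Spaces.linear scl scl (blinfun_apply (T + U))"
    using assms by (simp add: weakly_compact_operators_iff linear_scl_iff blinfun.add_left scale_right_distrib)
  ultimately show ?thesis unfolding weakly_compact_operators_iff by blast
qed

lemma weakly_compact_compose:
  assumes T: "T \<in> weakly_compact_operators scl" and U: "Vector_Spaces.linear scl scl (blinfun_apply U)"
  shows "U o\<^sub>L T \<in> weakly_compact_operators scl" "T o\<^sub>L U \<in> weakly_compact_operators scl"
proof -
  let ?w = "weak_topology scl"
  obtain K where K: "compactin ?w K" "blinfun_apply T ` cball 0 1 \<subseteq> K"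
    using T by (auto simp: weakly_compact_operators_iff)
  have lin: "Vector_Spaces.linear scl scl (blinfun_apply (U o\<^sub>L T))" "Vector_Spaces.linear scl scl (blinfun_apply (T o\<^sub>L U))"
    using T U by (auto simp: weakly_compact_operators_iff linear_scl_iff)
  have "compactin ?w (blinfun_apply U ` K)" by (rule image_compactin[OF K(1) weak_continuous_operator[OF U]])
  moreover have "blinfun_apply (U o\<^sub>L T) ` cball 0 1 \<subseteq> blinfun_apply U ` K" using K(2) by auto
  ultimately show "U o\<^sub>L T \<in> weakly_compact_operators scl" unfolding weakly_compact_operators_iff using lin by blast
  define r where "r = norm U + 1"
  have r: "0 < r" unfolding r_def by (rule add_nonneg_pos) auto
  have "blinfun_apply (r *\<^sub>R id_blinfun :: 'e \<Rightarrow>\<^sub>L 'e) = (\<lambda>x. r *\<^sub>R x)" by (auto simp: blinfun.scaleR_left)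
  moreover have "Vector_Spaces.linear scl scl (\<lambda>x. r *\<^sub>R x)"
    by (simp add: linear_scl_iff scaleR_right_distrib scl_scaleR)
  ultimately have "continuous_map ?w ?w (\<lambda>x. r *\<^sub>R x)" using weak_continuous_operator by metis
  hence "compactin ?w ((\<lambda>x. r *\<^sub>R x) ` K)" by (rule image_compactin[OF K(1)])
  moreover have "blinfun_apply (T o\<^sub>L U) ` cball 0 1 \<subseteq> (\<lambda>x. r *\<^sub>R x) ` K"
  proof safe
    fix x :: 'e assume "x \<in> cball 0 1"
    hence x: "norm x \<le> 1" by simp
    have "norm (U \<cdot> x) \<le> norm U * 1" by (rule order.trans[OF norm_blinfun mult_left_mono[OF x]]) simp
    hence "norm (inverse r *\<^sub>R U \<cdot> x) \<le> 1" using r by (simp add: r_def field_simps)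
    hence "T \<cdot> (inverse r *\<^sub>R U \<cdot> x) \<in> K" using K(2) by auto
    thus "(T o\<^sub>L U) \<cdot> x \<in> (\<lambda>x. r *\<^sub>R x) ` K"
      by (rule rev_image_eqI) (use r in \<open>simp add: blinfun.scaleR_right\<close>)
  qed
  ultimately show "T o\<^sub>L U \<in> weakly_compact_operators scl" unfolding weakly_compact_operators_iff using lin by blast
qed

lemma zero_weakly_compact: "0 \<in> weakly_compact_operators scl"
proof -
  have "compactin (weak_topology scl) {0}" by (simp add: topspace_weak)
  moreover have "blinfun_apply (0 :: 'e \<Rightarrow>\<^sub>L 'e) ` cball 0 1 \<subseteq> {0}" by auto
  moreover have "Vector_Spaces.linear scl scl (blinfun_apply (0 :: 'e \<Rightarrow>\<^sub>L 'e))" by (simp add: linear_scl_iff)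
  ultimately show ?thesis unfolding weakly_compact_operators_iff by blast
qed

lemma ideal_weakly_compact_operators: "ideal (weakly_compact_operators scl) (operator_algebra scl)"
proof (rule idealI[OF ring_operator_algebra])
  interpret ring "operator_algebra scl" by (rule ring_operator_algebra)
  have sub: "weakly_compact_operators scl \<subseteq> carrier (operator_algebra scl)"
    by (auto simp: weakly_compact_operators_def)
  show "subgroup (weakly_compact_operators scl) (add_monoid (operator_algebra scl))"
  proof (rule add.subgroupI[OF sub])
    show "weakly_compact_operators scl \<noteq> {}" using zero_weakly_compact by blast
    fix T assume T: "T \<in> weakly_compact_operators scl"
    have "- T \<in> weakly_compact_operators scl" by (rule uminus_weakly_compact_operators[OF T])
    moreover from this have "\<ominus>\<^bsub>operator_algebra scl\<^esub> T = - T"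
      using sub T by (intro minus_equality) (auto simp: operator_algebra_def)
    ultimately show "\<ominus>\<^bsub>operator_algebra scl\<^esub> T \<in> weakly_compact_operators scl" by simp
    fix U assume "U \<in> weakly_compact_operators scl"
    thus "T \<oplus>\<^bsub>operator_algebra scl\<^esub> U \<in> weakly_compact_operators scl"
      using weakly_compact_add[OF T] by (simp add: operator_algebra_def)
  qed
qed (auto simp: operator_algebra_def weakly_compact_compose)

section \<open>Bonsall's minimality property\<close>

text \<open>If \<open>N X\<close> were smaller than the weak essential norm, choose \<open>c' < c\<close> strictly between the two and \<open>\<delta>\<close> so
  small that \<open>(1 - \<delta>) c'\<close> still exceeds \<open>N X\<close>. The idempotent of the dichotomy then gives
  \<open>1 \<le> N X / ((1 - \<delta>) c')\<close>, a contradiction.\<close>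

theorem bonsall_minimal_weak_essential_norm:
  "bonsall_minimal (weak_calkin_algebra scl) weak_essential_norm"
  unfolding bonsall_minimal_def
proof (intro allI impI ballI, elim conjE)
  let ?A = "weak_calkin_algebra scl" and ?B = "operator_algebra scl" and ?W = "weakly_compact_operators scl"
  interpret ideal ?W ?B by (rule ideal_weakly_compact_operators)
  fix N X
  assume N: "algebra_norm ?A N" and le: "\<forall>x\<in>carrier ?A. N x \<le> weak_essential_norm x" and X: "X \<in> carrier ?A"
  have coset: "?W +>\<^bsub>?B\<^esub> R \<in> carrier ?A" if "R \<in> carrier ?B" for R
    using that by (auto simp: weak_calkin_algebra_simps FactRing_def A_RCOSETS_def')
  have mult: "(?W +>\<^bsub>?B\<^esub> R) \<otimes>\<^bsub>?A\<^esub> (?W +>\<^bsub>?B\<^esub> R') = ?W +>\<^bsub>?B\<^esub> (R o\<^sub>L R')" if "R \<in> carrier ?B" "R' \<in> carrier ?B" for R R'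
    using rcoset_mult_add[OF that] by (simp add: weak_calkin_algebra_simps FactRing_def) (simp add: operator_algebra_def)
  obtain T where T: "T \<in> carrier ?B" "X = ?W +>\<^bsub>?B\<^esub> T"
    using X by (auto simp: weak_calkin_algebra_simps FactRing_def A_RCOSETS_def')
  have norm_le: "weak_essential_norm (?W +>\<^bsub>?B\<^esub> R) \<le> norm (R - V)" if "V \<in> ?W" for R V
    unfolding weak_essential_norm_coset by (rule cINF_lower[OF bdd_belowI2[of _ 0] that]) simp
  have nonneg: "0 \<le> N x" and zero: "N x = 0 \<Longrightarrow> x = \<zero>\<^bsub>?A\<^esub>" if "x \<in> carrier ?A" for x
    using N that by (auto simp: algebra_norm_def)
  have submult: "N (x \<otimes>\<^bsub>?A\<^esub> y) \<le> N x * N y" if "x \<in> carrier ?A" "y \<in> carrier ?A" for x y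
    using N that by (auto simp: algebra_norm_def)
  have "weak_essential_norm X \<le> N X"
  proof (rule ccontr)
    assume "\<not> ?thesis"
    hence lt: "N X < weak_essential_norm X" by simp
    define c' where "c' = (N X + weak_essential_norm X) / 2"
    define c where "c = (c' + weak_essential_norm X) / 2"
    define \<delta> where "\<delta> = (c' - N X) / (2 * c')"
    have c: "N X < c'" "0 < c'" "c' < c" "c < weak_essential_norm X"
      using lt nonneg[OF X] by (auto simp: c'_def c_def)
    have \<delta>: "0 < \<delta>" "\<delta> < 1" "(1 - \<delta>) * c' = (c' + N X) / 2"
      using c(1,2) nonneg[OF X] by (auto simp: \<delta>_def field_simps)
    have "\<not> (\<exists>V\<in>?W. norm (T - V) \<le> c)"
      using norm_le[of _ T] c(4) unfolding T(2) by (meson not_le order.trans)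
    then obtain U where U: "U \<in> carrier ?B" "norm U \<le> 1 / (1 - \<delta>) / c'"
      "(U o\<^sub>L T) o\<^sub>L (U o\<^sub>L T) = U o\<^sub>L T" "U o\<^sub>L T \<notin> ?W"
      using dichotomy[OF T(1) c(2,3) \<delta>(1,2)] by blast
    let ?P = "U o\<^sub>L T"
    have P: "?P \<in> carrier ?B" using U(1) T(1) by (simp add: carrier_operator_algebra linear_scl_iff)
    have "?W +>\<^bsub>?B\<^esub> ?P \<noteq> \<zero>\<^bsub>?A\<^esub>"
    proof
      assume "?W +>\<^bsub>?B\<^esub> ?P = \<zero>\<^bsub>?A\<^esub>"
      hence "?W +>\<^bsub>?B\<^esub> ?P = ?W" by (simp add: weak_calkin_algebra_simps FactRing_def)
      thus False using a_rcos_self[OF P] U(4) by simp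
    qed
    hence pos: "0 < N (?W +>\<^bsub>?B\<^esub> ?P)" using nonneg[OF coset[OF P]] zero[OF coset[OF P]] by (metis order_le_less)
    have "N (?W +>\<^bsub>?B\<^esub> ?P) \<le> N (?W +>\<^bsub>?B\<^esub> ?P) * N (?W +>\<^bsub>?B\<^esub> ?P)"
      using submult[OF coset[OF P] coset[OF P]] by (simp add: mult[OF P P] U(3))
    hence "1 \<le> N (?W +>\<^bsub>?B\<^esub> ?P)" using pos by simp
    also have "\<dots> \<le> N (?W +>\<^bsub>?B\<^esub> U) * N X"
      using submult[OF coset[OF U(1)] X] by (simp add: T(2) mult[OF U(1) T(1)])
    also have "\<dots> \<le> norm U * N X"
    proof (rule mult_right_mono[OF _ nonneg[OF X]])
      have "N (?W +>\<^bsub>?B\<^esub> U) \<le> weak_essential_norm (?W +>\<^bsub>?B\<^esub> U)" using le coset[OF U(1)] by blast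
      also have "\<dots> \<le> norm U" using norm_le[OF zero_weakly_compact, of U] by simp
      finally show "N (?W +>\<^bsub>?B\<^esub> U) \<le> norm U" .
    qed
    also have "\<dots> \<le> 1 / (1 - \<delta>) / c' * N X" by (rule mult_right_mono[OF U(2) nonneg[OF X]])
    also have "\<dots> = N X / ((1 - \<delta>) * c')" by simp
    finally have "1 \<le> N X / ((1 - \<delta>) * c')" .
    moreover have "0 < (1 - \<delta>) * c'" using \<delta>(2) c(2) by simp
    ultimately have "(1 - \<delta>) * c' \<le> N X" by (simp only: pos_le_divide_eq mult_1)
    thus False using \<delta>(3) c(1) by simp
  qed
  thus "N X = weak_essential_norm X" using le X by (simp add: order.antisym)
qed

end

section \<open>Polar approximations in the real and in the complex space\<close>

text \<open>In the real case the sign of \<open>z\<close> takes the values \<open>1\<close> on the band of \<open>z\<^sup>+\<close> and \<open>- 1\<close> on its complement, and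
  the polar decomposition is exact.\<close>

lemma al_scalars_real:
  "al_scalars (scaleR :: real \<Rightarrow> 'a::al_space \<Rightarrow> 'a) abs (\<lambda>x. x) (\<lambda>x. x) (\<lambda>_. 0) 0"
proof (intro al_scalars.intro al_scalars_axioms.intro)
  show "vector_space (scaleR :: real \<Rightarrow> 'a \<Rightarrow> 'a)" by (rule real_vector.vector_space_axioms)
  show "\<bar>c *\<^sub>R z\<bar> \<le> norm c *\<^sub>R \<bar>z\<bar>" for c :: real and z :: 'a by (simp add: abs_scaleR_banach_lattice)
  show "norm (of_real (\<psi> \<cdot> z) + 0 * of_real (\<psi> \<cdot> 0) :: real) \<le> \<psi> \<cdot> \<bar>z\<bar>"
    if pos: "\<And>x. 0 \<le> x \<Longrightarrow> 0 \<le> \<psi> \<cdot> x" for \<psi> and z :: 'a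
  proof -
    have "0 \<le> \<psi> \<cdot> (\<bar>z\<bar> - z)" "0 \<le> \<psi> \<cdot> (\<bar>z\<bar> - (- z))"
      by (rule pos, simp add: abs_ge_self, rule pos, simp only: diff_ge_0_iff_ge abs_ge_minus_self)
    thus ?thesis by (simp add: blinfun.diff_right blinfun.add_right abs_le_iff)
  qed
  show "\<exists>ps :: (('a \<Rightarrow>\<^sub>L 'a) \<times> real) list. resolution (map fst ps) \<and> (\<forall>p\<in>set ps. norm (snd p) = 1) \<and>
      (\<Sum>p\<leftarrow>ps. norm (fst p \<cdot> z + 0 *\<^sub>R (fst p) \<cdot> 0 - snd p *\<^sub>R (fst p) \<cdot> \<bar>z\<bar>)) \<le> \<epsilon>"
    if "0 < \<epsilon>" for \<epsilon> and z :: 'a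
  proof -
    let ?P = "band_proj (pos_part z)"
    let ?ps = "[(?P, 1), (id_blinfun - ?P, - 1 :: real)]"
    have res: "resolution (map fst ?ps)" using resolution_split_at[of z] by (simp add: split_at_def)
    have 1: "?P \<cdot> \<bar>z\<bar> = ?P \<cdot> z"
      using resolution_abs[OF res, of ?P z] by (simp add: band_proj_pos_part)
    have z2: "(id_blinfun - ?P) \<cdot> z = - pos_part (- z)"
      by (simp add: blinfun.diff_left band_proj_pos_part pos_part_uminus)
    have 2: "(id_blinfun - ?P) \<cdot> \<bar>z\<bar> = - (id_blinfun - ?P) \<cdot> z"
      using resolution_abs[OF res, of "id_blinfun - ?P" z] unfolding z2 by simp
    show ?thesis
      by (intro exI[of _ ?ps] conjI res) (use that in \<open>simp_all add: 1 2 del: blinfun.diff_left\<close>)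
  qed
qed (auto intro: linearI exI[of _ "_ :: real"] simp: abs_triangle_ineq)

lemma exists_maximum_of_comparable:
  fixes g :: "'b \<Rightarrow> 'a::order"
  assumes "finite C" "C \<noteq> {}" and comp: "\<And>c d. c \<in> C \<Longrightarrow> d \<in> C \<Longrightarrow> g c \<le> g d \<or> g d \<le> g c"
  shows "\<exists>c\<in>C. \<forall>d\<in>C. g d \<le> g c"
proof -
  have "finite (g ` C)" "g ` C \<noteq> {}" using assms by auto
  from finite_has_maximal[OF this] obtain y where "y \<in> g ` C" "\<forall>b\<in>g ` C. y \<le> b \<longrightarrow> y = b" by blast
  thus ?thesis using comp by (metis imageE imageI)
qed

text \<open>The phase is rounded to a root of unity. For an \<open>N\<close>-th root of unity \<open>c\<close>, let \<open>r c\<close> and \<open>s c\<close> be the real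
  and imaginary parts of \<open>z\<close> divided by \<open>c\<close>. A suitable resolution splits \<open>z\<close> into pieces on each of which
  one \<open>r c\<close> dominates all the others. Comparing it with the two neighbouring roots
  gives \<open>|s c| \<le> tan (\<pi> / N) r c\<close> there, so \<open>z\<close> is close to \<open>c |z|\<close> on this piece.\<close>

lemma polar_complexification:
  fixes z :: "'a::al_space complexification"
  assumes \<epsilon>: "0 < \<epsilon>"
  shows "\<exists>ps :: (('a \<Rightarrow>\<^sub>L 'a) \<times> complex) list. resolution (map fst ps) \<and> (\<forall>p\<in>set ps. norm (snd p) = 1) \<and>
      (\<Sum>p\<leftarrow>ps. norm (Complexification (fst p \<cdot> re_part z) (fst p \<cdot> im_part z)
        - scaleC (snd p) (Complexification (fst p \<cdot> modulus z) 0))) \<le> \<epsilon>"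
proof -
  let ?M = "modulus z" and ?x = "re_part z" and ?y = "im_part z"
  have "(\<lambda>n. pi / real n) \<longlonglongrightarrow> 0" by (rule lim_const_over_n)
  hence "(\<lambda>n. tan (pi / real n)) \<longlonglongrightarrow> tan 0" by (intro isCont_tendsto_compose[OF isCont_tan]) auto
  hence "(\<lambda>n. 2 * tan (pi / real n) * norm ?M) \<longlonglongrightarrow> 2 * tan 0 * norm ?M" by (intro tendsto_intros)
  moreover have "2 * tan 0 * norm ?M < \<epsilon>" using \<epsilon> by simp
  ultimately have "eventually (\<lambda>n. 2 * tan (pi / real n) * norm ?M < \<epsilon>) sequentially" by (rule order_tendstoD)
  with eventually_ge_at_top[of "3 :: nat"] have "eventually (\<lambda>n. 3 \<le> n \<and> 2 * tan (pi / real n) * norm ?M < \<epsilon>) sequentially"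
    by eventually_elim simp
  then obtain N :: nat where N: "3 \<le> N" "2 * tan (pi / real N) * norm ?M < \<epsilon>"
    using eventually_happens'[OF sequentially_bot] by blast
  define t where "t = pi / real N"
  have t: "0 < t" "t < pi / 2" using N(1) by (auto simp: t_def field_simps)
  have sc: "0 < sin t" "0 < cos t" using t by (auto intro: sin_gt_zero cos_gt_zero)
  define \<omega> where "\<omega> = cis (2 * t)"
  define C where "C = {c :: complex. c ^ N = 1}"
  have "\<omega> ^ N = cis (real N * (2 * t))" unfolding \<omega>_def by (rule Complex.DeMoivre)
  also have "real N * (2 * t) = 2 * pi" using N(1) by (simp add: t_def)
  finally have \<omega>N: "\<omega> ^ N = 1" by simp
  have finC: "finite C" unfolding C_def using N(1) by (intro finite_roots_unity) simp
  have "1 \<in> C" by (simp add: C_def)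
  hence neC: "C \<noteq> {}" by blast
  have normC: "cmod c = 1" if "c \<in> C" for c
  proof -
    have "cmod c ^ N = 1" using that by (simp add: C_def norm_power[symmetric])
    hence "cmod c ^ N = 1 ^ N" by simp
    thus ?thesis by (rule power_eq_imp_eq_base) (use N(1) in auto)
  qed
  have mulC: "c * \<omega> \<in> C" "c * cnj \<omega> \<in> C" if "c \<in> C" for c
  proof -
    have "cnj \<omega> ^ N = 1" using \<omega>N by (metis complex_cnj_one complex_cnj_power)
    thus "c * \<omega> \<in> C" "c * cnj \<omega> \<in> C" using that \<omega>N by (auto simp: C_def power_mult_distrib)
  qed
  define r where "r c = Re c *\<^sub>R ?x + Im c *\<^sub>R ?y" for c
  define s where "s c = Re c *\<^sub>R ?y - Im c *\<^sub>R ?x" for c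
  \<comment> \<open>Multiplication by the generator and by its inverse leads to the neighbouring roots.\<close>
  have rot: "r (c * \<omega>) = cos (2 * t) *\<^sub>R r c + sin (2 * t) *\<^sub>R s c"
    "r (c * cnj \<omega>) = cos (2 * t) *\<^sub>R r c - sin (2 * t) *\<^sub>R s c" for c
    by (simp_all add: r_def s_def \<omega>_def algebra_simps)
  have rs: "scaleC (cnj c) z = Complexification (r c) (s c)" for c
    by (simp add: scaleC_def r_def s_def)
  interpret vector_space "scaleC :: complex \<Rightarrow> 'a complexification \<Rightarrow> _" by (rule vector_space_scaleC)
  have r_le: "r c \<le> ?M" and M_le: "?M \<le> \<bar>r c\<bar> + \<bar>s c\<bar>" if c: "c \<in> C" for c
  proof -
    have "r c \<le> modulus (scaleC (cnj c) z)"
      using order.trans[OF abs_ge_self abs_re_part_le_modulus[of "scaleC (cnj c) z"]] by (simp add: rs)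
    also have "\<dots> \<le> cmod (cnj c) *\<^sub>R ?M" by (rule modulus_scaleC_le)
    finally show "r c \<le> ?M" using normC[OF c] by simp
    have "c * cnj c = 1" using normC[OF c] by (simp add: complex_norm_square[symmetric])
    hence "?M = modulus (scaleC c (scaleC (cnj c) z))" by simp
    also have "\<dots> \<le> cmod c *\<^sub>R modulus (scaleC (cnj c) z)" by (rule modulus_scaleC_le)
    also have "\<dots> = modulus (scaleC (cnj c) z)" using normC[OF c] by simp
    also have "\<dots> \<le> \<bar>r c\<bar> + \<bar>s c\<bar>" using modulus_le_add[of "scaleC (cnj c) z"] by (simp add: rs)
    finally show "?M \<le> \<bar>r c\<bar> + \<bar>s c\<bar>" .
  qed
  have "finite ((\<lambda>(c, d). r c - r d) ` (C \<times> C))" using finC by simp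
  from signed_resolution_exists[OF this] obtain Qs where Qs: "resolution Qs"
    and sgn: "\<forall>Q\<in>set Qs. \<forall>y\<in>(\<lambda>(c, d). r c - r d) ` (C \<times> C). 0 \<le> Q \<cdot> y \<or> Q \<cdot> y \<le> 0"
    by blast
  have "\<forall>Q\<in>set Qs. \<exists>c\<in>C. \<forall>d\<in>C. Q \<cdot> r d \<le> Q \<cdot> r c"
  proof
    fix Q assume Q: "Q \<in> set Qs"
    show "\<exists>c\<in>C. \<forall>d\<in>C. Q \<cdot> r d \<le> Q \<cdot> r c"
    proof (rule exists_maximum_of_comparable[OF finC neC])
      fix c d assume "c \<in> C" "d \<in> C"
      hence "0 \<le> Q \<cdot> (r c - r d) \<or> Q \<cdot> (r c - r d) \<le> 0" using sgn Q by force
      thus "Q \<cdot> r c \<le> Q \<cdot> r d \<or> Q \<cdot> r d \<le> Q \<cdot> r c"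
        by (auto simp: blinfun.diff_right)
    qed
  qed
  then obtain \<gamma> where \<gamma>: "\<And>Q. Q \<in> set Qs \<Longrightarrow> \<gamma> Q \<in> C"
    "\<And>Q d. Q \<in> set Qs \<Longrightarrow> d \<in> C \<Longrightarrow> Q \<cdot> r d \<le> Q \<cdot> r (\<gamma> Q)" by metis
  have err: "norm (Complexification (Q \<cdot> ?x) (Q \<cdot> ?y)
        - scaleC (\<gamma> Q) (Complexification (Q \<cdot> ?M) 0)) \<le> 2 * tan t * norm (Q \<cdot> ?M)"
    if Q: "Q \<in> set Qs" for Q
  proof -
    define c where "c = \<gamma> Q"
    have c: "c \<in> C" using \<gamma>(1)[OF Q] by (simp add: c_def)
    have pos: "positive_op Q" using Qs Q by (simp add: resolution_def)
    let ?R = "Q \<cdot> r c" and ?S = "Q \<cdot> s c" and ?QM = "Q \<cdot> ?M"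
    have "cos (2 * t) *\<^sub>R ?R + sin (2 * t) *\<^sub>R ?S \<le> ?R" "cos (2 * t) *\<^sub>R ?R - sin (2 * t) *\<^sub>R ?S \<le> ?R"
      using \<gamma>(2)[OF Q mulC(1)[OF c]] \<gamma>(2)[OF Q mulC(2)[OF c]]
      by (simp_all add: rot c_def[symmetric] blinfun.add_right blinfun.diff_right blinfun.scaleR_right)
    hence "sin (2 * t) *\<^sub>R ?S \<le> (1 - cos (2 * t)) *\<^sub>R ?R" "sin (2 * t) *\<^sub>R (- ?S) \<le> (1 - cos (2 * t)) *\<^sub>R ?R"
      by (simp_all add: scaleR_left_diff_distrib algebra_simps)
    moreover have "1 - cos (2 * t) = 2 * sin t * sin t" "sin (2 * t) = 2 * sin t * cos t"
      by (simp_all add: cos_double_sin sin_double power2_eq_square)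
    ultimately have st: "(2 * sin t * cos t) *\<^sub>R ?S \<le> (2 * sin t * sin t) *\<^sub>R ?R"
      "(2 * sin t * cos t) *\<^sub>R (- ?S) \<le> (2 * sin t * sin t) *\<^sub>R ?R" by simp_all
    have div: "w \<le> tan t *\<^sub>R v" if "(2 * sin t * cos t) *\<^sub>R w \<le> (2 * sin t * sin t) *\<^sub>R v" for v w :: 'a
    proof -
      let ?p = "2 * sin t * cos t"
      have p: "inverse ?p * ?p = 1" "inverse ?p * (2 * sin t * sin t) = tan t"
        using sc by (simp_all add: tan_def field_simps)
      have "inverse ?p *\<^sub>R ?p *\<^sub>R w \<le> inverse ?p *\<^sub>R (2 * sin t * sin t) *\<^sub>R v"
        using sc by (intro scaleR_left_mono[OF that]) simp
      thus ?thesis unfolding scaleR_scaleR p scaleR_one .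
    qed
    have S: "\<bar>?S\<bar> \<le> tan t *\<^sub>R ?R" using div[OF st(1)] div[OF st(2)] by (rule abs_leI)
    have tan: "0 < tan t" using sc by (simp add: tan_def)
    have R0: "0 \<le> ?R"
    proof -
      have "0 \<le> tan t *\<^sub>R ?R" using order.trans[OF abs_ge_zero S] .
      from scaleR_left_mono[OF this, of "inverse (tan t)"] tan show ?thesis by simp
    qed
    have R_le: "?R \<le> ?QM" by (rule positive_op_mono[OF pos r_le[OF c]])
    have "?QM \<le> Q \<cdot> (\<bar>r c\<bar> + \<bar>s c\<bar>)" by (rule positive_op_mono[OF pos M_le[OF c]])
    also have "\<dots> = ?R + \<bar>?S\<bar>"
      using R0 by (simp add: blinfun.add_right resolution_abs[OF Qs Q, symmetric])
    finally have QM_le: "?QM - ?R \<le> \<bar>?S\<bar>" by (simp add: diff_le_eq add.commute)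
    have "\<bar>?S\<bar> \<le> tan t *\<^sub>R ?QM" using order.trans[OF S scaleR_left_mono[OF R_le]] tan by simp
    from norm_mono_nonneg[OF abs_ge_zero this] have nS: "norm ?S \<le> tan t * norm ?QM" using tan by simp
    have "norm (?QM - ?R) \<le> norm ?S"
      using norm_mono_nonneg[OF _ QM_le] R_le by simp
    hence nd: "norm (?R - ?QM) \<le> tan t * norm ?QM" using nS by (simp add: norm_minus_commute)
    have cc: "Re c * Re c + Im c * Im c = 1"
      using normC[OF c] cmod_power2[of c] by (simp add: power2_eq_square)
    have "Complexification (Q \<cdot> ?x) (Q \<cdot> ?y) = scaleC c (Complexification ?R ?S)"
    proof -
      have "v = (Re c * Re c + Im c * Im c) *\<^sub>R v" for v :: 'a using cc by simp
      from this[of "Q \<cdot> ?x"] this[of "Q \<cdot> ?y"] show ?thesis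
        by (simp add: scaleC_def r_def s_def blinfun.add_right blinfun.diff_right blinfun.scaleR_right
            scaleR_left_distrib scaleR_right_distrib scaleR_right_diff_distrib mult.commute)
    qed
    hence "Complexification (Q \<cdot> ?x) (Q \<cdot> ?y) - scaleC c (Complexification ?QM 0)
        = scaleC c (Complexification ?R ?S - Complexification ?QM 0)"
      by (simp only: scale_right_diff_distrib)
    also have "Complexification ?R ?S - Complexification ?QM 0 = Complexification (?R - ?QM) ?S"
      by (simp add: minus_complexification_def)
    finally have "norm (Complexification (Q \<cdot> ?x) (Q \<cdot> ?y) - scaleC c (Complexification ?QM 0))
        = norm (scaleC c (Complexification (?R - ?QM) ?S))" by simp
    also have "\<dots> \<le> norm (?R - ?QM) + norm ?S"
      using norm_complexification_le[of "Complexification (?R - ?QM) ?S"] normC[OF c] by (simp add: norm_scaleC)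
    finally show ?thesis using nd nS unfolding c_def by linarith
  qed
  let ?ps = "map (\<lambda>Q. (Q, \<gamma> Q)) Qs"
  show ?thesis
  proof (intro exI[of _ ?ps] conjI)
    show "resolution (map fst ?ps)" using Qs by (simp add: o_def)
    show "\<forall>p\<in>set ?ps. norm (snd p) = 1" using \<gamma>(1) normC by auto
    have "(\<Sum>Q\<leftarrow>Qs. norm (Complexification (Q \<cdot> ?x) (Q \<cdot> ?y)
        - scaleC (\<gamma> Q) (Complexification (Q \<cdot> ?M) 0))) \<le> (\<Sum>Q\<leftarrow>Qs. 2 * tan t * norm (Q \<cdot> ?M))"
      by (rule sum_list_mono) (rule err)
    also have "\<dots> = 2 * tan t * norm ?M"
      by (simp add: sum_list_const_mult resolution_sum_norm[OF Qs modulus_nonneg])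
    also have "\<dots> \<le> \<epsilon>" using N(2) by (simp add: t_def)
    finally show "(\<Sum>p\<leftarrow>?ps. norm (Complexification (fst p \<cdot> ?x) (fst p \<cdot> ?y)
        - scaleC (snd p) (Complexification (fst p \<cdot> ?M) 0))) \<le> \<epsilon>" by (simp add: o_def)
  qed
qed

lemma al_scalars_complex:
  "al_scalars (scaleC :: complex \<Rightarrow> 'a::al_space complexification \<Rightarrow> 'a complexification) modulus
    (\<lambda>x. Complexification x 0) re_part im_part \<i>"
proof (intro al_scalars.intro al_scalars_axioms.intro)
  show "vector_space (scaleC :: complex \<Rightarrow> 'a complexification \<Rightarrow> _)" by (rule vector_space_scaleC)
  show "scaleC (of_real r) z = r *\<^sub>R z" for r and z :: "'a complexification" by (rule scaleC_of_real)
  show "norm (modulus z) = norm z" for z :: "'a complexification" by (simp add: norm_complexification_def)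
  show "0 \<le> modulus z" for z :: "'a complexification" by (rule modulus_nonneg)
  show "modulus (z + w) \<le> modulus z + modulus w" for z w :: "'a complexification"
  proof (rule modulus_le)
    fix t :: real
    show "cos t *\<^sub>R re_part (z + w) + sin t *\<^sub>R im_part (z + w) \<le> modulus z + modulus w"
      using add_mono[OF modulus_ge[of t z] modulus_ge[of t w]] by (simp add: plus_complexification_def algebra_simps)
  qed
  show "modulus (scaleC c z) \<le> norm c *\<^sub>R modulus z" for c and z :: "'a complexification" by (rule modulus_scaleC_le)
  show "Real_Vector_Spaces.linear (\<lambda>x :: 'a. Complexification x 0)" "Real_Vector_Spaces.linear (re_part :: 'a complexification \<Rightarrow> _)"
    "Real_Vector_Spaces.linear (im_part :: 'a complexification \<Rightarrow> _)"
    by (auto intro!: linearI simp: complexification_arith_defs)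
  show "modulus (Complexification x 0) = \<bar>x\<bar>" for x :: 'a
    using modulus_le_add[of "Complexification x 0"] abs_re_part_le_modulus[of "Complexification x 0"] by simp
  show "z = Complexification (re_part z) 0 + scaleC \<i> (Complexification (im_part z) 0)" for z :: "'a complexification"
    by (simp add: scaleC_def plus_complexification_def)
  show "\<exists>a b. c = of_real a + of_real b * \<i> \<and> (b = 0 \<or> \<i> * \<i> = - 1) \<and>
      re_part (scaleC c z) = a *\<^sub>R re_part z - b *\<^sub>R im_part z \<and> im_part (scaleC c z) = a *\<^sub>R im_part z + b *\<^sub>R re_part z"
    for c and z :: "'a complexification"
    by (intro exI[of _ "Re c"] exI[of _ "Im c"]) (simp add: scaleC_def complex_eq_iff)
  show "norm (of_real (\<psi> \<cdot> re_part z) + \<i> * of_real (\<psi> \<cdot> im_part z)) \<le> \<psi> \<cdot> modulus z"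
    if pos: "\<And>x. 0 \<le> x \<Longrightarrow> 0 \<le> \<psi> \<cdot> x" for \<psi> and z :: "'a complexification"
  proof -
    let ?p = "\<psi> \<cdot> re_part z" and ?q = "\<psi> \<cdot> im_part z"
    define w where "w = Complex ?p ?q"
    define a where "a = Arg w"
    have w: "w = rcis (cmod w) a" by (simp add: a_def rcis_cmod_Arg)
    have "?p = cmod w * cos a" using arg_cong[OF w, of Re] by (simp add: w_def)
    moreover have "?q = cmod w * sin a" using arg_cong[OF w, of Im] by (simp add: w_def)
    ultimately have "cos a * ?p + sin a * ?q = cmod w * ((cos a)\<^sup>2 + (sin a)\<^sup>2)"
      by (simp only: power2_eq_square distrib_left mult_ac)
    hence "cmod w = \<psi> \<cdot> (cos a *\<^sub>R re_part z + sin a *\<^sub>R im_part z)"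
      by (simp add: blinfun.add_right blinfun.scaleR_right)
    also have "\<dots> \<le> \<psi> \<cdot> modulus z"
      using pos[of "modulus z - (cos a *\<^sub>R re_part z + sin a *\<^sub>R im_part z)"] modulus_ge[of a z]
      by (simp add: blinfun.diff_right)
    also have "w = of_real ?p + \<i> * of_real ?q" by (simp add: w_def complex_eq_iff)
    finally show ?thesis .
  qed
  show "\<exists>ps :: (('a \<Rightarrow>\<^sub>L 'a) \<times> complex) list. resolution (map fst ps) \<and> (\<forall>p\<in>set ps. norm (snd p) = 1) \<and>
      (\<Sum>p\<leftarrow>ps. norm (Complexification (fst p \<cdot> re_part z) 0
        + scaleC \<i> (Complexification (fst p \<cdot> im_part z) 0)
        - scaleC (snd p) (Complexification (fst p \<cdot> modulus z) 0))) \<le> \<epsilon>"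
    if "0 < \<epsilon>" for \<epsilon> and z :: "'a complexification"
  proof -
    have e: "Complexification a 0 + scaleC \<i> (Complexification b 0) = Complexification a b" for a b :: 'a
      by (simp add: scaleC_def plus_complexification_def)
    show ?thesis unfolding e by (rule polar_complexification[OF that])
  qed
qed (auto simp: abs_re_part_le_modulus abs_im_part_le_modulus)

theorem corollary1p11:
  shows "bonsall_minimal
           (weak_calkin_algebra (scaleR :: real \<Rightarrow> 'a::al_space \<Rightarrow> 'a))
           weak_essential_norm
       \<and> bonsall_minimal
           (weak_calkin_algebra
             (scaleC :: complex \<Rightarrow> 'a complexification \<Rightarrow> 'a complexification))
           weak_essential_norm"
proof
  interpret R: al_scalars "scaleR :: real \<Rightarrow> 'a \<Rightarrow> 'a" abs "\<lambda>x. x" "\<lambda>x. x" "\<lambda>_. 0" 0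
    by (rule al_scalars_real)
  show "bonsall_minimal (weak_calkin_algebra (scaleR :: real \<Rightarrow> 'a \<Rightarrow> 'a)) weak_essential_norm"
    by (rule R.bonsall_minimal_weak_essential_norm)
  interpret C: al_scalars "scaleC :: complex \<Rightarrow> 'a complexification \<Rightarrow> 'a complexification" modulus
    "\<lambda>x. Complexification x 0" re_part im_part \<i>
    by (rule al_scalars_complex)
  show "bonsall_minimal (weak_calkin_algebra (scaleC :: complex \<Rightarrow> 'a complexification \<Rightarrow> 'a complexification))
      weak_essential_norm"
    by (rule C.bonsall_minimal_weak_essential_norm)
qed

end
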